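(* Let $\mathcal{A},\mathcal{B}$ be two unital $C^*$-algebras. Let $T:\mathcal{A}\to\mathcal{B}$ be a cb-isomorphism with $T(1)=1$ and $\|T\|_{cb}\|T^{-1}\|_{cb}<\sqrt{2}$. Then $$\|T^\vee\|_{cb}\leq 2\sqrt{\Big(\|T\|_{cb}+\frac{\mu(T)}{\sqrt2}\Big)^2-1}+\mu(T)\,(1+\|T\|_{cb}),$$ $$\|T-T^\star\|_{cb}\leq 2\sqrt{\Big(\|T\|_{cb}+\frac{\mu(T)}{\sqrt2}\Big)^2-1}+2\mu(T),$$ where $$\mu(T)=\max\Big\{\|T\|_{cb}-1,\ 1-\sqrt{\frac{2}{\|T^{-1}\|_{cb}^2}-\|T\|_{cb}^2}\Big\}.$$
   Context: A cb-isomorphism is a completely bounded linear bijection whose inverse is completely bounded. The defect of multiplicativity of $T$ is the bilinear map $T^\vee:\mathcal{A}\times\mathcal{A}\to\mathcal{B}$, $T^\vee(a,b)=T(ab)-T(a)T(b)$; its completely bounded norm $\|T^\vee\|_{cb}$ is the cb-norm of the induced linear map $\mathcal{A}\otimes_h\mathcal{A}\to\mathcal{B}$ on the Haagerup tensor product. The map $T^\star:\mathcal{A}\to\mathcal{B}$ is defined by $T^\star(x)=T(x^* )^*$. *)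

theory Defs
  imports Complex_Main "HOL-Library.Multiset" "Jordan_Normal_Form.Matrix"
begin

section \<open>Complex vector spaces and unital C*-algebras\<close>

class complex_vector = ab_group_add +
  fixes scaleC :: "complex \<Rightarrow> 'a \<Rightarrow> 'a" (infixr \<open>*\<^sub>C\<close> 75)
  assumes scaleC_add_right: "c *\<^sub>C (x + y) = c *\<^sub>C x + c *\<^sub>C y"
    and scaleC_add_left: "(c + d) *\<^sub>C x = c *\<^sub>C x + d *\<^sub>C x"
    and scaleC_scaleC: "c *\<^sub>C d *\<^sub>C x = (c * d) *\<^sub>C x"
    and scaleC_one: "1 *\<^sub>C x = x"

lemma vector_space_scaleC: "vector_space (scaleC :: complex \<Rightarrow> 'a \<Rightarrow> 'a::complex_vector)"
  by unfold_locales (simp_all add: scaleC_add_right scaleC_add_left scaleC_scaleC scaleC_one)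

abbreviation complex_linear :: "('a::complex_vector \<Rightarrow> 'b::complex_vector) \<Rightarrow> bool" where
  "complex_linear \<equiv> Vector_Spaces.linear (*\<^sub>C) (*\<^sub>C)"

definition complex_bilinear ::
  "('a::complex_vector \<Rightarrow> 'b::complex_vector \<Rightarrow> 'c::complex_vector) \<Rightarrow> bool" where
  "complex_bilinear \<phi> \<longleftrightarrow>
     (\<forall>a. complex_linear (\<lambda>b. \<phi> a b)) \<and> (\<forall>b. complex_linear (\<lambda>a. \<phi> a b))"

text \<open>
  \<^class>\<open>real_normed_algebra_1\<close> contains \<^prop>\<open>norm 1 = 1\<close>, which follows from the C*-identity
  in every nonzero algebra; the zero algebra is thereby excluded.
\<close>

class unital_cstar_algebra = complex_vector + real_normed_algebra_1 + complete_space +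
  fixes star :: "'a \<Rightarrow> 'a"
  assumes scaleR_scaleC: "r *\<^sub>R x = complex_of_real r *\<^sub>C x"
    and mult_scaleC_left: "(c *\<^sub>C x) * y = c *\<^sub>C (x * y)"
    and mult_scaleC_right: "x * (c *\<^sub>C y) = c *\<^sub>C (x * y)"
    and norm_scaleC: "norm (c *\<^sub>C x) = cmod c * norm x"
    and star_star: "star (star x) = x"
    and star_add: "star (x + y) = star x + star y"
    and star_scaleC: "star (c *\<^sub>C x) = cnj c *\<^sub>C star x"
    and star_mult: "star (x * y) = star y * star x"
    and cstar_identity: "norm (star x * x) = (norm x)\<^sup>2"

instantiation complex :: unital_cstar_algebra
begin

definition scaleC_complex :: "complex \<Rightarrow> complex \<Rightarrow> complex" where
  "scaleC_complex = (*)"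

definition star_complex :: "complex \<Rightarrow> complex" where
  "star_complex = cnj"

instance
  by standard
    (simp_all add: scaleC_complex_def star_complex_def algebra_simps norm_mult power2_eq_square
      scaleR_conv_of_real)

end


section \<open>Matrices over a C*-algebra\<close>

definition mat_star :: "'a::unital_cstar_algebra mat \<Rightarrow> 'a mat" where
  "mat_star X = map_mat star (transpose_mat X)"

text \<open>
  The norm \<open>N\<close> turns the *-algebra of \<open>n \<times> n\<close> matrices over \<open>'a\<close> into a C*-algebra.  The first
  conjunct fixes the irrelevant values outside the carrier, so that there is exactly one such \<open>N\<close>.
\<close>

definition is_matrix_cstar_norm :: "nat \<Rightarrow> ('a::unital_cstar_algebra mat \<Rightarrow> real) \<Rightarrow> bool" where
  "is_matrix_cstar_norm n N \<longleftrightarrow>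
     (\<forall>X. X \<notin> carrier_mat n n \<longrightarrow> N X = 0) \<and>
     (\<forall>X \<in> carrier_mat n n. 0 \<le> N X \<and> (N X = 0 \<longleftrightarrow> X = 0\<^sub>m n n)) \<and>
     (\<forall>X \<in> carrier_mat n n. \<forall>Y \<in> carrier_mat n n. N (X + Y) \<le> N X + N Y) \<and>
     (\<forall>c. \<forall>X \<in> carrier_mat n n. N (map_mat ((*\<^sub>C) c) X) = cmod c * N X) \<and>
     (\<forall>X \<in> carrier_mat n n. \<forall>Y \<in> carrier_mat n n. N (X * Y) \<le> N X * N Y) \<and>
     (\<forall>X \<in> carrier_mat n n. N (mat_star X * X) = (N X)\<^sup>2) \<and>
     (\<forall>S :: nat \<Rightarrow> 'a mat. (\<forall>k. S k \<in> carrier_mat n n) \<longrightarrow>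
        (\<forall>e>0. \<exists>K. \<forall>k\<ge>K. \<forall>l\<ge>K. N (S k - S l) < e) \<longrightarrow>
        (\<exists>L \<in> carrier_mat n n. (\<lambda>k. N (S k - L)) \<longlonglongrightarrow> 0))"

text \<open>The unique C*-norm of \<open>M\<^sub>n(A)\<close>.\<close>

definition cstar_norm :: "nat \<Rightarrow> 'a::unital_cstar_algebra mat \<Rightarrow> real" where
  "cstar_norm n = (THE N. is_matrix_cstar_norm n N)"

text \<open>Rectangular matrices are normed as corners of square ones, by adding zero rows or columns.\<close>

definition rect_norm :: "'a::unital_cstar_algebra mat \<Rightarrow> real" where
  "rect_norm X =
     (let m = max (dim_row X) (dim_col X)
      in cstar_norm m
           (mat m m (\<lambda>(i, j). if i < dim_row X \<and> j < dim_col X then X $$ (i, j) else 0)))"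


section \<open>Completely bounded maps\<close>

text \<open>
  A matrix-normed space is given by a family \<open>M\<close>, where \<open>M n\<close> is the norm of \<open>n \<times> n\<close> matrices;
  the amplification of \<open>f\<close> to \<open>n \<times> n\<close> matrices is \<^term>\<open>map_mat f\<close>.  As \<^term>\<open>cb_norm M N f\<close> is
  a supremum of reals, it is only meaningful if \<^term>\<open>completely_bounded M N f\<close>.
\<close>

type_synonym 'a matrix_norms = "nat \<Rightarrow> 'a mat \<Rightarrow> real"

definition amplification_norms ::
  "'a matrix_norms \<Rightarrow> 'b matrix_norms \<Rightarrow> ('a \<Rightarrow> 'b) \<Rightarrow> real set" where
  "amplification_norms M N f =
     {N n (map_mat f X) | n X. 1 \<le> n \<and> X \<in> carrier_mat n n \<and> M n X \<le> 1}"

definition completely_bounded ::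
  "'a::complex_vector matrix_norms \<Rightarrow> 'b::complex_vector matrix_norms \<Rightarrow> ('a \<Rightarrow> 'b) \<Rightarrow> bool" where
  "completely_bounded M N f \<longleftrightarrow> complex_linear f \<and> bdd_above (amplification_norms M N f)"

definition cb_norm ::
  "'a::complex_vector matrix_norms \<Rightarrow> 'b::complex_vector matrix_norms \<Rightarrow> ('a \<Rightarrow> 'b) \<Rightarrow> real" where
  "cb_norm M N f = Sup (amplification_norms M N f)"

abbreviation cb_map :: "('a::unital_cstar_algebra \<Rightarrow> 'b::unital_cstar_algebra) \<Rightarrow> bool" where
  "cb_map \<equiv> completely_bounded cstar_norm cstar_norm"

abbreviation cb_map_norm ::
  "('a::unital_cstar_algebra \<Rightarrow> 'b::unital_cstar_algebra) \<Rightarrow> real" (\<open>\<parallel>_\<parallel>\<^sub>c\<^sub>b\<close>) where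
  "\<parallel>T\<parallel>\<^sub>c\<^sub>b \<equiv> cb_norm cstar_norm cstar_norm T"

text \<open>\<open>inv_into UNIV\<close> is written out because HOL-Algebra overrides the notation \<open>inv\<close>.\<close>

definition cb_isomorphism :: "('a::unital_cstar_algebra \<Rightarrow> 'b::unital_cstar_algebra) \<Rightarrow> bool" where
  "cb_isomorphism T \<longleftrightarrow> cb_map T \<and> bij T \<and> cb_map (inv_into UNIV T)"


section \<open>The algebraic tensor product\<close>

text \<open>Finite formal sums of pairs modulo the bilinearity relations.\<close>

inductive tensor_rel ::
  "('a::complex_vector \<times> 'b::complex_vector) multiset \<Rightarrow> ('a \<times> 'b) multiset \<Rightarrow> bool" where
  refl: "tensor_rel s s"
| sym: "tensor_rel s t \<Longrightarrow> tensor_rel t s"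
| trans: "tensor_rel s t \<Longrightarrow> tensor_rel t u \<Longrightarrow> tensor_rel s u"
| plus: "tensor_rel s s' \<Longrightarrow> tensor_rel t t' \<Longrightarrow> tensor_rel (s + t) (s' + t')"
| add_left: "tensor_rel {#(a + a', b)#} {#(a, b), (a', b)#}"
| add_right: "tensor_rel {#(a, b + b')#} {#(a, b), (a, b')#}"
| scale: "tensor_rel {#(c *\<^sub>C a, b)#} {#(a, c *\<^sub>C b)#}"
| zero: "tensor_rel {#(0, b)#} {#}"

quotient_type (overloaded) ('a, 'b) tensor =
  "('a::complex_vector \<times> 'b::complex_vector) multiset" / tensor_rel
  by (intro equivpI reflpI sympI transpI) (auto intro: tensor_rel.intros)

lift_definition tensor :: "'a::complex_vector \<Rightarrow> 'b::complex_vector \<Rightarrow> ('a, 'b) tensor"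
  (infixl \<open>\<otimes>\<^sub>t\<close> 70) is "\<lambda>a b. {#(a, b)#}" .

lemma scaleC_zero [simp]: "0 *\<^sub>C x = (0 :: 'a)" "c *\<^sub>C 0 = (0 :: 'a::complex_vector)"
proof -
  interpret vector_space "scaleC :: complex \<Rightarrow> 'a \<Rightarrow> 'a"
    by (rule vector_space_scaleC)
  show "0 *\<^sub>C x = (0 :: 'a)" "c *\<^sub>C 0 = (0 :: 'a)"
    by simp_all
qed

lemma tensor_rel_scale:
  "tensor_rel s t \<Longrightarrow>
   tensor_rel (image_mset (map_prod ((*\<^sub>C) c) id) s) (image_mset (map_prod ((*\<^sub>C) c) id) t)"
proof (induction rule: tensor_rel.induct)
  case (scale d a b)
  then show ?case
    using tensor_rel.scale[of d "c *\<^sub>C a" b] by (simp add: scaleC_scaleC mult.commute)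
next
  case (zero b)
  then show ?case by (simp add: tensor_rel.zero)
qed (auto simp: scaleC_add_right intro: tensor_rel.intros)

lemma tensor_rel_scale_add:
  "tensor_rel (image_mset (map_prod ((*\<^sub>C) (c + d)) id) s)
     (image_mset (map_prod ((*\<^sub>C) c) id) s + image_mset (map_prod ((*\<^sub>C) d) id) s)"
proof (induction s)
  case empty
  then show ?case by (simp add: tensor_rel.refl)
next
  case (add p s)
  obtain a b where p: "p = (a, b)" by (cases p)
  have "tensor_rel {#((c + d) *\<^sub>C a, b)#} {#(c *\<^sub>C a, b), (d *\<^sub>C a, b)#}"
    by (simp add: scaleC_add_left tensor_rel.add_left)
  from tensor_rel.plus[OF this add] show ?case
    by (simp add: p ac_simps add_mset_commute)
qed

instantiation tensor :: (complex_vector, complex_vector) complex_vector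
begin

lift_definition zero_tensor :: "('a, 'b) tensor" is "{#}" .

lift_definition plus_tensor :: "('a, 'b) tensor \<Rightarrow> ('a, 'b) tensor \<Rightarrow> ('a, 'b) tensor"
  is "(+)" by (rule tensor_rel.plus)

lift_definition scaleC_tensor :: "complex \<Rightarrow> ('a, 'b) tensor \<Rightarrow> ('a, 'b) tensor"
  is "\<lambda>c. image_mset (map_prod ((*\<^sub>C) c) id)" by (rule tensor_rel_scale)

definition uminus_tensor :: "('a, 'b) tensor \<Rightarrow> ('a, 'b) tensor" where
  "uminus_tensor u = (-1) *\<^sub>C u"

definition minus_tensor :: "('a, 'b) tensor \<Rightarrow> ('a, 'b) tensor \<Rightarrow> ('a, 'b) tensor" where
  "minus_tensor u v = u + - v"

instance
proof
  fix u v w :: "('a, 'b) tensor" and c d :: complex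
  show "u + v + w = u + (v + w)"
    by transfer (simp add: ac_simps tensor_rel.refl)
  show "u + v = v + u"
    by transfer (simp add: ac_simps tensor_rel.refl)
  show "0 + u = u"
    by transfer (simp add: tensor_rel.refl)
  show add: "(c + d) *\<^sub>C u = c *\<^sub>C u + d *\<^sub>C u" for c d
    by transfer (rule tensor_rel_scale_add)
  show "c *\<^sub>C (u + v) = c *\<^sub>C u + c *\<^sub>C v"
    by transfer (simp add: tensor_rel.refl)
  show "c *\<^sub>C d *\<^sub>C u = (c * d) *\<^sub>C u"
    by transfer
      (simp add: multiset.map_comp comp_def map_prod_def case_prod_unfold scaleC_scaleC
        tensor_rel.refl)
  show one: "1 *\<^sub>C u = u"
    by transfer (simp add: scaleC_one map_prod_def tensor_rel.refl)
  have zero: "0 *\<^sub>C u = 0"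
  proof transfer
    fix s :: "('a \<times> 'b) multiset"
    show "tensor_rel (image_mset (map_prod ((*\<^sub>C) 0) id) s) {#}"
    proof (induction s)
      case empty
      then show ?case by (simp add: tensor_rel.refl)
    next
      case (add p s)
      from tensor_rel.plus[OF tensor_rel.zero[of "snd p"] add] show ?case
        by (simp add: map_prod_def case_prod_unfold)
    qed
  qed
  show "- u + u = 0"
    using add[of "-1" 1] by (simp add: uminus_tensor_def one zero)
  show "u - v = u + - v"
    by (simp add: minus_tensor_def)
qed

end

text \<open>
  The linear map on the tensor product induced by a bilinear map, evaluated on a chosen
  representative; it is independent of the choice by the lemma following it.
\<close>

definition formal_sum_eval ::
  "('a \<Rightarrow> 'b \<Rightarrow> 'c::comm_monoid_add) \<Rightarrow> ('a \<times> 'b) multiset \<Rightarrow> 'c" where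
  "formal_sum_eval \<phi> s = (\<Sum>(a, b)\<in>#s. \<phi> a b)"

definition tensor_lift ::
  "('a::complex_vector \<Rightarrow> 'b::complex_vector \<Rightarrow> 'c::complex_vector) \<Rightarrow> ('a, 'b) tensor \<Rightarrow> 'c" where
  "tensor_lift \<phi> u = formal_sum_eval \<phi> (rep_tensor u)"

lemma complex_linear_iff:
  "complex_linear f \<longleftrightarrow> (\<forall>x y. f (x + y) = f x + f y) \<and> (\<forall>c x. f (c *\<^sub>C x) = c *\<^sub>C f x)"
  by (simp add: Vector_Spaces.linear_iff vector_space_scaleC)

lemma complex_bilinearD:
  assumes "complex_bilinear \<phi>"
  shows "\<phi> (a + a') b = \<phi> a b + \<phi> a' b" "\<phi> a (b + b') = \<phi> a b + \<phi> a b'"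
    "\<phi> (c *\<^sub>C a) b = c *\<^sub>C \<phi> a b" "\<phi> a (c *\<^sub>C b) = c *\<^sub>C \<phi> a b" "\<phi> 0 b = 0"
proof -
  show "\<phi> (a + a') b = \<phi> a b + \<phi> a' b" "\<phi> a (b + b') = \<phi> a b + \<phi> a b'"
    and *: "\<phi> (c *\<^sub>C a) b = c *\<^sub>C \<phi> a b" "\<phi> a (c *\<^sub>C b) = c *\<^sub>C \<phi> a b" for c
    using assms by (simp_all add: complex_bilinear_def complex_linear_iff)
  show "\<phi> 0 b = 0"
    using *(1)[of 0] by simp
qed

lemma formal_sum_eval_cong:
  assumes "complex_bilinear \<phi>"
  shows "tensor_rel s t \<Longrightarrow> formal_sum_eval \<phi> s = formal_sum_eval \<phi> t"
  by (induction rule: tensor_rel.induct)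
    (simp_all add: formal_sum_eval_def complex_bilinearD[OF assms])

lemma tensor_lift_abs:
  assumes "complex_bilinear \<phi>"
  shows "tensor_lift \<phi> (abs_tensor s) = formal_sum_eval \<phi> s"
  unfolding tensor_lift_def
  by (intro formal_sum_eval_cong[OF assms] rep_abs_rsp_left[OF Quotient3_tensor] tensor_rel.refl)

lemma tensor_lift_tensor:
  assumes "complex_bilinear \<phi>"
  shows "tensor_lift \<phi> (a \<otimes>\<^sub>t b) = \<phi> a b"
  by (simp add: tensor.abs_eq tensor_lift_abs[OF assms] formal_sum_eval_def)

lemma complex_linear_tensor_lift:
  assumes "complex_bilinear \<phi>"
  shows "complex_linear (tensor_lift \<phi>)"
  unfolding complex_linear_iff
proof (intro conjI allI)
  fix u v :: "('a, 'b) tensor" and c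
  obtain s t where u: "u = abs_tensor s" and v: "v = abs_tensor t"
    by (metis Quotient3_abs_rep[OF Quotient3_tensor])
  show "tensor_lift \<phi> (u + v) = tensor_lift \<phi> u + tensor_lift \<phi> v"
    by (simp add: u v plus_tensor.abs_eq tensor_lift_abs[OF assms] formal_sum_eval_def)
  have "formal_sum_eval \<phi> (image_mset (map_prod ((*\<^sub>C) c) id) s) = c *\<^sub>C formal_sum_eval \<phi> s"
    by (induction s)
      (auto simp: formal_sum_eval_def complex_bilinearD[OF assms] scaleC_add_right)
  then show "tensor_lift \<phi> (c *\<^sub>C u) = c *\<^sub>C tensor_lift \<phi> u"
    by (simp add: u scaleC_tensor.abs_eq tensor_lift_abs[OF assms])
qed


section \<open>The Haagerup tensor product\<close>

text \<open>\<open>(X \<odot>\<^sub>h Y)\<^sub>i\<^sub>j = \<Sum>\<^sub>k X\<^sub>i\<^sub>k \<otimes> Y\<^sub>k\<^sub>j\<close>\<close>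

definition tensor_mat_prod ::
  "'a::complex_vector mat \<Rightarrow> 'b::complex_vector mat \<Rightarrow> ('a, 'b) tensor mat" (infixl \<open>\<odot>\<^sub>h\<close> 70) where
  "X \<odot>\<^sub>h Y = mat (dim_row X) (dim_col Y) (\<lambda>(i, j). \<Sum>k<dim_col X. X $$ (i, k) \<otimes>\<^sub>t Y $$ (k, j))"

definition haagerup_norm ::
  "nat \<Rightarrow> ('a::unital_cstar_algebra, 'b::unital_cstar_algebra) tensor mat \<Rightarrow> real" where
  "haagerup_norm n U =
     Inf {rect_norm X * rect_norm Y | p X Y.
            X \<in> carrier_mat n p \<and> Y \<in> carrier_mat p n \<and> X \<odot>\<^sub>h Y = U}"

text \<open>
  The Haagerup tensor product is the completion of the algebraic tensor product with respect to
  these norms.  A completely bounded map extends uniquely to the completion with the same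
  cb-norm, so the induced map is considered on the dense algebraic tensor product.
\<close>

definition cb_bilinear ::
  "('a::unital_cstar_algebra \<Rightarrow> 'b::unital_cstar_algebra \<Rightarrow> 'c::unital_cstar_algebra) \<Rightarrow> bool" where
  "cb_bilinear \<phi> \<longleftrightarrow>
     complex_bilinear \<phi> \<and> completely_bounded haagerup_norm cstar_norm (tensor_lift \<phi>)"

definition cb_bilinear_norm ::
  "('a::unital_cstar_algebra \<Rightarrow> 'b::unital_cstar_algebra \<Rightarrow> 'c::unital_cstar_algebra) \<Rightarrow> real" where
  "cb_bilinear_norm \<phi> = cb_norm haagerup_norm cstar_norm (tensor_lift \<phi>)"


section \<open>Multiplicativity defect, conjugate map and \<open>\<mu>\<close>\<close>

definition mult_defect ::
  "('a::unital_cstar_algebra \<Rightarrow> 'b::unital_cstar_algebra) \<Rightarrow> 'a \<Rightarrow> 'a \<Rightarrow> 'b" where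
  "mult_defect T a b = T (a * b) - T a * T b"

definition star_map ::
  "('a::unital_cstar_algebra \<Rightarrow> 'b::unital_cstar_algebra) \<Rightarrow> 'a \<Rightarrow> 'b" where
  "star_map T x = star (T (star x))"

definition mu :: "('a::unital_cstar_algebra \<Rightarrow> 'b::unital_cstar_algebra) \<Rightarrow> real" where
  "mu T = max (\<parallel>T\<parallel>\<^sub>c\<^sub>b - 1) (1 - sqrt (2 / \<parallel>inv_into UNIV T\<parallel>\<^sub>c\<^sub>b\<^sup>2 - \<parallel>T\<parallel>\<^sub>c\<^sub>b\<^sup>2))"

end

theory Submission
  imports Defs
begin

text \<open>
A unital linear map that almost preserves the norms of all matrices almost preserves isometries,
and therefore products and adjoints.  Let \<open>S\<close> and \<open>R\<close> be the completely bounded norms of \<open>T\<close>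
and of its inverse, write \<open>T\<close> also for its amplifications, let \<open>s = sqrt (2 / R\<^sup>2 - S\<^sup>2)\<close>, which is
defined and positive because \<open>S * R < sqrt 2\<close>, and \<open>\<mu> = max (S - 1) (1 - s)\<close>.  The proof has three
ideas.

First, the image \<open>z = T U\<close> of a matrix \<open>U\<close> with \<open>U\<^sup>* U = 1\<close> lies within \<open>\<mu>\<close> of an isometry
(\<open>image_near_isometry\<close>).  The upper bound \<open>z\<^sup>* z \<le> S\<^sup>2\<close> is clear.  For the lower bound, a column with
entries \<open>U\<close> and \<open>Y\<close> has squared norm \<open>1 + \<parallel>Y\<parallel>\<^sup>2\<close>, and this is nearly preserved by \<open>T\<close>; testing the
column with entries \<open>z\<close> and \<open>Y\<close> against a \<open>Y\<close> that is large where \<open>z\<^sup>* z\<close> is small gives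
\<open>s\<^sup>2 \<le> z\<^sup>* z\<close> (\<open>image_lower_bound\<close>).  The polar decomposition of \<open>z\<close> does the rest.

Second, let \<open>U\<close> and \<open>V\<close> be isometries, and let \<open>u\<close> and \<open>v\<close> be isometries within \<open>\<mu>\<close> of \<open>T U\<close> and \<open>T V\<close>.
The block matrix with rows \<open>(1, -V)\<close> and \<open>(U, U V)\<close> is \<open>sqrt 2\<close> times an isometry, so its image
under \<open>T\<close> has norm at most \<open>sqrt 2 * S\<close>.  Applied to the column with entries \<open>v\<close> and \<open>-1\<close>, this image
gives, up to an error \<open>sqrt 2 * \<mu>\<close>, the column with entries \<open>2 v\<close> and \<open>D = u v - T (U V)\<close>, of
squared norm \<open>4 + \<parallel>D\<parallel>\<^sup>2\<close>.  Hence \<open>\<parallel>D\<parallel> \<le> 2 * sqrt ((S + \<mu> / sqrt 2)\<^sup>2 - 1)\<close> (\<open>product_estimate\<close>).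
Replacing \<open>u v\<close> by \<open>T U * T V\<close> costs \<open>\<mu> * (1 + S)\<close>; and for unitary \<open>U\<close> with \<open>V = U\<^sup>*\<close> the same estimate
says that \<open>v\<close> is close to \<open>u\<^sup>*\<close>, which compares \<open>T (U\<^sup>*)\<close> with \<open>(T U)\<^sup>*\<close> at the cost of \<open>2 * \<mu>\<close>.

Third, since matrices of all sizes are admitted, contractions reduce to unitaries: every
contraction is a corner of a self-adjoint contraction of twice the size, and this is the average
of a unitary and its adjoint (\<open>selfadjoint_dilation\<close>).  A bilinear map is bounded on the Haagerup
tensor product as soon as it is bounded on pairs of contractive matrices \<open>X\<close>, \<open>Y\<close> with inner indices
of any range, and these are padded by zeros to square matrices.

All of this takes place in the C*-algebras of matrices, whose norm is characterised by being the
only C*-norm.  Its existence and uniqueness rest on the order of a C*-algebra, which is obtained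
without spectral theory from the one iteration that computes \<open>sqrt (1 - b)\<close> for \<open>\<parallel>b\<parallel> \<le> 1\<close>
(\<open>sqrt_one_minus\<close>).  The positive elements are thereby the squares of self-adjoint elements, a
purely algebraic notion that determines the norm; this is uniqueness.  Existence is provided by the
operator norm on the Hilbert module of columns, where the Cauchy-Schwarz inequality follows from
the positivity of \<open>x\<^sup>* x\<close> (\<open>pos_st_mult\<close>).
\<close>

section \<open>Complex algebras\<close>

class complex_algebra = complex_vector + ring +
  assumes alg_scaleC_left: "(c *\<^sub>C x) * y = c *\<^sub>C (x * y)"
    and alg_scaleC_right: "x * (c *\<^sub>C y) = c *\<^sub>C (x * y)"

instance unital_cstar_algebra < complex_algebra
  by standard (simp_all add: mult_scaleC_left mult_scaleC_right)

lemma scaleC_minus_right: "c *\<^sub>C (- x) = - (c *\<^sub>C (x::'a::complex_vector))"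
  using scaleC_add_right[of c x "-x"] by (simp add: eq_neg_iff_add_eq_0 add.commute)

lemma scaleC_minus_left: "(- c) *\<^sub>C x = - (c *\<^sub>C (x::'a::complex_vector))"
  using scaleC_add_left[of c "-c" x] by (simp add: eq_neg_iff_add_eq_0 add.commute)

lemma scaleC_diff_right: "c *\<^sub>C (x - y) = c *\<^sub>C x - c *\<^sub>C (y::'a::complex_vector)"
  using scaleC_add_right[of c x "-y"] by (simp add: scaleC_minus_right)

lemma scaleC_diff_left: "(c - d) *\<^sub>C x = c *\<^sub>C x - d *\<^sub>C (x::'a::complex_vector)"
  using scaleC_add_left[of c "-d" x] by (simp add: scaleC_minus_left)

lemma scaleC_minus_one: "(- 1) *\<^sub>C x = - (x::'a::complex_vector)"
  by (simp add: scaleC_minus_left scaleC_one)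

lemmas scaleC_simps = scaleC_add_right scaleC_diff_right scaleC_minus_right scaleC_scaleC
  scaleC_one scaleC_zero alg_scaleC_left alg_scaleC_right

abbreviation real_scale :: "real \<Rightarrow> 'a::complex_vector \<Rightarrow> 'a" (infixr \<open>*\<^sub>r\<close> 75) where
  "t *\<^sub>r x \<equiv> complex_of_real t *\<^sub>C x"

section \<open>C*-algebras as subsets of a ring\<close>

text \<open>
A unital C*-algebra that need not fill its type: \<open>C\<close> is the carrier, \<open>e\<close> the unit, \<open>st\<close> the involution
and \<open>N\<close> the norm.  The carrier is a subset because the size of the matrices below is a variable,
hence cannot be part of a type; the ambient ring makes the ring operations total, so that only
closure has to be tracked.
\<close>

locale cstar_subset =
  fixes C :: "'r::complex_algebra set" and e :: 'r and st :: "'r \<Rightarrow> 'r" and N :: "'r \<Rightarrow> real"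
  assumes e_in: "e \<in> C" and e_nonzero: "e \<noteq> 0"
    and e_left: "x \<in> C \<Longrightarrow> e * x = x" and e_right: "x \<in> C \<Longrightarrow> x * e = x"
    and add_in: "x \<in> C \<Longrightarrow> y \<in> C \<Longrightarrow> x + y \<in> C"
    and mult_in: "x \<in> C \<Longrightarrow> y \<in> C \<Longrightarrow> x * y \<in> C"
    and scale_in: "x \<in> C \<Longrightarrow> c *\<^sub>C x \<in> C"
    and st_in: "x \<in> C \<Longrightarrow> st x \<in> C"
    and st_st: "x \<in> C \<Longrightarrow> st (st x) = x"
    and st_add: "x \<in> C \<Longrightarrow> y \<in> C \<Longrightarrow> st (x + y) = st x + st y"
    and st_scale: "x \<in> C \<Longrightarrow> st (c *\<^sub>C x) = cnj c *\<^sub>C st x"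
    and st_mult: "x \<in> C \<Longrightarrow> y \<in> C \<Longrightarrow> st (x * y) = st y * st x"
    and N_nonneg: "x \<in> C \<Longrightarrow> 0 \<le> N x"
    and N_eq_0: "x \<in> C \<Longrightarrow> N x = 0 \<longleftrightarrow> x = 0"
    and N_triangle: "x \<in> C \<Longrightarrow> y \<in> C \<Longrightarrow> N (x + y) \<le> N x + N y"
    and N_scale: "x \<in> C \<Longrightarrow> N (c *\<^sub>C x) = cmod c * N x"
    and N_mult: "x \<in> C \<Longrightarrow> y \<in> C \<Longrightarrow> N (x * y) \<le> N x * N y"
    and N_cstar: "x \<in> C \<Longrightarrow> N (st x * x) = (N x)\<^sup>2"
    and N_complete: "(\<And>k. S k \<in> C) \<Longrightarrow>
      (\<And>d. d > 0 \<Longrightarrow> \<exists>K. \<forall>k\<ge>K. \<forall>l\<ge>K. N (S k - S l) < d) \<Longrightarrow>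
      \<exists>L\<in>C. (\<lambda>k. N (S k - L)) \<longlonglongrightarrow> 0"
begin

lemma zero_in: "0 \<in> C"
  using scale_in[OF e_in, of 0] by simp

lemma minus_in: "x \<in> C \<Longrightarrow> - x \<in> C"
  using scale_in[of x "-1"] by (simp add: scaleC_minus_one)

lemma diff_in: "x \<in> C \<Longrightarrow> y \<in> C \<Longrightarrow> x - y \<in> C"
  using add_in[of x "-y"] minus_in by simp

lemmas closed [simp, intro] = e_in add_in mult_in scale_in st_in zero_in minus_in diff_in

lemma st_zero: "st 0 = 0"
  using st_scale[OF e_in, of 0] by simp

lemma st_minus: "x \<in> C \<Longrightarrow> st (- x) = - st x"
  using st_scale[of x "-1"] by (simp add: scaleC_minus_one)

lemma st_diff: "x \<in> C \<Longrightarrow> y \<in> C \<Longrightarrow> st (x - y) = st x - st y"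
  using st_add[of x "-y"] by (simp add: st_minus)

lemma st_e: "st e = e"
  by (metis e_in e_right st_in st_mult st_st)

lemmas st_simps [simp] = st_st st_add st_scale st_mult st_zero st_minus st_diff st_e e_left e_right

lemma N_zero [simp]: "N 0 = 0"
  by (simp add: N_eq_0)

lemma N_e [simp]: "N e = 1"
proof -
  have "N e = (N e)\<^sup>2"
    using N_cstar[OF e_in] by simp
  moreover have "N e \<noteq> 0"
    using e_nonzero by (simp add: N_eq_0)
  ultimately show ?thesis
    by (simp add: power2_eq_square)
qed

lemma N_st [simp]:
  assumes "x \<in> C" shows "N (st x) = N x"
proof -
  have le: "N y \<le> N (st y)" if "y \<in> C" for y
  proof (cases "N y = 0")
    case True
    then show ?thesis using that N_nonneg by simp
  next
    case False
    then have "N y > 0" using N_nonneg[OF that] by simp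
    moreover have "N y * N y \<le> N (st y) * N y"
      using N_cstar[OF that] N_mult[of "st y" y] that by (simp add: power2_eq_square)
    ultimately show ?thesis by simp
  qed
  show ?thesis
    using le[of x] le[of "st x"] assms by simp
qed

lemma N_minus [simp]: "x \<in> C \<Longrightarrow> N (- x) = N x"
  using N_scale[of x "-1"] by (simp add: scaleC_minus_one)

lemma N_diff_commute: "x \<in> C \<Longrightarrow> y \<in> C \<Longrightarrow> N (x - y) = N (y - x)"
  using N_minus[of "x - y"] by simp

lemma N_diff_triangle: "x \<in> C \<Longrightarrow> y \<in> C \<Longrightarrow> N (x - y) \<le> N x + N y"
  using N_triangle[of x "-y"] by simp

lemma N_scaleR: "x \<in> C \<Longrightarrow> N (t *\<^sub>r x) = \<bar>t\<bar> * N x"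
  by (simp add: N_scale)

lemma N_selfadjoint_sq: "x \<in> C \<Longrightarrow> st x = x \<Longrightarrow> N (x * x) = (N x)\<^sup>2"
  using N_cstar[of x] by simp

text \<open>
Convergence in the norm \<open>N\<close>.  As \<open>N\<close> is a parameter, it does not come from a topology on the type.
\<close>

definition conv :: "(nat \<Rightarrow> 'r) \<Rightarrow> 'r \<Rightarrow> bool" where
  "conv S L \<longleftrightarrow> (\<forall>k. S k \<in> C) \<and> L \<in> C \<and> (\<lambda>k. N (S k - L)) \<longlonglongrightarrow> 0"

lemma convI:
  assumes "\<And>k. S k \<in> C" "L \<in> C" "\<And>k. N (S k - L) \<le> b k" "b \<longlonglongrightarrow> 0"
  shows "conv S L"
  unfolding conv_def
proof (intro conjI allI)
  show "(\<lambda>k. N (S k - L)) \<longlonglongrightarrow> 0"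
    using assms N_nonneg by (intro tendsto_sandwich[OF _ _ tendsto_const assms(4)]) auto
qed (use assms in auto)

lemma conv_unique:
  assumes "conv S L" "conv S L'"
  shows "L = L'"
proof -
  have "(\<lambda>k. N (S k - L) + N (S k - L')) \<longlonglongrightarrow> 0 + 0"
    using assms by (intro tendsto_add) (auto simp: conv_def)
  moreover have "N (L - L') \<le> N (S k - L) + N (S k - L')" for k
  proof -
    have "L - L' = (S k - L') - (S k - L)" by simp
    then show ?thesis
      using N_diff_triangle[of "S k - L'" "S k - L"] assms by (simp add: conv_def)
  qed
  ultimately have "N (L - L') \<le> 0"
    by (intro LIMSEQ_le_const[where x = 0]) auto
  then show ?thesis
    using N_nonneg[of "L - L'"] N_eq_0[of "L - L'"] assms by (auto simp: conv_def)
qed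

lemma conv_const: "x \<in> C \<Longrightarrow> conv (\<lambda>k. x) x"
  by (simp add: conv_def)

lemma conv_add:
  assumes "conv S L" "conv S' L'"
  shows "conv (\<lambda>k. S k + S' k) (L + L')"
proof (rule convI)
  show "(\<lambda>k. N (S k - L) + N (S' k - L')) \<longlonglongrightarrow> 0"
    using tendsto_add[of "\<lambda>k. N (S k - L)" 0 sequentially "\<lambda>k. N (S' k - L')" 0] assms
    by (simp add: conv_def)
  show "N (S k + S' k - (L + L')) \<le> N (S k - L) + N (S' k - L')" for k
    using N_triangle[of "S k - L" "S' k - L'"] assms by (simp add: conv_def algebra_simps)
qed (use assms in \<open>auto simp: conv_def\<close>)

lemma conv_scale:
  assumes "conv S L"
  shows "conv (\<lambda>k. c *\<^sub>C S k) (c *\<^sub>C L)"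
proof (rule convI)
  show "(\<lambda>k. cmod c * N (S k - L)) \<longlonglongrightarrow> 0"
    using assms by (intro tendsto_mult_right_zero) (simp add: conv_def)
  show "N (c *\<^sub>C S k - c *\<^sub>C L) \<le> cmod c * N (S k - L)" for k
    using N_scale[of "S k - L" c] assms by (simp add: conv_def scaleC_diff_right)
qed (use assms in \<open>auto simp: conv_def\<close>)

lemma conv_st:
  assumes "conv S L"
  shows "conv (\<lambda>k. st (S k)) (st L)"
proof (rule convI)
  show "(\<lambda>k. N (S k - L)) \<longlonglongrightarrow> 0" using assms by (simp add: conv_def)
  show "N (st (S k) - st L) \<le> N (S k - L)" for k
    using assms by (simp add: conv_def del: st_diff flip: st_diff)
qed (use assms in \<open>auto simp: conv_def\<close>)

lemma conv_bounded:
  assumes "conv S L" "\<And>k. N (S k) \<le> r"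
  shows "N L \<le> r"
proof -
  have "(\<lambda>k. N (S k - L) + r) \<longlonglongrightarrow> 0 + r"
    using assms by (intro tendsto_add) (auto simp: conv_def)
  moreover have "N L \<le> N (S k - L) + r" for k
    using N_diff_triangle[of "S k" "S k - L"] assms(1) assms(2)[of k] by (simp add: conv_def)
  ultimately show ?thesis
    by (intro LIMSEQ_le_const[where x = r]) auto
qed

lemma conv_mult:
  assumes "conv S L" "conv S' L'" "\<And>k. N (S' k) \<le> r"
  shows "conv (\<lambda>k. S k * S' k) (L * L')"
proof (rule convI)
  show "(\<lambda>k. N (S k - L) * r + N L * N (S' k - L')) \<longlonglongrightarrow> 0"
    using tendsto_add[OF tendsto_mult_left_zero[of "\<lambda>k. N (S k - L)" _ r]
        tendsto_mult_right_zero[of "\<lambda>k. N (S' k - L')" _ "N L"]] assms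
    by (simp add: conv_def)
  fix k
  have in_C: "S k \<in> C" "L \<in> C" "S' k \<in> C" "L' \<in> C" using assms by (auto simp: conv_def)
  have "N (S k * S' k - L * L') = N ((S k - L) * S' k + L * (S' k - L'))"
    by (simp add: algebra_simps)
  also have "\<dots> \<le> N ((S k - L) * S' k) + N (L * (S' k - L'))"
    using in_C by (intro N_triangle) auto
  also have "\<dots> \<le> N (S k - L) * N (S' k) + N L * N (S' k - L')"
    using in_C by (intro add_mono N_mult) auto
  also have "\<dots> \<le> N (S k - L) * r + N L * N (S' k - L')"
    using in_C assms(3)[of k] N_nonneg by (intro add_mono mult_left_mono) auto
  finally show "N (S k * S' k - L * L') \<le> \<dots>" .
qed (use assms in \<open>auto simp: conv_def\<close>)

lemma conv_Suc: "conv S L \<Longrightarrow> conv (\<lambda>k. S (Suc k)) L"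
  unfolding conv_def using LIMSEQ_Suc[of "\<lambda>k. N (S k - L)" 0] by auto

text \<open>
The form of completeness that the iterations below use: the dominating real sequence is increasing
and bounded, so its differences are small, and they bound those of \<open>S\<close>.
\<close>

lemma conv_if_majorised:
  fixes s :: "nat \<Rightarrow> real"
  assumes S: "\<And>k. S k \<in> C" and maj: "\<And>k. N (S (Suc k) - S k) \<le> s (Suc k) - s k"
    and bound: "\<And>k. s k \<le> B"
  shows "\<exists>L. conv S L"
proof -
  have "s k \<le> s (Suc k)" for k
    using maj[of k] N_nonneg[of "S (Suc k) - S k"] S by simp
  then have "incseq s" by (rule incseq_SucI)
  then obtain l where "s \<longlonglongrightarrow> l" using incseq_convergent[of s B] bound by blast
  then have "Cauchy s" by (rule LIMSEQ_imp_Cauchy)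
  have diff: "N (S (k + j) - S k) \<le> s (k + j) - s k" for k j
  proof (induction j)
    case (Suc j)
    have "S (k + Suc j) - S k = (S (Suc (k + j)) - S (k + j)) + (S (k + j) - S k)" by simp
    then show ?case
      using Suc maj[of "k + j"] N_triangle[of "S (Suc (k + j)) - S (k + j)" "S (k + j) - S k"] S
      by simp
  qed simp
  have dist: "N (S k - S l) \<le> \<bar>s k - s l\<bar>" for k l
    using diff[of k "l - k"] diff[of l "k - l"] N_diff_commute[OF S S, of k l]
    by (cases "k \<le> l") auto
  have "\<exists>L\<in>C. (\<lambda>k. N (S k - L)) \<longlonglongrightarrow> 0"
  proof (rule N_complete[OF S])
    fix d :: real assume "d > 0"
    then obtain K where "\<forall>k\<ge>K. \<forall>l\<ge>K. \<bar>s k - s l\<bar> < d"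
      using \<open>Cauchy s\<close> by (auto simp: Cauchy_def dist_real_def)
    then show "\<exists>K. \<forall>k\<ge>K. \<forall>l\<ge>K. N (S k - S l) < d"
      using dist by (meson le_less_trans)
  qed
  then show ?thesis
    using S by (auto simp: conv_def)
qed

end

section \<open>Square roots\<close>

lemma le_if_powers_le_linear:
  fixes x t c :: real
  assumes t: "0 < t" and bound: "\<And>k. x ^ 2 ^ k \<le> t ^ 2 ^ k * (1 + 2 ^ k * c)"
  shows "x \<le> t"
proof (rule ccontr)
  assume "\<not> x \<le> t"
  then have x: "t < x" "0 < x" using t by auto
  define r where "r = t / x"
  have r: "norm r < 1" using x t by (simp add: r_def)
  have sub: "strict_mono (\<lambda>k::nat. (2::nat) ^ k)" by (simp add: strict_mono_def)
  have "(\<lambda>n. r ^ n + c * (of_nat n * r ^ n)) \<longlonglongrightarrow> 0 + c * 0"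
    by (intro tendsto_add tendsto_mult_left LIMSEQ_power_zero r powser_times_n_limit_0)
  from LIMSEQ_subseq_LIMSEQ[OF this sub]
  have "(\<lambda>k. r ^ 2 ^ k + c * (2 ^ k * r ^ 2 ^ k)) \<longlonglongrightarrow> 0"
    by (simp add: comp_def)
  moreover have "1 \<le> r ^ 2 ^ k + c * (2 ^ k * r ^ 2 ^ k)" for k
  proof -
    have "x ^ 2 ^ k * 1 \<le> x ^ 2 ^ k * (r ^ 2 ^ k * (1 + 2 ^ k * c))"
      using bound[of k] x by (simp add: r_def power_divide)
    then have "1 \<le> r ^ 2 ^ k * (1 + 2 ^ k * c)"
      using x by (subst (asm) mult_le_cancel_left_pos) auto
    then show ?thesis by (simp add: algebra_simps)
  qed
  ultimately show False
    using LIMSEQ_le_const[of _ 0 1] by fastforce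
qed

context cstar_subset
begin

text \<open>
With \<open>y = e - sqrt (e - b)\<close> the equation reads \<open>y = (b + y * y) / 2\<close>, which is solved by iteration
from \<open>0\<close>.  All iterates commute, so the step that follows successive iterates \<open>x'\<close>, \<open>x\<close> factors as
\<open>(x + x') * (x - x') / 2\<close> and is dominated by the step of the same iteration for the real number \<open>q\<close>,
which increases to \<open>1 - sqrt (1 - q)\<close>.  The case \<open>q = 1\<close> is included; it gives square roots of
positive elements that are not invertible.
\<close>

lemma sqrt_one_minus:
  assumes b: "b \<in> C" "st b = b" "N b \<le> q" "q \<le> 1"
  obtains y where "y \<in> C" "st y = y" "N y \<le> 1 - sqrt (1 - q)" "(e - y) * (e - y) = e - b"
    "\<And>x. x \<in> C \<Longrightarrow> x * b = b * x \<Longrightarrow> x * y = y * x"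
proof -
  define S where "S = rec_nat 0 (\<lambda>_ x. (1/2) *\<^sub>C (b + x * x))"
  define s where "s = rec_nat (0::real) (\<lambda>_ x. (q + x * x) / 2)"
  have S_0: "S 0 = 0" and S_Suc: "S (Suc k) = (1/2) *\<^sub>C (b + S k * S k)" for k
    by (simp_all add: S_def)
  have s_0: "s 0 = 0" and s_Suc: "s (Suc k) = (q + s k * s k) / 2" for k
    by (simp_all add: s_def)
  have q0: "0 \<le> q" using N_nonneg[OF b(1)] b(3) by simp
  \<comment> \<open>the fixed point of the real iteration\<close>
  define r where "r = 1 - sqrt (1 - q)"
  have "q + r * r = 2 * r"
    using b(4) real_sqrt_mult_self[of "1 - q"] by (simp add: r_def algebra_simps)
  then have r_fix: "(q + r * r) / 2 = r" by simp
  have r0: "0 \<le> r" using q0 b(4) by (simp add: r_def)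
  have s_nonneg: "0 \<le> s k" for k
    using q0 by (induction k) (auto simp: s_0 s_Suc)
  have s_le: "s k \<le> r" for k
  proof (induction k)
    case (Suc k)
    have "(q + s k * s k) / 2 \<le> (q + r * r) / 2"
      using mult_mono[OF Suc Suc] s_nonneg[of k] r0 by simp
    then show ?case by (simp add: s_Suc r_fix)
  qed (simp add: s_0 r0)
  have S_in: "S k \<in> C" for k
    using b(1) by (induction k) (auto simp: S_0 S_Suc)
  have S_st: "st (S k) = S k" for k
    using b S_in by (induction k) (auto simp: S_0 S_Suc)
  have N_S: "N (S k) \<le> s k" for k
  proof (induction k)
    case (Suc k)
    have "N (b + S k * S k) \<le> N b + N (S k) * N (S k)"
      using N_triangle[of b "S k * S k"] N_mult[of "S k" "S k"] b S_in by force
    also have "\<dots> \<le> q + s k * s k"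
      using b Suc N_nonneg[OF S_in] s_nonneg by (intro add_mono mult_mono) auto
    finally show ?case
      using b S_in by (simp add: S_Suc s_Suc N_scale)
  qed (simp add: S_0 s_0)
  have S_comm: "x * S k = S k * x" if x: "x \<in> C" "x * b = b * x" for x k
  proof (induction k)
    case (Suc k)
    have "x * (S k * S k) = S k * S k * x"
      by (metis Suc mult.assoc)
    then show ?case
      using x(2) by (simp add: S_Suc scaleC_simps distrib_left distrib_right)
  qed (simp add: S_0)
  have SS_comm: "S j * S k = S k * S j" for j k
    using S_comm[OF b(1) HOL.refl, of j] S_comm[OF S_in, of j k] by simp
  \<comment> \<open>both factors of the step are dominated by the corresponding real quantities\<close>
  have maj: "N (S (Suc k) - S k) \<le> s (Suc k) - s k" for k
  proof (induction k)
    case 0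
    then show ?case using b by (simp add: S_0 S_Suc s_0 s_Suc N_scale)
  next
    case (Suc k)
    have "S (Suc (Suc k)) - S (Suc k) = (1/2) *\<^sub>C ((b + S (Suc k) * S (Suc k)) - (b + S k * S k))"
      by (simp only: S_Suc scaleC_diff_right)
    also have "(b + S (Suc k) * S (Suc k)) - (b + S k * S k)
        = (S (Suc k) + S k) * (S (Suc k) - S k)"
      using SS_comm[of k "Suc k"] by (simp add: algebra_simps)
    finally have "N (S (Suc (Suc k)) - S (Suc k)) = N ((S (Suc k) + S k) * (S (Suc k) - S k)) / 2"
      using S_in by (simp add: N_scale)
    also have "\<dots> \<le> (N (S (Suc k) + S k) * N (S (Suc k) - S k)) / 2"
      using N_mult S_in by simp
    also have "\<dots> \<le> ((s (Suc k) + s k) * (s (Suc k) - s k)) / 2"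
      using N_triangle[OF S_in S_in, of "Suc k" k] N_S[of k] N_S[of "Suc k"] Suc s_nonneg[of k]
        s_nonneg[of "Suc k"] N_nonneg S_in
      by (intro divide_right_mono mult_mono) auto
    also have "\<dots> = s (Suc (Suc k)) - s (Suc k)"
    proof -
      have "2 * s (Suc k) = q + s k * s k" "2 * s (Suc (Suc k)) = q + s (Suc k) * s (Suc k)"
        by (simp_all add: s_Suc)
      moreover have "(s (Suc k) + s k) * (s (Suc k) - s k) = s (Suc k) * s (Suc k) - s k * s k"
        by (simp add: algebra_simps)
      ultimately show ?thesis by linarith
    qed
    finally show ?case .
  qed
  obtain y where y: "conv S y"
    using conv_if_majorised[of S s r] S_in maj s_le by blast
  have y_in: "y \<in> C" using y by (simp add: conv_def)
  have N_bd: "N (S k) \<le> r" for k using N_S s_le order_trans by blast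
  show ?thesis
  proof (rule that[OF y_in])
    have "conv S (st y)"
      using conv_st[OF y] by (simp add: S_st)
    then show "st y = y"
      using y by (rule conv_unique)
    show "N y \<le> 1 - sqrt (1 - q)"
      using conv_bounded[OF y N_bd] by (simp add: r_def)
    have "conv (\<lambda>k. S (Suc k)) ((1/2) *\<^sub>C (b + y * y))"
      unfolding S_Suc
      by (intro conv_scale conv_add conv_const b conv_mult[OF y y, of r] N_bd)
    with conv_Suc[OF y] have y_eq: "y = (1/2) *\<^sub>C (b + y * y)"
      by (rule conv_unique)
    have "y + y = (1/2 + 1/2) *\<^sub>C (b + y * y)"
      by (simp only: scaleC_add_left y_eq[symmetric])
    then have "y + y = b + y * y" by (simp add: scaleC_one)
    moreover have "(e - y) * (e - y) = e - (y + y) + y * y"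
      using y_in by (simp add: algebra_simps)
    ultimately show "(e - y) * (e - y) = e - b" by simp
    fix x assume x: "x \<in> C" "x * b = b * x"
    have "conv (\<lambda>k. x * S k) (x * y)"
      by (intro conv_mult[OF conv_const[OF x(1)] y, of r] N_bd)
    moreover have "conv (\<lambda>k. S k * x) (y * x)"
      by (intro conv_mult[OF y conv_const[OF x(1)], of "N x"] order_refl)
    ultimately show "x * y = y * x"
      using conv_unique S_comm[OF x] by simp
  qed
qed

section \<open>Positivity\<close>

text \<open>
For self-adjoint \<open>a\<close> this says that the spectrum is nonnegative, being contained in an interval
\<open>[0, 2 t]\<close>.  In this form sums of positive elements are obviously positive.
\<close>

definition pos :: "'r \<Rightarrow> bool" where
  "pos a \<longleftrightarrow> a \<in> C \<and> st a = a \<and> (\<exists>t\<ge>0. N (t *\<^sub>r e - a) \<le> t)"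

lemma posD: "pos a \<Longrightarrow> a \<in> C" "pos a \<Longrightarrow> st a = a"
  by (auto simp: pos_def)

lemma pos_add:
  assumes "pos a" "pos b"
  shows "pos (a + b)"
proof -
  obtain s t where st: "s \<ge> 0" "N (s *\<^sub>r e - a) \<le> s" "t \<ge> 0" "N (t *\<^sub>r e - b) \<le> t"
    using assms by (auto simp: pos_def)
  have "N ((s + t) *\<^sub>r e - (a + b)) = N ((s *\<^sub>r e - a) + (t *\<^sub>r e - b))"
    by (simp add: scaleC_add_left algebra_simps)
  also have "\<dots> \<le> s + t"
    using N_triangle[of "s *\<^sub>r e - a" "t *\<^sub>r e - b"] st assms by (simp add: pos_def)
  finally show ?thesis
    using assms st by (auto simp: pos_def intro!: exI[of _ "s + t"])
qed

lemma pos_scale: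
  assumes "pos a" "r \<ge> 0"
  shows "pos (r *\<^sub>r a)"
proof -
  obtain t where t: "t \<ge> 0" "N (t *\<^sub>r e - a) \<le> t" and a: "a \<in> C" "st a = a"
    using assms by (auto simp: pos_def)
  have "(r * t) *\<^sub>r e - r *\<^sub>r a = r *\<^sub>r (t *\<^sub>r e - a)"
    by (simp add: scaleC_simps)
  then have "N ((r * t) *\<^sub>r e - r *\<^sub>r a) \<le> r * t"
    using N_scaleR[of "t *\<^sub>r e - a" r] a t assms(2) by (simp add: mult_left_mono)
  then show ?thesis
    using a t assms(2) unfolding pos_def by (intro conjI exI[of _ "r * t"]) auto
qed

lemma pos_e_minus:
  assumes "b \<in> C" "st b = b" "N b \<le> t"
  shows "pos (t *\<^sub>r e - b)"
  using assms N_nonneg[of b] unfolding pos_def by (intro conjI exI[of _ t]) auto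

lemma pos_e: "0 \<le> t \<Longrightarrow> pos (t *\<^sub>r e)"
  using pos_e_minus[of 0 t] by simp

lemma pos_zero: "pos 0"
  using pos_e[of 0] by simp

lemma pos_sqrt:
  assumes "pos a"
  obtains h where "pos h" "h * h = a" "\<And>x. x \<in> C \<Longrightarrow> x * a = a * x \<Longrightarrow> x * h = h * x"
proof -
  obtain t where t: "t \<ge> 0" "N (t *\<^sub>r e - a) \<le> t" and a: "a \<in> C" "st a = a"
    using assms by (auto simp: pos_def)
  show ?thesis
  proof (cases "t = 0")
    case True
    then have "N (- a) \<le> 0" using t by simp
    then have "a = 0" using a N_nonneg[of a] N_eq_0[of a] by simp
    then show ?thesis using that[of 0] pos_zero by simp
  next
    case False
    then have "t > 0" using t by simp
    define b where "b = e - (1/t) *\<^sub>r a"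
    have b_eq: "b = (1/t) *\<^sub>r (t *\<^sub>r e - a)"
      using \<open>t > 0\<close> by (simp add: b_def scaleC_simps flip: of_real_mult)
    have b: "b \<in> C" "st b = b" using a by (auto simp: b_def)
    have "N b \<le> 1"
      using a t \<open>t > 0\<close> N_scaleR[of "t *\<^sub>r e - a" "1/t"] by (simp add: b_eq)
    then obtain y where y: "y \<in> C" "st y = y" "N y \<le> 1" "(e - y) * (e - y) = e - b"
      "\<And>x. x \<in> C \<Longrightarrow> x * b = b * x \<Longrightarrow> x * y = y * x"
      using sqrt_one_minus[of b 1] b by auto
    define h where "h = sqrt t *\<^sub>r (e - y)"
    have "h * h = (of_real (sqrt t) * of_real (sqrt t)) *\<^sub>C ((e - y) * (e - y))"
      by (simp only: h_def alg_scaleC_left alg_scaleC_right scaleC_scaleC)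
    also have "\<dots> = t *\<^sub>r (e - b)"
      using \<open>t > 0\<close> by (simp only: y(4) of_real_mult[symmetric]) simp
    finally have hh: "h * h = a"
      using \<open>t > 0\<close> by (simp add: b_def scaleC_simps)
    have "sqrt t *\<^sub>r e - h = sqrt t *\<^sub>r y"
      by (simp add: h_def scaleC_simps)
    then have "N (sqrt t *\<^sub>r e - h) \<le> sqrt t"
      using N_scaleR[of y "sqrt t"] y t by (simp add: mult_left_le)
    then have "pos h"
      using y t unfolding pos_def by (intro conjI exI[of _ "sqrt t"]) (auto simp: h_def)
    moreover have "x * h = h * x" if "x \<in> C" "x * a = a * x" for x
    proof -
      have "x * b = b * x" using that a by (simp add: b_def scaleC_simps algebra_simps)
      then show ?thesis
        using y(5)[OF that(1)] that y(1) by (simp add: h_def scaleC_simps algebra_simps)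
    qed
    ultimately show ?thesis using that hh by blast
  qed
qed

lemma N_isometry:
  assumes "u \<in> C" "st u * u = e"
  shows "N u = 1"
  using N_cstar[OF assms(1)] assms N_nonneg[OF assms(1)] by (simp add: power2_eq_1_iff)

text \<open>
Commuting self-adjoint \<open>h\<close>, \<open>k\<close> on the circle \<open>h\<^sup>2 + k\<^sup>2 = t\<close> are the real and imaginary parts of a
multiple of a unitary, which bounds both of them.
\<close>

lemma selfadjoint_combination:
  assumes hk: "h \<in> C" "st h = h" "k \<in> C" "st k = k" "h * k = k * h" "h * h + k * k = t *\<^sub>r e"
    "0 \<le> t"
  defines "u \<equiv> h + \<i> *\<^sub>C k"
  shows "u \<in> C" "st u * u = t *\<^sub>r e" "u * st u = t *\<^sub>r e" "h = (1/2) *\<^sub>C (u + st u)"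
    "k = (- \<i>/2) *\<^sub>C (u - st u)" "(N h)\<^sup>2 \<le> t" "(N k)\<^sup>2 \<le> t"
proof -
  have st_u: "st u = h - \<i> *\<^sub>C k"
    using hk by (simp add: u_def scaleC_minus_left)
  show u: "u \<in> C" using hk by (simp add: u_def)
  show 1: "st u * u = t *\<^sub>r e" "u * st u = t *\<^sub>r e"
    unfolding st_u unfolding u_def
    using hk(5,6) by (simp_all add: algebra_simps scaleC_simps scaleC_minus_one)
  show h: "h = (1/2) *\<^sub>C (u + st u)"
  proof -
    have "(1/2) *\<^sub>C (u + st u) = (1/2) *\<^sub>C (h + h)"
      unfolding st_u unfolding u_def by simp
    also have "\<dots> = h"
      by (simp add: scaleC_add_right scaleC_add_left[symmetric] scaleC_one)
    finally show ?thesis by simp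
  qed
  show k: "k = (- \<i>/2) *\<^sub>C (u - st u)"
  proof -
    have "(- \<i>/2) *\<^sub>C (u - st u) = (- \<i>/2) *\<^sub>C (\<i> *\<^sub>C k + \<i> *\<^sub>C k)"
      unfolding st_u unfolding u_def by simp
    also have "\<dots> = k"
      by (simp add: scaleC_add_right scaleC_scaleC scaleC_add_left[symmetric] scaleC_one)
    finally show ?thesis by simp
  qed
  have Nu: "(N u)\<^sup>2 = \<bar>t\<bar>"
    using N_cstar[OF u] N_scaleR[OF e_in, of t] by (simp add: 1)
  have "h * h + k * k = t *\<^sub>r e" by (rule hk)
  have "N h \<le> N u"
    using N_scale[of "u + st u" "1/2"] N_triangle[of u "st u"] u by (subst h) simp
  moreover have "N k \<le> N u"
    using N_scale[of "u - st u" "-\<i>/2"] N_diff_triangle[of u "st u"] u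
    by (subst k) (simp add: norm_divide)
  ultimately show "(N h)\<^sup>2 \<le> t" "(N k)\<^sup>2 \<le> t"
    using power_mono[of "N h" "N u" 2] power_mono[of "N k" "N u" 2] N_nonneg[OF hk(1)]
      N_nonneg[OF hk(3)] Nu hk(7) by simp_all
qed

lemma selfadjoint_contraction_complement:
  assumes h: "h \<in> C" "st h = h" "N h \<le> 1"
  obtains k where "k \<in> C" "st k = k" "h * k = k * h" "h * h + k * k = 1 *\<^sub>r e"
proof -
  have "N (h * h) \<le> 1"
    using h N_nonneg[OF h(1)] by (simp add: N_selfadjoint_sq power_le_one)
  then obtain y where y: "y \<in> C" "st y = y" "(e - y) * (e - y) = e - h * h"
      "\<And>x. x \<in> C \<Longrightarrow> x * (h * h) = (h * h) * x \<Longrightarrow> x * y = y * x"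
    using sqrt_one_minus[of "h * h" 1] h by auto
  have "h * y = y * h" using y(4)[of h] h by (simp add: mult.assoc)
  then show ?thesis
    using that[of "e - y"] y h by (simp add: algebra_simps scaleC_one)
qed

lemma selfadjoint_contraction_average:
  assumes h: "h \<in> C" "st h = h" "N h \<le> 1"
  obtains u where "u \<in> C" "st u * u = e" "u * st u = e" "h = (1/2) *\<^sub>C (u + st u)"
proof -
  obtain k where k: "k \<in> C" "st k = k" "h * k = k * h" "h * h + k * k = 1 *\<^sub>r e"
    using selfadjoint_contraction_complement[OF h] .
  note comb = selfadjoint_combination[OF h(1,2) k]
  show ?thesis
    by (rule that[of "h + \<i> *\<^sub>C k"]) (use comb(1-4) in \<open>simp_all add: scaleC_one\<close>)
qed

text \<open>
For \<open>\<parallel>h\<parallel> \<le> 1\<close> the element \<open>e - h * h\<close> is the square of the imaginary part \<open>k\<close> of a unitary with real part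
\<open>h\<close>, and \<open>\<parallel>k\<parallel> \<le> 1\<close>; the general case follows by scaling.
\<close>

lemma N_scaleR_minus_square:
  assumes h: "h \<in> C" "st h = h" "(N h)\<^sup>2 \<le> t"
  shows "N (t *\<^sub>r e - h * h) \<le> t"
proof (cases "t = 0")
  case True
  then have "N h = 0" using h by simp
  then have "h = 0" using N_eq_0 h by simp
  then show ?thesis using True by simp
next
  case False
  then have t: "t > 0" using h(3) zero_le_power2[of "N h"] by linarith
  define g where "g = (1 / sqrt t) *\<^sub>r h"
  have g: "g \<in> C" "st g = g" using h by (auto simp: g_def)
  have "N h \<le> sqrt t"
    using h(3) real_le_rsqrt by blast
  then have "N g \<le> 1"
    using h t N_scaleR[of h "1 / sqrt t"] by (simp add: g_def)
  then obtain k where k: "k \<in> C" "st k = k" "g * k = k * g" "g * g + k * k = 1 *\<^sub>r e"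
    using selfadjoint_contraction_complement[OF g] by auto
  have "h = sqrt t *\<^sub>r g"
    using t by (simp add: g_def scaleC_simps flip: of_real_mult)
  then have "h * h = (of_real (sqrt t) * of_real (sqrt t)) *\<^sub>C (g * g)"
    by (simp only: alg_scaleC_left alg_scaleC_right scaleC_scaleC)
  also have "\<dots> = t *\<^sub>r (g * g)"
    using t by (simp only: of_real_mult[symmetric]) simp
  also have "g * g = e - k * k"
    using k(4) by (simp add: scaleC_one eq_diff_eq)
  finally have "t *\<^sub>r e - h * h = t *\<^sub>r (k * k)"
    by (simp add: scaleC_diff_right)
  moreover have "N (k * k) \<le> 1"
    using selfadjoint_combination(7)[OF g k] k by (simp add: N_selfadjoint_sq)
  ultimately show ?thesis
    using t k N_scaleR[of "k * k" t] by (simp add: mult_left_le)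
qed

lemma pos_square:
  assumes "h \<in> C" "st h = h"
  shows "pos (h * h)"
  using N_scaleR_minus_square[OF assms order_refl] assms unfolding pos_def
  by (intro conjI exI[of _ "(N h)\<^sup>2"]) auto

text \<open>
The right-hand side does not mention the norm, so positivity depends on the *-algebra only.
\<close>

lemma pos_iff_square: "pos a \<longleftrightarrow> (\<exists>h\<in>C. st h = h \<and> a = h * h)"
proof
  assume "pos a"
  then show "\<exists>h\<in>C. st h = h \<and> a = h * h"
    by (rule pos_sqrt) (auto dest: posD)
qed (auto intro: pos_square)

lemma pos_N_minus:
  assumes "pos a" "N a \<le> t"
  shows "N (t *\<^sub>r e - a) \<le> t"
proof -
  obtain h where "h \<in> C" "st h = h" "a = h * h" using assms pos_iff_square by auto
  then show ?thesis
    using N_scaleR_minus_square[of h t] assms by (simp add: N_selfadjoint_sq)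
qed

text \<open>
The square roots of \<open>a\<close> and of \<open>t - a\<close> commute and lie on the circle of radius \<open>sqrt t\<close>.
\<close>

lemma N_le_if_pos_diff:
  assumes "pos a" "pos (t *\<^sub>r e - a)" "0 \<le> t"
  shows "N a \<le> t"
proof -
  obtain h where h: "pos h" "h * h = a" "\<And>x. x \<in> C \<Longrightarrow> x * a = a * x \<Longrightarrow> x * h = h * x"
    using pos_sqrt[OF assms(1)] by blast
  obtain k where k: "pos k" "k * k = t *\<^sub>r e - a"
    "\<And>x. x \<in> C \<Longrightarrow> x * (t *\<^sub>r e - a) = (t *\<^sub>r e - a) * x \<Longrightarrow> x * k = k * x"
    using pos_sqrt[OF assms(2)] by blast
  note hk = posD[OF h(1)] posD[OF k(1)]
  have "h * (t *\<^sub>r e - a) = (t *\<^sub>r e - a) * h"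
    using h(2) hk by (auto simp: algebra_simps scaleC_simps)
  then have "h * k = k * h" using k(3) hk by blast
  then have "(N h)\<^sup>2 \<le> t"
    using selfadjoint_combination(6)[of h k t] hk h(2) k(2) assms(3) by simp
  then show ?thesis using N_selfadjoint_sq[of h] hk h(2) by simp
qed

lemma N_mono:
  assumes "pos a" "pos (b - a)"
  shows "N a \<le> N b"
proof (rule N_le_if_pos_diff[OF assms(1)])
  have b: "b \<in> C" "st b = b"
    using posD[OF pos_add[OF assms]] by simp_all
  have "N b *\<^sub>r e - a = (b - a) + (N b *\<^sub>r e - b)" by simp
  show "pos (N b *\<^sub>r e - a)"
    unfolding \<open>N b *\<^sub>r e - a = _\<close> by (rule pos_add[OF assms(2) pos_e_minus[OF b order_refl]])
  show "0 \<le> N b" using b N_nonneg by simp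
qed

lemma pos_antisym:
  assumes "pos a" "pos (- a)"
  shows "a = 0"
proof -
  have "N a \<le> 0"
    using N_le_if_pos_diff[of a 0] assms by simp
  then show ?thesis
    using N_nonneg[of a] N_eq_0[of a] posD(1)[OF assms(1)] by simp
qed

lemma pos_mult:
  assumes "pos a" "pos b" "a * b = b * a"
  shows "pos (a * b)"
proof -
  obtain h where h: "pos h" "h * h = a" "\<And>x. x \<in> C \<Longrightarrow> x * a = a * x \<Longrightarrow> x * h = h * x"
    using pos_sqrt[OF assms(1)] by blast
  obtain k where k: "pos k" "k * k = b" "\<And>x. x \<in> C \<Longrightarrow> x * b = b * x \<Longrightarrow> x * k = k * x"
    using pos_sqrt[OF assms(2)] by blast
  note hk = posD[OF h(1)] posD[OF k(1)]
  have "b * h = h * b" using h(3)[of b] assms(3) posD(1)[OF assms(2)] by simp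
  then have comm: "h * k = k * h" using k(3)[of h] hk by simp
  have "a * b = h * (h * k) * k"
    unfolding h(2)[symmetric] k(2)[symmetric] by (simp only: mult.assoc)
  also have "\<dots> = (h * k) * (h * k)"
    by (subst comm) (simp only: mult.assoc)
  finally have "a * b = (h * k) * (h * k)" .
  then show ?thesis using pos_square[of "h * k"] hk comm by simp
qed

text \<open>
The norm of a self-adjoint element in terms of the order.  One direction multiplies the two positive
elements, which commute, to get \<open>a * a \<le> t\<^sup>2\<close>.
\<close>

lemma N_le_iff_pos:
  assumes a: "a \<in> C" "st a = a" and "0 \<le> t"
  shows "N a \<le> t \<longleftrightarrow> pos (t *\<^sub>r e - a) \<and> pos (t *\<^sub>r e + a)"
proof
  assume "N a \<le> t"
  then show "pos (t *\<^sub>r e - a) \<and> pos (t *\<^sub>r e + a)"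
    using pos_e_minus[of a t] pos_e_minus[of "-a" t] a by simp
next
  assume "pos (t *\<^sub>r e - a) \<and> pos (t *\<^sub>r e + a)"
  then have "pos ((t *\<^sub>r e - a) * (t *\<^sub>r e + a))"
    using a by (intro pos_mult) (auto simp: algebra_simps scaleC_simps)
  moreover have "(t *\<^sub>r e - a) * (t *\<^sub>r e + a) = (t\<^sup>2) *\<^sub>r e - a * a"
    using a by (simp add: algebra_simps scaleC_simps power2_eq_square)
  ultimately have "N (a * a) \<le> t\<^sup>2"
    using N_le_if_pos_diff[of "a * a" "t\<^sup>2"] pos_square[OF a] by simp
  then have "(N a)\<^sup>2 \<le> t\<^sup>2"
    using a by (simp add: N_selfadjoint_sq)
  then show "N a \<le> t"
    using assms(3) by (rule power2_le_imp_le)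
qed

lemma one_plus_N_le:
  assumes "pos a"
  shows "1 + N a \<le> N (e + a)"
proof -
  have a: "a \<in> C" "st a = a" using posD[OF assms] .
  have e: "pos e" using pos_e[of 1] by (simp add: scaleC_one)
  have "pos (N (e + a) *\<^sub>r e - (e + a))"
    using a by (intro pos_e_minus) auto
  also have "N (e + a) *\<^sub>r e - (e + a) = (N (e + a) - 1) *\<^sub>r e - a"
    by (simp add: scaleC_diff_left scaleC_one)
  finally have "pos ((N (e + a) - 1) *\<^sub>r e - a)" .
  moreover have "N e \<le> N (e + a)"
    using N_mono[OF e, of "e + a"] assms by simp
  ultimately show ?thesis
    using N_le_if_pos_diff[OF assms, of "N (e + a) - 1"] by simp
qed

text \<open>
The elements \<open>st y * y\<close> and \<open>y * st y\<close> have the same spectrum up to \<open>0\<close>.  The following replaces the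
spectrum by norms of powers.  For large \<open>t\<close>, put \<open>F = t + st y * y\<close> and \<open>G = t + y * st y\<close>; then
\<open>\<parallel>F\<parallel> \<le> t\<close> by assumption and \<open>st y * G = F * st y\<close>.  Expanding \<open>G\<^sup>n\<close> therefore gives
\<open>t\<^sup>n + y * M * st y\<close>, where \<open>M\<close> consists of \<open>n\<close> terms of norm at most \<open>t\<^sup>n\<^sup>-\<^sup>1\<close>.  For \<open>n\<close> a power of two
\<open>\<parallel>G\<^sup>n\<parallel> = \<parallel>G\<parallel>\<^sup>n\<close>, and a growth by at most a linear factor forces \<open>\<parallel>G\<parallel> \<le> t\<close>.
\<close>

lemma pos_minus_mult_st:
  assumes y: "y \<in> C" and neg: "pos (- (st y * y))"
  shows "pos (- (y * st y))"
proof -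
  \<comment> \<open>\<open>1 \<le> t\<close> allows the bound \<open>t\<^sup>n\<close> in place of \<open>t\<^sup>n\<^sup>-\<^sup>1\<close> below\<close>
  define t where "t = max 1 (N (st y * y))"
  have t1: "1 \<le> t" and t0: "0 < t" by (auto simp: t_def)
  \<comment> \<open>the powers \<open>F\<^sup>n\<close> and \<open>G\<^sup>n\<close> for \<open>n = 2\<^sup>k\<close>\<close>
  define F where "F = rec_nat (t *\<^sub>r e + st y * y) (\<lambda>_ z. z * z)"
  define G where "G = rec_nat (t *\<^sub>r e + y * st y) (\<lambda>_ z. z * z)"
  have F_0: "F 0 = t *\<^sub>r e + st y * y" and F_Suc: "F (Suc k) = F k * F k" for k
    by (simp_all add: F_def)
  have G_0: "G 0 = t *\<^sub>r e + y * st y" and G_Suc: "G (Suc k) = G k * G k" for k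
    by (simp_all add: G_def)
  have F_in: "F k \<in> C" for k using y by (induction k) (auto simp: F_0 F_Suc)
  have G_in: "G k \<in> C" "st (G k) = G k" for k
    using y by (induction k) (auto simp: G_0 G_Suc)
  have N_F0: "N (F 0) \<le> t"
    using pos_N_minus[OF neg, of t] y by (simp add: F_0 t_def)
  have N_F: "N (F k) \<le> t ^ 2 ^ k" for k
  proof (induction k)
    case (Suc k)
    have "N (F k * F k) \<le> N (F k) * N (F k)" using F_in N_mult by simp
    also have "\<dots> \<le> t ^ 2 ^ k * t ^ 2 ^ k"
      using Suc t0 N_nonneg[OF F_in] by (intro mult_mono) auto
    finally show ?case by (simp add: F_Suc power_add[symmetric] mult_2)
  qed (use N_F0 in simp)
  have N_G: "N (G k) = N (G 0) ^ 2 ^ k" for k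
    by (induction k)
      (simp_all add: G_Suc N_selfadjoint_sq[OF G_in] power_mult[symmetric] mult.commute)
  have inter: "st y * G k = F k * st y" for k
  proof (induction k)
    case (Suc k)
    then show ?case unfolding G_Suc F_Suc by (metis mult.assoc)
  qed (use y in \<open>simp add: F_0 G_0 algebra_simps scaleC_simps\<close>)
  have "\<exists>m\<in>C. G k = (t ^ 2 ^ k) *\<^sub>r e + y * m * st y \<and> N m \<le> 2 ^ k * t ^ 2 ^ k" for k
  proof (induction k)
    case 0
    show ?case using t1 y by (intro bexI[of _ e]) (auto simp: G_0)
  next
    case (Suc k)
    then obtain m where m: "m \<in> C" "G k = (t ^ 2 ^ k) *\<^sub>r e + y * m * st y"
      "N m \<le> 2 ^ k * t ^ 2 ^ k" by auto
    let ?m = "(t ^ 2 ^ k) *\<^sub>r m + m * F k"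
    have double: "t ^ 2 ^ Suc k = t ^ 2 ^ k * t ^ 2 ^ k"
      by (simp add: power_add[symmetric] mult_2)
    have "G (Suc k) = ((t ^ 2 ^ k) *\<^sub>r e + y * m * st y) * G k"
      unfolding G_Suc by (subst (1) m(2)) (rule HOL.refl)
    also have "\<dots> = (t ^ 2 ^ k) *\<^sub>r G k + y * m * (st y * G k)"
      by (simp add: distrib_right mult.assoc alg_scaleC_left e_left[OF G_in(1)])
    finally have "G (Suc k) = (t ^ 2 ^ k) *\<^sub>r G k + y * m * (st y * G k)" .
    also have "\<dots> = (t ^ 2 ^ k) *\<^sub>r ((t ^ 2 ^ k) *\<^sub>r e + y * m * st y) + y * m * (F k * st y)"
      unfolding inter m(2)[symmetric] by (rule HOL.refl)
    also have "\<dots> = (t ^ 2 ^ Suc k) *\<^sub>r e + y * ?m * st y"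
      unfolding double by (simp add: distrib_left distrib_right mult.assoc scaleC_simps)
    finally have eq: "G (Suc k) = (t ^ 2 ^ Suc k) *\<^sub>r e + y * ?m * st y" .
    have "N ?m \<le> N ((t ^ 2 ^ k) *\<^sub>r m) + N (m * F k)"
      using m(1) F_in by (intro N_triangle) auto
    also have "\<dots> \<le> t ^ 2 ^ k * N m + N m * t ^ 2 ^ k"
      using N_scaleR[OF m(1), of "t ^ 2 ^ k"] N_mult[OF m(1) F_in, of k] t0
        mult_left_mono[OF N_F[of k] N_nonneg[OF m(1)]] by simp
    also have "\<dots> \<le> t ^ 2 ^ k * (2 ^ k * t ^ 2 ^ k) + (2 ^ k * t ^ 2 ^ k) * t ^ 2 ^ k"
      using m(3) t0 by (intro add_mono mult_left_mono mult_right_mono) auto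
    also have "\<dots> = 2 ^ Suc k * t ^ 2 ^ Suc k"
      unfolding double by simp
    finally show ?case using eq m(1) F_in by (intro bexI[of _ ?m]) auto
  qed
  then have G_le: "N (G k) \<le> t ^ 2 ^ k * (1 + 2 ^ k * (N y)\<^sup>2)" for k
  proof -
    obtain m where m: "m \<in> C" "G k = (t ^ 2 ^ k) *\<^sub>r e + y * m * st y" "N m \<le> 2 ^ k * t ^ 2 ^ k"
      using \<open>\<And>k. \<exists>m\<in>C. _ k m\<close> by blast
    have "N (y * m * st y) \<le> N (y * m) * N y"
      using N_mult[of "y * m" "st y"] m y by simp
    also have "\<dots> \<le> (N y * N m) * N y"
      using N_mult[OF y m(1)] N_nonneg[OF y] by (intro mult_right_mono) auto
    also have "\<dots> \<le> (N y * (2 ^ k * t ^ 2 ^ k)) * N y"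
      using m(3) N_nonneg[OF y] by (intro mult_right_mono mult_left_mono) auto
    finally have "N (y * m * st y) \<le> t ^ 2 ^ k * (2 ^ k * (N y)\<^sup>2)"
      by (simp add: power2_eq_square mult_ac)
    moreover have "N (G k) \<le> N ((t ^ 2 ^ k) *\<^sub>r e) + N (y * m * st y)"
      unfolding m(2) using m(1) y by (intro N_triangle) auto
    ultimately show ?thesis
      using N_scaleR[OF e_in, of "t ^ 2 ^ k"] t0 by (simp add: algebra_simps)
  qed
  have "N (G 0) \<le> t"
    using le_if_powers_le_linear[OF t0, of "N (G 0)" "(N y)\<^sup>2"] G_le N_G by metis
  then show ?thesis
    using y t0 unfolding pos_def by (intro conjI exI[of _ t]) (auto simp: G_0)
qed

text \<open>
Let \<open>a = st x * x\<close>, let \<open>m = sqrt (a * a)\<close> be its absolute value and \<open>c = m - a\<close>, which is twice its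
negative part.  Then \<open>y = x * c\<close> satisfies \<open>st y * y = c * a * c = - m * c\<^sup>2 \<le> 0\<close>, hence also
\<open>y * st y \<le> 0\<close>.  But the sum of the two is twice the sum of the squares of the real and imaginary
parts of \<open>y\<close>, so \<open>m * c\<^sup>2 = 0\<close>.  This forces \<open>c = 0\<close>, that is \<open>a = m\<close>.
\<close>

lemma pos_st_mult:
  assumes x: "x \<in> C"
  shows "pos (st x * x)"
proof -
  define a where "a = st x * x"
  have a: "a \<in> C" "st a = a" using x by (auto simp: a_def)
  obtain m where m: "pos m" "m * m = a * a"
    "\<And>z. z \<in> C \<Longrightarrow> z * (a * a) = a * a * z \<Longrightarrow> z * m = m * z"
    using pos_sqrt[OF pos_square[OF a]] by blast
  note m_in = posD[OF m(1)]
  have am: "a * m = m * a" using m(3)[OF a(1)] by (simp add: mult.assoc)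
  define c where "c = m - a"
  have c: "c \<in> C" "st c = c" using a m_in by (auto simp: c_def)
  have mc: "m * c = c * m" using am by (simp add: c_def algebra_simps)
  have ac: "a * c = - (m * c)" using am m(2) by (simp add: c_def algebra_simps)
  have ca: "c * a = - (m * c)" using am m(2) by (simp add: c_def algebra_simps)
  define y where "y = x * c"
  have y: "y \<in> C" using x c by (simp add: y_def)
  have "st y * y = c * a * c"
    using x c by (simp add: y_def a_def mult.assoc)
  then have sty: "st y * y = - (m * (c * c))"
    by (simp add: ca mult.assoc)
  have "m * (c * c) = c * c * m" using mc by (metis mult.assoc)
  then have pos_mcc: "pos (m * (c * c))"
    using pos_mult[OF m(1) pos_square[OF c]] by simp
  define h where "h = (1/2) *\<^sub>C (y + st y)"
  define g where "g = (- \<i>/2) *\<^sub>C (y - st y)"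
  have h: "h \<in> C" "st h = h" using y by (auto simp: h_def add.commute)
  have g: "g \<in> C" "st g = g"
    using y by (auto simp: g_def scaleC_diff_right scaleC_minus_left)
  have 1: "(y * y + st y * st y) + (y * st y + st y * y) = 4 *\<^sub>C (h * h)"
    by (simp add: h_def scaleC_simps algebra_simps)
  have 2: "(y * st y + st y * y) - (y * y + st y * st y) = 4 *\<^sub>C (g * g)"
    by (simp add: g_def scaleC_simps algebra_simps scaleC_minus_one)
  have "(y * st y + st y * y) + (y * st y + st y * y) = 4 *\<^sub>C (h * h) + 4 *\<^sub>C (g * g)"
    unfolding 1[symmetric] 2[symmetric] by (simp add: algebra_simps)
  moreover have "pos (4 *\<^sub>r (h * h) + 4 *\<^sub>r (g * g))"
    by (intro pos_add pos_scale pos_square h g) auto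
  ultimately have "pos ((1/2) *\<^sub>r ((y * st y + st y * y) + (y * st y + st y * y)))"
    using pos_scale[of _ "1/2"] by simp
  then have sum: "pos (y * st y + st y * y)"
    by (simp add: scaleC_add_right) (simp add: scaleC_add_left[symmetric] scaleC_one algebra_simps)
  have "pos (- (y * st y))"
    using pos_minus_mult_st[OF y] pos_mcc sty by simp
  from pos_add[OF sum this] have "pos (- (m * (c * c)))"
    by (simp add: sty)
  then have mcc: "m * (c * c) = 0"
    using pos_antisym pos_mcc by blast
  have "(a * c) * (a * c) = a * (c * a) * c" by (simp only: mult.assoc)
  also have "\<dots> = - (a * (m * (c * c)))" by (simp add: ca mult.assoc)
  finally have "(a * c) * (a * c) = 0" by (simp add: mcc)
  moreover have "st (a * c) = c * a" using a c by simp
  then have "st (a * c) = a * c" by (simp only: ac ca)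
  ultimately have "(N (a * c))\<^sup>2 = 0"
    using N_selfadjoint_sq[of "a * c"] a c by simp
  then have ac0: "a * c = 0" using N_eq_0[of "a * c"] a c by simp
  then have mc0: "m * c = 0" using ac by simp
  have "c * c = m * c - a * c" by (simp add: c_def algebra_simps)
  then have "(N c)\<^sup>2 = 0" using N_selfadjoint_sq[OF c] by (simp add: ac0 mc0)
  then have "c = 0" using N_eq_0 c by simp
  then show ?thesis using m(1) by (simp add: c_def a_def)
qed

lemma pos_conj:
  assumes "pos a" "x \<in> C"
  shows "pos (st x * a * x)"
proof -
  obtain h where h: "h \<in> C" "st h = h" "a = h * h" using assms pos_iff_square by auto
  then have "st x * a * x = st (h * x) * (h * x)" using assms by (simp add: mult.assoc)
  then show ?thesis using pos_st_mult[of "h * x"] h assms by simp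
qed

section \<open>Polar decomposition\<close>

text \<open>
The limit of the partial sums of the geometric series of \<open>y\<close>.
\<close>

lemma inverse_near_e:
  assumes y: "y \<in> C" "N y < 1"
  obtains w where "w \<in> C" "w * (e - y) = e" "(e - y) * w = e"
proof -
  define q where "q = N y"
  have q: "0 \<le> q" "q < 1" using assms N_nonneg by (auto simp: q_def)
  define S where "S = rec_nat 0 (\<lambda>_ z. e + y * z)"
  define s where "s = rec_nat (0::real) (\<lambda>_ z. 1 + q * z)"
  have S_0: "S 0 = 0" and S_Suc: "S (Suc k) = e + y * S k" for k by (simp_all add: S_def)
  have s_0: "s 0 = 0" and s_Suc: "s (Suc k) = 1 + q * s k" for k by (simp_all add: s_def)
  have S_in: "S k \<in> C" for k using y by (induction k) (auto simp: S_0 S_Suc)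
  have s_le: "0 \<le> s k \<and> s k \<le> 1 / (1 - q)" for k
  proof (induction k)
    case (Suc k)
    have "1 + q * s k \<le> 1 + q * (1 / (1 - q))"
      using Suc q by (intro add_left_mono mult_left_mono) auto
    also have "\<dots> = 1 / (1 - q)" using q by (simp add: field_simps)
    finally show ?case using Suc q by (simp add: s_Suc)
  qed (use q in \<open>simp add: s_0\<close>)
  have comm: "S k * y = y * S k" for k
  proof (induction k)
    case (Suc k)
    then show ?case using y by (simp add: S_Suc algebra_simps)
  qed (simp add: S_0)
  have maj: "N (S (Suc k) - S k) \<le> s (Suc k) - s k" for k
  proof (induction k)
    case (Suc k)
    have "S (Suc (Suc k)) - S (Suc k) = y * (S (Suc k) - S k)"
      by (simp add: S_Suc[of "Suc k"] S_Suc[of k] right_diff_distrib)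
    then have "N (S (Suc (Suc k)) - S (Suc k)) \<le> q * N (S (Suc k) - S k)"
      using N_mult[of y "S (Suc k) - S k"] y S_in by (simp add: q_def)
    also have "\<dots> \<le> q * (s (Suc k) - s k)" using Suc q by (intro mult_left_mono) auto
    also have "\<dots> = s (Suc (Suc k)) - s (Suc k)" by (simp add: s_Suc algebra_simps)
    finally show ?case .
  qed (simp add: S_0 S_Suc s_0 s_Suc)
  obtain w where w: "conv S w"
    using conv_if_majorised[of S s "1 / (1 - q)"] S_in maj s_le by blast
  have w_in: "w \<in> C" using w by (simp add: conv_def)
  have N_S: "N (S k) \<le> 1 / (1 - q)" for k
  proof -
    have "N (S k) \<le> s k"
    proof (induction k)
      case (Suc k)
      have "N (e + y * S k) \<le> N e + N (y * S k)" using y S_in by (intro N_triangle) auto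
      also have "\<dots> \<le> 1 + q * N (S k)" using N_mult[OF y(1) S_in] by (simp add: q_def)
      also have "\<dots> \<le> 1 + q * s k" using Suc q by (simp add: mult_left_mono)
      finally show ?case by (simp add: S_Suc s_Suc)
    qed (simp add: S_0 s_0)
    then show ?thesis using s_le[of k] by simp
  qed
  have "conv (\<lambda>k. S (Suc k)) (e + y * w)"
    unfolding S_Suc by (intro conv_add conv_const e_in conv_mult[OF conv_const[OF y(1)] w N_S])
  with conv_Suc[OF w] have right: "w = e + y * w" by (rule conv_unique)
  have "conv (\<lambda>k. S k * y) (w * y)"
    by (rule conv_mult[OF w conv_const[OF y(1)], of "N y"]) simp
  moreover have "conv (\<lambda>k. S k * y) (y * w)"
    unfolding comm by (rule conv_mult[OF conv_const[OF y(1)] w N_S])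
  ultimately have wy: "w * y = y * w" by (rule conv_unique)
  have "w - y * w = e" by (subst (1) right) simp
  then show ?thesis
    using that[OF w_in] w_in by (simp add: left_diff_distrib right_diff_distrib wy)
qed

text \<open>
The isometry is the polar part \<open>z * k\<^sup>-\<^sup>1\<close>, where \<open>k = sqrt (st z * z)\<close>.  The bound with \<open>q = 1 - (s / S)\<^sup>2\<close>
in \<open>sqrt_one_minus\<close> says \<open>s \<le> k\<close>, which makes \<open>k\<close> invertible; together with \<open>k \<le> S\<close> it bounds
\<open>z - v = v * (k - e)\<close>.
\<close>

lemma near_isometry:
  assumes z: "z \<in> C" "N z \<le> S" and s: "0 < s" and lower: "N ((S\<^sup>2) *\<^sub>r e - st z * z) \<le> S\<^sup>2 - s\<^sup>2"
  obtains v where "v \<in> C" "st v * v = e" "N (z - v) \<le> max (S - 1) (1 - s)"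
proof -
  have s_le_S: "s \<le> S"
  proof -
    have "0 \<le> S\<^sup>2 - s\<^sup>2"
      using lower N_nonneg[of "(S\<^sup>2) *\<^sub>r e - st z * z"] z(1) by simp
    then have "s\<^sup>2 \<le> S\<^sup>2" by simp
    moreover have "0 \<le> S" using z N_nonneg[OF z(1)] by simp
    ultimately show ?thesis by (rule power2_le_imp_le)
  qed
  then have S: "0 < S" using s by simp
  define b where "b = e - (1 / S\<^sup>2) *\<^sub>r (st z * z)"
  have b: "b \<in> C" "st b = b" using z by (auto simp: b_def)
  have b_eq: "b = (1 / S\<^sup>2) *\<^sub>r ((S\<^sup>2) *\<^sub>r e - st z * z)"
  proof -
    have "(1 / S\<^sup>2) *\<^sub>r (S\<^sup>2) *\<^sub>r e = e"
      using S by (simp only: scaleC_scaleC of_real_mult[symmetric]) (simp add: scaleC_one)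
    then show ?thesis by (simp only: b_def scaleC_diff_right)
  qed
  define q where "q = 1 - (s / S)\<^sup>2"
  have "N b = N ((S\<^sup>2) *\<^sub>r e - st z * z) / S\<^sup>2"
    unfolding b_eq using z by (subst N_scaleR) auto
  also have "\<dots> \<le> (S\<^sup>2 - s\<^sup>2) / S\<^sup>2" using lower by (simp add: divide_right_mono)
  also have "\<dots> = q" using S by (simp add: q_def field_simps)
  finally have "N b \<le> q" .
  moreover have "q \<le> 1" by (simp add: q_def)
  ultimately obtain y where y: "y \<in> C" "st y = y" "N y \<le> 1 - sqrt (1 - q)"
      "(e - y) * (e - y) = e - b"
    using sqrt_one_minus[OF b] by blast
  have N_y: "N y \<le> 1 - s / S"
    using y(3) s S by (simp add: q_def)
  then have "N y < 1" using s S by (smt (verit) divide_pos_pos)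
  then obtain w where w: "w \<in> C" "w * (e - y) = e" "(e - y) * w = e"
    using inverse_near_e[OF y(1)] by blast
  have "st w * (e - y) = e"
    using arg_cong[OF w(3), of st] w(1) y by simp
  then have "st w = st w * ((e - y) * w)" by (simp add: w)
  also have "\<dots> = w"
    using \<open>st w * (e - y) = e\<close> w(1) by (simp only: mult.assoc[symmetric]) simp
  finally have st_w: "st w = w" .
  define k where "k = S *\<^sub>r (e - y)"
  have k: "k \<in> C" "st k = k" using y by (auto simp: k_def)
  have kk: "k * k = st z * z"
  proof -
    have "k * k = (of_real S * of_real S) *\<^sub>C (e - b)"
      by (simp only: k_def alg_scaleC_left alg_scaleC_right scaleC_scaleC y(4))
    also have "e - b = (1 / S\<^sup>2) *\<^sub>r (st z * z)" by (simp add: b_def)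
    also have "(of_real S * of_real S) *\<^sub>C \<dots> = (S * S * (1 / S\<^sup>2)) *\<^sub>r (st z * z)"
      by (simp only: scaleC_scaleC of_real_mult)
    also have "S * S * (1 / S\<^sup>2) = 1" using S by (simp add: power2_eq_square)
    finally show ?thesis by (simp add: scaleC_one)
  qed
  \<comment> \<open>the inverse of \<open>k\<close>\<close>
  define j where "j = (1 / S) *\<^sub>r w"
  have j: "j \<in> C" "st j = j" using w st_w by (auto simp: j_def)
  have S_inv: "complex_of_real (1 / S) * complex_of_real S = 1"
      "complex_of_real S * complex_of_real (1 / S) = 1"
    using S by (simp_all only: of_real_mult[symmetric]) simp_all
  have jk: "j * k = e" "k * j = e"
    by (simp_all only: j_def k_def alg_scaleC_left alg_scaleC_right scaleC_scaleC w S_inv scaleC_one)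
  define v where "v = z * j"
  have v: "v \<in> C" using z j by (simp add: v_def)
  have "st v * v = j * (st z * z) * j" using z j by (simp add: v_def mult.assoc)
  also have "\<dots> = (j * k) * (k * j)" by (simp only: kk[symmetric] mult.assoc)
  also have "\<dots> = e" by (simp add: jk)
  finally have vv: "st v * v = e" .
  have "z = v * k" using z(1) by (simp add: v_def mult.assoc jk)
  then have "z - v = v * (k - e)" using v by (simp add: right_diff_distrib)
  then have "N (z - v) \<le> N v * N (k - e)" using N_mult[of v "k - e"] v k by simp
  then have zv: "N (z - v) \<le> N (k - e)" by (simp add: N_isometry[OF v vv])
  define M where "M = max (S - 1) (1 - s)"
  have "(N k)\<^sup>2 \<le> S\<^sup>2"
    using N_selfadjoint_sq[OF k] N_cstar[OF z(1)] power_mono[OF z(2) N_nonneg[OF z(1)], of 2]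
    by (simp add: kk)
  then have "N k \<le> S" using S by (meson less_imp_le power2_le_imp_le)
  then have "pos (S *\<^sub>r e - k)" using k by (intro pos_e_minus) auto
  moreover have "pos ((M - (S - 1)) *\<^sub>r e)" by (intro pos_e) (simp add: M_def)
  ultimately have "pos ((S *\<^sub>r e - k) + (M - (S - 1)) *\<^sub>r e)" by (rule pos_add)
  moreover have "(S *\<^sub>r e - k) + (M - (S - 1)) *\<^sub>r e = M *\<^sub>r e - (k - e)"
    by (simp add: scaleC_diff_left scaleC_one)
  ultimately have 1: "pos (M *\<^sub>r e - (k - e))" by (simp only:)
  have "N (S *\<^sub>r y) \<le> S - s"
    using N_scaleR[OF y(1), of S] mult_left_mono[OF N_y, of S] S by (simp add: algebra_simps)
  then have "pos ((S - s) *\<^sub>r e - S *\<^sub>r y)" using y by (intro pos_e_minus) auto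
  moreover have "pos ((M - (1 - s)) *\<^sub>r e)" by (intro pos_e) (simp add: M_def)
  ultimately have "pos (((S - s) *\<^sub>r e - S *\<^sub>r y) + (M - (1 - s)) *\<^sub>r e)" by (rule pos_add)
  moreover have "((S - s) *\<^sub>r e - S *\<^sub>r y) + (M - (1 - s)) *\<^sub>r e = M *\<^sub>r e + (k - e)"
    by (simp add: k_def scaleC_diff_left scaleC_diff_right scaleC_one)
  ultimately have 2: "pos (M *\<^sub>r e + (k - e))" by (simp only:)
  have "0 \<le> M" unfolding M_def by (smt (verit) s_le_S)
  then have "N (k - e) \<le> M"
    using N_le_iff_pos[of "k - e" M] k 1 2 by simp
  then show ?thesis using that[OF v vv] zv by (simp add: M_def)
qed

text \<open>
Let \<open>d = S\<^sup>2 - st z * z\<close>, which has its norm \<open>r\<close> where \<open>st z * z\<close> is smallest.  The multiple \<open>y\<close> of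
\<open>sqrt d\<close> with norm \<open>S\<close> satisfies \<open>st z * z + st y * y = S\<^sup>2 + (S\<^sup>2 / r - 1) * d\<close>, so adding \<open>y\<close> below \<open>z\<close>
makes the squared norm no larger than \<open>S\<^sup>2\<close> plus the smallest value \<open>S\<^sup>2 - r\<close> of \<open>st z * z\<close>.
\<close>

lemma test_column:
  assumes z: "z \<in> C" "N z \<le> S" and S: "0 < S"
    and nonzero: "N ((S\<^sup>2) *\<^sub>r e - st z * z) \<noteq> 0"
  obtains y where "y \<in> C" "N y = S"
    "N (st z * z + st y * y) \<le> 2 * S\<^sup>2 - N ((S\<^sup>2) *\<^sub>r e - st z * z)"
proof -
  define d where "d = (S\<^sup>2) *\<^sub>r e - st z * z"
  define r where "r = N d"
  have d: "d \<in> C" "st d = d" using z by (auto simp: d_def)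
  have r: "r > 0" using nonzero N_nonneg[OF d(1)] by (simp add: r_def d_def order_less_le)
  have Nzz: "N (st z * z) \<le> S\<^sup>2"
    using N_cstar[OF z(1)] power_mono[OF z(2) N_nonneg[OF z(1)], of 2] by simp
  have r_le: "r \<le> S\<^sup>2"
    unfolding r_def d_def by (rule pos_N_minus[OF pos_st_mult[OF z(1)] Nzz])
  have "pos d" unfolding d_def using z Nzz by (intro pos_e_minus) auto
  then obtain h where h: "h \<in> C" "st h = h" "h * h = d"
    using pos_iff_square[of d] by auto
  have N_h: "(N h)\<^sup>2 = r" using N_selfadjoint_sq[OF h(1,2)] by (simp add: h r_def)
  then have Nh: "N h = sqrt r" using N_nonneg[OF h(1)] by (metis real_sqrt_abs abs_of_nonneg)
  define y where "y = (S / sqrt r) *\<^sub>r h"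
  have y: "y \<in> C" "st y = y" using h by (auto simp: y_def)
  have "N y = S" using N_scaleR[OF h(1), of "S / sqrt r"] r S by (simp add: y_def Nh)
  have "st y * y = (of_real (S / sqrt r) * of_real (S / sqrt r)) *\<^sub>C d"
    by (simp only: y(2)) (simp only: y_def alg_scaleC_left alg_scaleC_right scaleC_scaleC h)
  also have "\<dots> = (S\<^sup>2 / r) *\<^sub>r d"
    using r by (simp only: of_real_mult[symmetric]) (simp add: power2_eq_square)
  finally have "st z * z + st y * y = (S\<^sup>2) *\<^sub>r e + (S\<^sup>2 / r - 1) *\<^sub>r d"
    by (simp add: d_def scaleC_diff_left scaleC_one)
  then have "N (st z * z + st y * y) \<le> N ((S\<^sup>2) *\<^sub>r e) + N ((S\<^sup>2 / r - 1) *\<^sub>r d)"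
    using N_triangle[of "(S\<^sup>2) *\<^sub>r e" "(S\<^sup>2 / r - 1) *\<^sub>r d"] d by simp
  also have "\<dots> = S\<^sup>2 + \<bar>S\<^sup>2 / r - 1\<bar> * r"
    using N_scaleR[OF e_in, of "S\<^sup>2"] N_scaleR[OF d(1), of "S\<^sup>2 / r - 1"] by (simp add: r_def)
  also have "\<bar>S\<^sup>2 / r - 1\<bar> = S\<^sup>2 / r - 1" using r r_le by simp
  also have "S\<^sup>2 + (S\<^sup>2 / r - 1) * r = 2 * S\<^sup>2 - r" using r by (simp add: field_simps)
  finally show ?thesis using that[OF y(1) \<open>N y = S\<close>] by (simp add: r_def d_def)
qed

end

section \<open>Uniqueness of the C*-norm\<close>

text \<open>
Both norms have the same positive elements, hence agree on self-adjoint elements, hence everywhere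
by the C*-identity.
\<close>

lemma cstar_norm_unique:
  assumes "cstar_subset C e st N" "cstar_subset C e st M" "x \<in> C"
  shows "N x = M x"
proof -
  interpret N: cstar_subset C e st N by fact
  interpret M: cstar_subset C e st M by fact
  have pos: "N.pos a \<longleftrightarrow> M.pos a" for a
    by (simp add: N.pos_iff_square M.pos_iff_square)
  have eq: "N a = M a" if a: "a \<in> C" "st a = a" for a
  proof (rule antisym)
    show "N a \<le> M a" 
      using N.N_le_iff_pos[OF a, of "M a"] M.N_le_iff_pos[OF a, of "M a"] M.N_nonneg[OF a(1)] pos
      by simp
    show "M a \<le> N a" 
      using N.N_le_iff_pos[OF a, of "N a"] M.N_le_iff_pos[OF a, of "N a"] N.N_nonneg[OF a(1)] pos
      by simp
  qed
  have "(N x)\<^sup>2 = (M x)\<^sup>2"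
    using N.N_cstar[OF assms(3)] M.N_cstar[OF assms(3)] eq[of "st x * x"] assms(3) by simp
  then show ?thesis
    using N.N_nonneg M.N_nonneg assms(3) by simp
qed

section \<open>The Hilbert module of columns\<close>

interpretation unital: cstar_subset "UNIV :: 'a::unital_cstar_algebra set" 1 star norm
proof
  fix S :: "nat \<Rightarrow> 'a"
  assume "\<And>d. d > 0 \<Longrightarrow> \<exists>K. \<forall>k\<ge>K. \<forall>l\<ge>K. norm (S k - S l) < d"
  then have "Cauchy S" by (simp add: Cauchy_def dist_norm)
  then obtain L where "S \<longlonglongrightarrow> L" using Cauchy_convergent convergent_def by blast
  then show "\<exists>L\<in>UNIV. (\<lambda>k. norm (S k - L)) \<longlonglongrightarrow> 0"
    using LIM_zero tendsto_norm_zero by blast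
qed (simp_all add: star_add star_scaleC star_mult star_star cstar_identity norm_triangle_ineq
    norm_mult_ineq norm_scaleC)

lemma star_zero [simp]: "star (0 :: 'a::unital_cstar_algebra) = 0"
  by (rule unital.st_zero)

lemma star_one [simp]: "star (1 :: 'a::unital_cstar_algebra) = 1"
  by (rule unital.st_e)

lemma star_diff: "star (x - y) = star x - star (y :: 'a::unital_cstar_algebra)"
  by (rule unital.st_diff) simp_all

lemma star_sum: "star (sum f A) = (\<Sum>i\<in>A. star (f i :: 'a::unital_cstar_algebra))"
  by (induction A rule: infinite_finite_induct) (simp_all add: star_add)

lemma scaleC_sum_right: "c *\<^sub>C sum f A = (\<Sum>i\<in>A. c *\<^sub>C (f i :: 'a::complex_vector))"
  by (induction A rule: infinite_finite_induct) (simp_all add: scaleC_add_right)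

lemma pos_sum:
  fixes f :: "'i \<Rightarrow> 'a::unital_cstar_algebra"
  assumes "\<And>i. i \<in> A \<Longrightarrow> unital.pos (f i)"
  shows "unital.pos (sum f A)"
  using assms
  by (induction A rule: infinite_finite_induct) (simp_all add: unital.pos_zero unital.pos_add)


text \<open>
The \<open>'a\<close>-valued inner product of columns of length \<open>n\<close>, linear in the second argument.  Columns are
functions on \<open>nat\<close> whose values from \<open>n\<close> on are ignored.
\<close>

definition ip :: "nat \<Rightarrow> (nat \<Rightarrow> 'a::unital_cstar_algebra) \<Rightarrow> (nat \<Rightarrow> 'a) \<Rightarrow> 'a" where
  "ip n x y = (\<Sum>i<n. star (x i) * y i)"

definition colnorm :: "nat \<Rightarrow> (nat \<Rightarrow> 'a::unital_cstar_algebra) \<Rightarrow> real" where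
  "colnorm n x = sqrt (norm (ip n x x))"

lemma colnorm_sq: "(colnorm n x)\<^sup>2 = norm (ip n x x)"
  by (simp add: colnorm_def)

lemma colnorm_nonneg [simp]: "0 \<le> colnorm n x"
  by (simp add: colnorm_def)

lemma pos_ip: "unital.pos (ip n x x)"
  unfolding ip_def by (intro pos_sum unital.pos_st_mult) simp

lemma star_ip: "star (ip n x y) = ip n y x"
  by (simp add: ip_def star_sum star_mult star_star)

lemma norm_component_le: 
  assumes "j < n"
  shows "norm (x j) \<le> colnorm n x"
proof -
  have "ip n x x - star (x j) * x j = (\<Sum>i\<in>{..<n} - {j}. star (x i) * x i)"
    using assms by (simp add: ip_def sum_diff1)
  then have "unital.pos (ip n x x - star (x j) * x j)"
    by (simp add: pos_sum unital.pos_st_mult)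
  then have "norm (star (x j) * x j) \<le> norm (ip n x x)"
    using unital.N_mono[OF unital.pos_st_mult[of "x j"]] by simp
  then show ?thesis
    by (simp add: colnorm_def cstar_identity real_le_rsqrt)
qed

lemma colnorm_le_sum: "colnorm n x \<le> (\<Sum>i<n. norm (x i))"
proof -
  have "norm (ip n x x) \<le> (\<Sum>i<n. (norm (x i))\<^sup>2)"
    unfolding ip_def using sum_norm_le[of "{..<n}" "\<lambda>i. star (x i) * x i"]
    by (simp add: cstar_identity)
  also have "\<dots> \<le> (\<Sum>i<n. norm (x i) * (\<Sum>j<n. norm (x j)))"
    by (intro sum_mono) (auto simp: power2_eq_square intro!: mult_left_mono member_le_sum)
  also have "\<dots> = (\<Sum>i<n. norm (x i))\<^sup>2"
    by (simp add: power2_eq_square sum_distrib_right)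
  finally show ?thesis
    unfolding colnorm_def by (rule real_le_lsqrt[rotated]) (simp add: sum_nonneg)
qed

text \<open>
As for scalars, the inner product of \<open>x * a - t * y\<close> with itself is positive, where \<open>a = \<langle>x, y\<rangle>\<close> and
\<open>t = \<parallel>\<langle>x, x\<rangle>\<parallel>\<close>.  The element \<open>\<langle>x, x\<rangle>\<close> cannot be divided by and is replaced by the larger \<open>t\<close>; this
leaves \<open>t * (star a * a) \<le> t\<^sup>2 * \<langle>y, y\<rangle>\<close>, and norms are monotone on positive elements.
\<close>

lemma Cauchy_Schwarz_ip: "norm (ip n x y) \<le> colnorm n x * colnorm n y"
proof (cases "ip n x x = 0")
  case True
  then have "x i = 0" if "i < n" for i
    using norm_component_le[OF that, of x] by (simp add: colnorm_def)
  then show ?thesis by (simp add: ip_def)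
next
  case False
  define a where "a = ip n x y"
  define t where "t = norm (ip n x x)"
  have t: "t > 0" using False by (simp add: t_def)
  define z where "z i = x i * a - t *\<^sub>r y i" for i
  have xa: "ip n x (\<lambda>i. x i * a) = ip n x x * a" "ip n y (\<lambda>i. x i * a) = star a * a"
    by (simp_all add: ip_def sum_distrib_right mult.assoc a_def star_sum star_mult star_star)
  have star_z: "star (z i) = star a * star (x i) - t *\<^sub>r star (y i)" for i
    by (simp add: z_def star_diff star_mult star_scaleC)
  have "ip n z z = (\<Sum>i<n. star a * (star (x i) * x i) * a - t *\<^sub>r (star a * (star (x i) * y i))
      - t *\<^sub>r (star (y i) * x i * a) + (t * t) *\<^sub>r (star (y i) * y i))"
    unfolding ip_def star_z unfolding z_def
    by (intro sum.cong HOL.refl)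
      (simp add: left_diff_distrib right_diff_distrib scaleC_simps mult.assoc)
  also have "\<dots> = star a * ip n x x * a - t *\<^sub>r (star a * ip n x y) - t *\<^sub>r (ip n y x * a)
      + (t * t) *\<^sub>r ip n y y"
    by (simp add: ip_def sum.distrib sum_subtractf sum_distrib_left sum_distrib_right
        scaleC_sum_right)
  also have "\<dots> = star a * ip n x x * a - t *\<^sub>r (star a * a) - t *\<^sub>r (star a * a) + (t * t) *\<^sub>r ip n y y"
    by (simp add: a_def star_ip)
  finally have zz: "ip n z z = \<dots>" .
  \<comment> \<open>the error made by replacing \<open>\<langle>x, x\<rangle>\<close> by its norm\<close>
  have "unital.pos (star a * (t *\<^sub>r 1 - ip n x x) * a)"
    by (intro unital.pos_conj unital.pos_e_minus) (simp_all add: t_def star_ip)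
  from unital.pos_add[OF pos_ip[of n z] this]
  have "unital.pos (ip n z z + star a * (t *\<^sub>r 1 - ip n x x) * a)" .
  also have "ip n z z + star a * (t *\<^sub>r 1 - ip n x x) * a = (t * t) *\<^sub>r ip n y y - t *\<^sub>r (star a * a)"
    by (simp add: zz algebra_simps scaleC_simps)
  finally have "norm (t *\<^sub>r (star a * a)) \<le> norm ((t * t) *\<^sub>r ip n y y)"
    using t by (intro unital.N_mono unital.pos_scale unital.pos_st_mult) auto
  then have "t * (norm a)\<^sup>2 \<le> t * (t * norm (ip n y y))"
    using t by (simp add: norm_scaleC cstar_identity norm_mult mult.assoc)
  then have "(norm a)\<^sup>2 \<le> t * norm (ip n y y)"
    using t by simp
  then have "norm a \<le> sqrt (t * norm (ip n y y))" by (rule real_le_rsqrt)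
  then show ?thesis by (simp add: a_def colnorm_def t_def real_sqrt_mult)
qed

lemma colnorm_triangle: "colnorm n (\<lambda>i. x i + y i) \<le> colnorm n x + colnorm n y"
proof -
  have "ip n (\<lambda>i. x i + y i) (\<lambda>i. x i + y i) = ip n x x + ip n x y + ip n y x + ip n y y"
    by (simp add: ip_def star_add algebra_simps sum.distrib)
  then have "norm (ip n (\<lambda>i. x i + y i) (\<lambda>i. x i + y i))
      \<le> norm (ip n x x) + norm (ip n x y) + norm (ip n y x) + norm (ip n y y)"
    by (simp add: norm_triangle_le norm_triangle_ineq)
  also have "\<dots> \<le> (colnorm n x + colnorm n y)\<^sup>2"
    using Cauchy_Schwarz_ip[of n x y] Cauchy_Schwarz_ip[of n y x] colnorm_sq[of n x] colnorm_sq[of n y]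
    by (simp add: power2_sum mult.commute mult.left_commute)
  finally show ?thesis
    by (subst colnorm_def, intro real_le_lsqrt) auto
qed

lemma colnorm_scale: "colnorm n (\<lambda>i. c *\<^sub>C x i) = cmod c * colnorm n x"
proof -
  have "ip n (\<lambda>i. c *\<^sub>C x i) (\<lambda>i. c *\<^sub>C x i) = (cnj c * c) *\<^sub>C ip n x x"
    by (simp add: ip_def star_scaleC scaleC_sum_right scaleC_simps mult.commute)
  then show ?thesis
    by (simp add: colnorm_def norm_scaleC norm_mult real_sqrt_mult)
qed


section \<open>The operator norm is a C*-norm\<close>

definition apply_mat :: "nat \<Rightarrow> 'a::unital_cstar_algebra mat \<Rightarrow> (nat \<Rightarrow> 'a) \<Rightarrow> nat \<Rightarrow> 'a" where
  "apply_mat n X x i = (\<Sum>j<n. X $$ (i, j) * x j)"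

definition opnorm :: "nat \<Rightarrow> 'a::unital_cstar_algebra mat \<Rightarrow> real" where
  "opnorm n X = Sup {colnorm n (apply_mat n X x) | x. colnorm n x \<le> 1}"

lemma ip_cong: "(\<And>i. i < n \<Longrightarrow> x i = x' i) \<Longrightarrow> (\<And>i. i < n \<Longrightarrow> y i = y' i) \<Longrightarrow> ip n x y = ip n x' y'"
  by (simp add: ip_def)

lemma colnorm_cong: "(\<And>i. i < n \<Longrightarrow> x i = x' i) \<Longrightarrow> colnorm n x = colnorm n x'"
  unfolding colnorm_def by (simp cong: ip_cong)

lemma mult_mat_index:
  "A \<in> carrier_mat n m \<Longrightarrow> B \<in> carrier_mat m p \<Longrightarrow> i < n \<Longrightarrow> j < p \<Longrightarrow>
   (A * B) $$ (i, j) = (\<Sum>k<m. A $$ (i, k) * B $$ (k, j))"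
  by (simp add: scalar_prod_def atLeast0LessThan)

lemma mat_star_index [simp]:
  "i < dim_col X \<Longrightarrow> j < dim_row X \<Longrightarrow> mat_star X $$ (i, j) = star (X $$ (j, i))"
  by (simp add: mat_star_def)

lemma mat_star_dim [simp]: "dim_row (mat_star X) = dim_col X" "dim_col (mat_star X) = dim_row X"
  by (simp_all add: mat_star_def)

lemma mat_star_carrier [simp]: "mat_star X \<in> carrier_mat n m \<longleftrightarrow> X \<in> carrier_mat m n"
  by (auto simp: mat_star_def)

lemma mat_star_mult:
  assumes "A \<in> carrier_mat n m" "B \<in> carrier_mat m p"
  shows "mat_star (A * B) = mat_star B * mat_star A"
  using assms
  by (intro eq_matI)
    (auto simp: mult_mat_index[of _ n m _ p] mult_mat_index[of _ p m _ n] star_sum star_mult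
      simp del: index_mult_mat(1))

lemma mat_star_mat_star [simp]: "mat_star (mat_star X) = X"
  by (intro eq_matI) (auto simp: star_star)

lemma apply_mat_mult:
  assumes "A \<in> carrier_mat n n" "B \<in> carrier_mat n n" "i < n"
  shows "apply_mat n (A * B) x i = apply_mat n A (apply_mat n B x) i"
proof -
  have "apply_mat n (A * B) x i = (\<Sum>j<n. \<Sum>k<n. A $$ (i, k) * B $$ (k, j) * x j)"
    using assms by (simp add: apply_mat_def mult_mat_index[of _ n n _ n] sum_distrib_right
      del: index_mult_mat(1))
  also have "\<dots> = (\<Sum>k<n. \<Sum>j<n. A $$ (i, k) * B $$ (k, j) * x j)" by (rule sum.swap)
  also have "\<dots> = apply_mat n A (apply_mat n B x) i"
    by (simp add: apply_mat_def sum_distrib_left mult.assoc)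
  finally show ?thesis .
qed

lemma ip_apply_mat:
  assumes "X \<in> carrier_mat n n"
  shows "ip n (apply_mat n X x) y = ip n x (apply_mat n (mat_star X) y)"
proof -
  have "ip n (apply_mat n X x) y = (\<Sum>i<n. \<Sum>j<n. star (x j) * star (X $$ (i, j)) * y i)"
    by (simp add: ip_def apply_mat_def star_sum star_mult sum_distrib_right)
  also have "\<dots> = (\<Sum>j<n. \<Sum>i<n. star (x j) * star (X $$ (i, j)) * y i)" by (rule sum.swap)
  also have "\<dots> = ip n x (apply_mat n (mat_star X) y)"
    using assms by (simp add: ip_def apply_mat_def sum_distrib_left mult.assoc)
  finally show ?thesis .
qed

lemma colnorm_apply_le_entries:
  "colnorm n (apply_mat n X x) \<le> (\<Sum>i<n. \<Sum>j<n. norm (X $$ (i, j))) * colnorm n x"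
proof -
  have "colnorm n (apply_mat n X x) \<le> (\<Sum>i<n. norm (apply_mat n X x i))"
    by (rule colnorm_le_sum)
  also have "\<dots> \<le> (\<Sum>i<n. \<Sum>j<n. norm (X $$ (i, j)) * colnorm n x)"
  proof (intro sum_mono)
    fix i
    have "norm (X $$ (i, j) * x j) \<le> norm (X $$ (i, j)) * colnorm n x" if "j < n" for j
      using norm_mult_ineq[of "X $$ (i, j)" "x j"] norm_component_le[OF that, of x]
      by (meson mult_left_mono norm_ge_zero order_trans)
    then show "norm (apply_mat n X x i) \<le> (\<Sum>j<n. norm (X $$ (i, j)) * colnorm n x)"
      unfolding apply_mat_def by (intro sum_norm_le) auto
  qed
  finally show ?thesis by (simp add: sum_distrib_right)
qed

lemma bdd_above_opnorm: "bdd_above {colnorm n (apply_mat n X x) | x. colnorm n x \<le> 1}"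
proof (rule bdd_aboveI)
  fix r assume "r \<in> {colnorm n (apply_mat n X x) | x. colnorm n x \<le> 1}"
  then obtain x where "r = colnorm n (apply_mat n X x)" "colnorm n x \<le> 1" by auto
  then show "r \<le> (\<Sum>i<n. \<Sum>j<n. norm (X $$ (i, j)))"
    using colnorm_apply_le_entries[of n X x] 
      mult_left_le[of "colnorm n x" "\<Sum>i<n. \<Sum>j<n. norm (X $$ (i, j))"]
    by (simp add: sum_nonneg)
qed

lemma colnorm_zero: "colnorm n (\<lambda>i. 0) = 0"
  by (simp add: colnorm_def ip_def)

lemma opnorm_least:
  assumes "\<And>x. colnorm n x \<le> 1 \<Longrightarrow> colnorm n (apply_mat n X x) \<le> r"
  shows "opnorm n X \<le> r"
  unfolding opnorm_def
proof (rule cSup_least)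
  have "colnorm n (\<lambda>i. 0 :: 'a) \<le> 1" by (simp add: colnorm_zero)
  then show "{colnorm n (apply_mat n X x) | x. colnorm n x \<le> 1} \<noteq> {}" by blast
qed (use assms in auto)

lemma apply_mat_scale: "apply_mat n X (\<lambda>i. c *\<^sub>C x i) = (\<lambda>i. c *\<^sub>C apply_mat n X x i)"
  by (simp add: fun_eq_iff apply_mat_def scaleC_sum_right alg_scaleC_right)

lemma colnorm_apply_le: "colnorm n (apply_mat n X x) \<le> opnorm n X * colnorm n x"
proof (cases "colnorm n x = 0")
  case True
  then show ?thesis
    using colnorm_apply_le_entries[of n X x] by simp
next
  case False
  define r where "r = colnorm n x"
  have r: "r > 0" using False colnorm_nonneg[of n x] by (simp add: r_def order_less_le)
  define y where "y = (\<lambda>i. (1 / r) *\<^sub>r x i)"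
  have "colnorm n y = 1" using r by (simp add: y_def colnorm_scale norm_divide) (simp add: r_def)
  then have "colnorm n (apply_mat n X y) \<le> opnorm n X"
    unfolding opnorm_def by (intro cSup_upper bdd_above_opnorm) force
  moreover have "colnorm n (apply_mat n X y) = colnorm n (apply_mat n X x) / r"
    using r by (simp add: y_def apply_mat_scale colnorm_scale norm_divide)
  ultimately show ?thesis using r by (simp add: r_def[symmetric] field_simps)
qed

lemma opnorm_nonneg [simp]: "0 \<le> opnorm n X"
proof -
  have "colnorm n (apply_mat n X (\<lambda>i. 0)) \<le> opnorm n X"
    unfolding opnorm_def by (rule cSup_upper[OF _ bdd_above_opnorm]) (auto intro!: exI[of _ "\<lambda>i. 0"] simp: colnorm_zero)
  then show ?thesis using colnorm_nonneg order_trans by blast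
qed

lemma opnorm_leI:
  assumes "0 \<le> r" "\<And>x. colnorm n (apply_mat n X x) \<le> r * colnorm n x"
  shows "opnorm n X \<le> r"
  by (rule opnorm_least) (meson assms mult_left_le order_trans)

lemma norm_entry_le_opnorm:
  assumes "i < n" "j < n"
  shows "norm (X $$ (i, j)) \<le> opnorm n X"
proof -
  define x where "x = (\<lambda>k. if k = j then 1 else 0 :: 'a)"
  have "ip n x x = (\<Sum>k<n. if k = j then 1 else 0)"
    unfolding ip_def x_def by (intro sum.cong) auto
  then have "colnorm n x = 1" using assms by (simp add: colnorm_def)
  moreover have "apply_mat n X x i = (\<Sum>k<n. if k = j then X $$ (i, j) else 0)"
    unfolding apply_mat_def x_def by (intro sum.cong) auto
  then have "apply_mat n X x i = X $$ (i, j)" using assms by simp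
  ultimately show ?thesis
    using norm_component_le[OF assms(1), of "apply_mat n X x"] colnorm_apply_le[of n X x] by simp
qed

lemma opnorm_le_entries: "opnorm n X \<le> (\<Sum>i<n. \<Sum>j<n. norm (X $$ (i, j)))"
  by (intro opnorm_leI colnorm_apply_le_entries) (simp add: sum_nonneg)

lemma opnorm_mult:
  assumes "A \<in> carrier_mat n n" "B \<in> carrier_mat n n"
  shows "opnorm n (A * B) \<le> opnorm n A * opnorm n B"
proof (rule opnorm_leI)
  fix x
  have "colnorm n (apply_mat n (A * B) x) = colnorm n (apply_mat n A (apply_mat n B x))"
    by (intro colnorm_cong apply_mat_mult assms)
  also have "\<dots> \<le> opnorm n A * colnorm n (apply_mat n B x)" by (rule colnorm_apply_le)
  also have "\<dots> \<le> opnorm n A * (opnorm n B * colnorm n x)"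
    by (intro mult_left_mono colnorm_apply_le) simp
  finally show "colnorm n (apply_mat n (A * B) x) \<le> opnorm n A * opnorm n B * colnorm n x"
    by (simp add: mult.assoc)
qed simp

text \<open>
The Cauchy-Schwarz inequality bounds \<open>\<parallel>X x\<parallel>\<^sup>2 = \<parallel>\<langle>x, X\<^sup>* X x\<rangle>\<parallel>\<close>; the other inequality follows from it and
submultiplicativity, as in every *-algebra with such a norm.
\<close>

lemma opnorm_cstar:
  assumes X: "X \<in> carrier_mat n n"
  shows "opnorm n (mat_star X * X) = (opnorm n X)\<^sup>2"
proof -
  have sq_le: "(opnorm n Y)\<^sup>2 \<le> opnorm n (mat_star Y * Y)" if Y: "Y \<in> carrier_mat n n" for Y :: "'a mat"
  proof -
    have "opnorm n Y \<le> sqrt (opnorm n (mat_star Y * Y))"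
    proof (rule opnorm_leI)
      fix x
      have "(colnorm n (apply_mat n Y x))\<^sup>2 = norm (ip n x (apply_mat n (mat_star Y) (apply_mat n Y x)))"
        by (simp add: colnorm_sq ip_apply_mat[OF Y])
      also have "ip n x (apply_mat n (mat_star Y) (apply_mat n Y x))
          = ip n x (apply_mat n (mat_star Y * Y) x)"
        using Y by (intro ip_cong apply_mat_mult[symmetric]) auto
      also have "norm \<dots> \<le> colnorm n x * colnorm n (apply_mat n (mat_star Y * Y) x)"
        by (rule Cauchy_Schwarz_ip)
      also have "\<dots> \<le> colnorm n x * (opnorm n (mat_star Y * Y) * colnorm n x)"
        by (intro mult_left_mono colnorm_apply_le) simp
      also have "\<dots> = (sqrt (opnorm n (mat_star Y * Y)) * colnorm n x)\<^sup>2"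
        by (simp add: power_mult_distrib) (simp add: power2_eq_square mult_ac)
      finally show "colnorm n (apply_mat n Y x) \<le> sqrt (opnorm n (mat_star Y * Y)) * colnorm n x"
        by (rule power2_le_imp_le) simp
    qed simp
    then have "(opnorm n Y)\<^sup>2 \<le> (sqrt (opnorm n (mat_star Y * Y)))\<^sup>2"
      by (rule power_mono) simp
    then show ?thesis by simp
  qed
  have le_star: "opnorm n Y \<le> opnorm n (mat_star Y)" if Y: "Y \<in> carrier_mat n n" for Y :: "'a mat"
  proof (cases "opnorm n Y = 0")
    case False
    then have "0 < opnorm n Y" using opnorm_nonneg[of n Y] by linarith
    moreover have "opnorm n Y * opnorm n Y \<le> opnorm n (mat_star Y) * opnorm n Y"
      using sq_le[OF Y] opnorm_mult[of "mat_star Y" n Y] Y by (simp add: power2_eq_square)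
    ultimately show ?thesis by simp
  qed simp
  have "opnorm n (mat_star X) = opnorm n X"
    using le_star[of X] le_star[of "mat_star X"] X by simp
  then show ?thesis
    using sq_le[OF X] opnorm_mult[of "mat_star X" n X] X by (simp add: power2_eq_square)
qed

lemma opnorm_triangle:
  assumes "A \<in> carrier_mat n n" "B \<in> carrier_mat n n"
  shows "opnorm n (A + B) \<le> opnorm n A + opnorm n B"
proof (rule opnorm_leI)
  fix x
  have "colnorm n (apply_mat n (A + B) x)
      = colnorm n (\<lambda>i. apply_mat n A x i + apply_mat n B x i)"
    using assms by (intro colnorm_cong) (simp add: apply_mat_def distrib_right sum.distrib)
  also have "\<dots> \<le> colnorm n (apply_mat n A x) + colnorm n (apply_mat n B x)"
    by (rule colnorm_triangle)
  also have "\<dots> \<le> opnorm n A * colnorm n x + opnorm n B * colnorm n x"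
    by (intro add_mono colnorm_apply_le)
  finally show "colnorm n (apply_mat n (A + B) x) \<le> (opnorm n A + opnorm n B) * colnorm n x"
    by (simp add: distrib_right)
qed simp

lemma opnorm_scale:
  assumes "A \<in> carrier_mat n n"
  shows "opnorm n (map_mat ((*\<^sub>C) c) A) = cmod c * opnorm n A"
proof (cases "c = 0")
  case True
  have "opnorm n (map_mat ((*\<^sub>C) c) A) \<le> (\<Sum>i<n. \<Sum>j<n. 0 :: real)"
    using opnorm_le_entries[of n "map_mat ((*\<^sub>C) c) A"] assms True by simp
  then show ?thesis using True by (simp add: order_antisym)
next
  case False
  have le: "opnorm n (map_mat ((*\<^sub>C) c) B) \<le> cmod c * opnorm n B"
    if "B \<in> carrier_mat n n" for c and B :: "'a mat"
  proof (rule opnorm_leI)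
    fix x
    have "colnorm n (apply_mat n (map_mat ((*\<^sub>C) c) B) x) = colnorm n (\<lambda>i. c *\<^sub>C apply_mat n B x i)"
      using that
      by (intro colnorm_cong) (simp add: apply_mat_def scaleC_sum_right alg_scaleC_left)
    then show "colnorm n (apply_mat n (map_mat ((*\<^sub>C) c) B) x) \<le> cmod c * opnorm n B * colnorm n x"
      using colnorm_apply_le[of n B x] by (simp add: colnorm_scale mult_left_mono mult.assoc)
  qed simp
  have "A = map_mat ((*\<^sub>C) (1 / c)) (map_mat ((*\<^sub>C) c) A)"
    using False by (intro eq_matI) (auto simp: scaleC_scaleC scaleC_one)
  then have "opnorm n A \<le> cmod (1 / c) * opnorm n (map_mat ((*\<^sub>C) c) A)"
    using le[of "map_mat ((*\<^sub>C) c) A" "1 / c"] assms by simp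
  then have "cmod c * opnorm n A \<le> opnorm n (map_mat ((*\<^sub>C) c) A)"
    using False by (simp add: norm_divide field_simps)
  then show ?thesis using le[OF assms, of c] by simp
qed

text \<open>
The operator norm lies between the largest norm of an entry and the sum of the norms of all entries.
\<close>

lemma opnorm_complete:
  fixes S :: "nat \<Rightarrow> 'a::unital_cstar_algebra mat"
  assumes S: "\<And>k. S k \<in> carrier_mat n n"
    and Cauchy_S: "\<And>e. e > 0 \<Longrightarrow> \<exists>K. \<forall>k\<ge>K. \<forall>l\<ge>K. opnorm n (S k - S l) < e"
  shows "\<exists>L\<in>carrier_mat n n. (\<lambda>k. opnorm n (S k - L)) \<longlonglongrightarrow> 0"
proof -
  have "\<exists>l. (\<lambda>k. S k $$ (i, j)) \<longlonglongrightarrow> l" if ij: "i < n" "j < n" for i j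
  proof -
    have "norm (S k $$ (i, j) - S l $$ (i, j)) \<le> opnorm n (S k - S l)" for k l
      using norm_entry_le_opnorm[OF ij, of "S k - S l"] S[of k] S[of l] ij by simp
    then have "Cauchy (\<lambda>k. S k $$ (i, j))"
      unfolding Cauchy_def dist_norm by (meson Cauchy_S le_less_trans)
    then show ?thesis using Cauchy_convergent convergent_def by blast
  qed
  then obtain l where l: "\<And>i j. i < n \<Longrightarrow> j < n \<Longrightarrow> (\<lambda>k. S k $$ (i, j)) \<longlonglongrightarrow> l i j"
    by metis
  define L where "L = mat n n (\<lambda>(i, j). l i j)"
  have "(\<lambda>k. \<Sum>i<n. \<Sum>j<n. norm (S k $$ (i, j) - l i j)) \<longlonglongrightarrow> (\<Sum>i<n. \<Sum>j<n. 0)"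
    by (intro tendsto_sum tendsto_norm_zero LIM_zero l) auto
  then have lim: "(\<lambda>k. \<Sum>i<n. \<Sum>j<n. norm (S k $$ (i, j) - l i j)) \<longlonglongrightarrow> 0" by simp
  have "opnorm n (S k - L) \<le> (\<Sum>i<n. \<Sum>j<n. norm (S k $$ (i, j) - l i j))" for k
    using opnorm_le_entries[of n "S k - L"] S[of k] by (simp add: L_def)
  then have "(\<lambda>k. opnorm n (S k - L)) \<longlonglongrightarrow> 0"
    by (intro tendsto_sandwich[OF _ _ tendsto_const lim]) auto
  then show ?thesis by (intro bexI[of _ L]) (auto simp: L_def)
qed

lemma matrix_cstar_norm_exists:
  "is_matrix_cstar_norm n (\<lambda>X::'a::unital_cstar_algebra mat. if X \<in> carrier_mat n n then opnorm n X else 0)"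
  unfolding is_matrix_cstar_norm_def
proof (intro conjI ballI allI impI)
  fix X :: "'a mat" assume X: "X \<in> carrier_mat n n"
  show "((if X \<in> carrier_mat n n then opnorm n X else 0) = 0) = (X = 0\<^sub>m n n)"
  proof
    assume "(if X \<in> carrier_mat n n then opnorm n X else 0) = 0"
    then have "opnorm n X = 0" using X by simp
    then have "norm (X $$ (i, j)) = 0" if "i < n" "j < n" for i j
      using norm_entry_le_opnorm[OF that, of X] by simp
    then show "X = 0\<^sub>m n n" using X by (intro eq_matI) auto
  next
    assume "X = 0\<^sub>m n n"
    then show "(if X \<in> carrier_mat n n then opnorm n X else 0) = 0"
      using opnorm_le_entries[of n X] by (simp add: order_antisym)
  qed
next
  fix S :: "nat \<Rightarrow> 'a mat"
  assume S: "\<forall>k. S k \<in> carrier_mat n n" 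
    and C: "\<forall>e>0. \<exists>K. \<forall>k\<ge>K. \<forall>l\<ge>K. (if S k - S l \<in> carrier_mat n n then opnorm n (S k - S l) else 0) < e"
  have in_C: "S k - M \<in> carrier_mat n n" if "M \<in> carrier_mat n n" for k M
    using that by (rule minus_carrier_mat)
  show "\<exists>L\<in>carrier_mat n n. (\<lambda>k. if S k - L \<in> carrier_mat n n then opnorm n (S k - L) else 0) \<longlonglongrightarrow> 0"
    using opnorm_complete[of S n] S C in_C by simp
qed (auto simp: opnorm_triangle opnorm_scale opnorm_mult opnorm_cstar)

section \<open>Matrices as elements of a ring\<close>

text \<open>
Linear maps on sequences.  This ring contains the matrices of every size \<open>n\<close>, acting on the first \<open>n\<close>
entries, so that each matrix algebra becomes a subset of a single type.
\<close>

typedef (overloaded) ('a::complex_vector) linop =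
  "{f :: (nat \<Rightarrow> 'a) \<Rightarrow> nat \<Rightarrow> 'a. (\<forall>x y. f (\<lambda>i. x i + y i) = (\<lambda>i. f x i + f y i)) \<and>
     (\<forall>c x. f (\<lambda>i. c *\<^sub>C x i) = (\<lambda>i. c *\<^sub>C f x i))}"
  by (rule exI[of _ "\<lambda>x. x"]) simp

setup_lifting type_definition_linop

instantiation linop :: (complex_vector) complex_algebra
begin

lift_definition zero_linop :: "'a linop" is "\<lambda>x i. 0" by simp
lift_definition plus_linop :: "'a linop \<Rightarrow> 'a linop \<Rightarrow> 'a linop" is "\<lambda>f g x i. f x i + g x i"
  by (simp add: ac_simps scaleC_add_right)
lift_definition minus_linop :: "'a linop \<Rightarrow> 'a linop \<Rightarrow> 'a linop" is "\<lambda>f g x i. f x i - g x i"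
  by (simp add: scaleC_diff_right fun_eq_iff)
lift_definition uminus_linop :: "'a linop \<Rightarrow> 'a linop" is "\<lambda>f x i. - f x i"
  by (simp add: scaleC_minus_right)
lift_definition times_linop :: "'a linop \<Rightarrow> 'a linop \<Rightarrow> 'a linop" is "\<lambda>f g x. f (g x)"
  by simp
lift_definition scaleC_linop :: "complex \<Rightarrow> 'a linop \<Rightarrow> 'a linop" is "\<lambda>c f x i. c *\<^sub>C f x i"
  by (simp add: scaleC_add_right scaleC_scaleC mult.commute)

instance
  by standard
    (transfer; simp add: fun_eq_iff scaleC_add_right scaleC_add_left scaleC_scaleC scaleC_one ac_simps)+

end

lift_definition mat_op :: "nat \<Rightarrow> 'a::unital_cstar_algebra mat \<Rightarrow> 'a linop" is
  "\<lambda>n X x i. if i < n then \<Sum>j<n. X $$ (i, j) * x j else 0"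
  by (auto simp: fun_eq_iff distrib_left sum.distrib scaleC_sum_right alg_scaleC_right)

text \<open>
A left inverse of \<open>mat_op\<close>: the entries are the values on the standard columns.
\<close>

lift_definition op_mat :: "nat \<Rightarrow> 'a::unital_cstar_algebra linop \<Rightarrow> 'a mat" is
  "\<lambda>n f. mat n n (\<lambda>(i, j). f (\<lambda>k. if k = j then 1 else 0) i)" .

lemma op_mat_carrier [simp]: "op_mat n f \<in> carrier_mat n n"
  by transfer simp

lemma op_mat_mat_op [simp]:
  assumes "X \<in> carrier_mat n n"
  shows "op_mat n (mat_op n X) = X"
proof -
  have "(\<Sum>k<n. X $$ (i, k) * (if k = j then 1 else 0)) = X $$ (i, j)" if "j < n" for i j
  proof -
    have "(\<Sum>k<n. X $$ (i, k) * (if k = j then 1 else 0)) = (\<Sum>k<n. if k = j then X $$ (i, j) else 0)"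
      by (intro sum.cong) auto
    then show ?thesis using that by simp
  qed
  then show ?thesis using assms
    by transfer (intro eq_matI; simp)
qed

lemma mat_op_inj:
  "X \<in> carrier_mat n n \<Longrightarrow> Y \<in> carrier_mat n n \<Longrightarrow> mat_op n X = mat_op n Y \<longleftrightarrow> X = Y"
  using op_mat_mat_op[of X n] op_mat_mat_op[of Y n] by metis

lemma mat_op_zero: "mat_op n (0\<^sub>m n n) = 0"
  by transfer (auto simp: fun_eq_iff)

lemma mat_op_add:
  "X \<in> carrier_mat n n \<Longrightarrow> Y \<in> carrier_mat n n \<Longrightarrow> mat_op n (X + Y) = mat_op n X + mat_op n Y"
  by transfer (auto simp: fun_eq_iff distrib_right sum.distrib)

lemma mat_op_diff:
  "X \<in> carrier_mat n n \<Longrightarrow> Y \<in> carrier_mat n n \<Longrightarrow> mat_op n (X - Y) = mat_op n X - mat_op n Y"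
  by transfer (auto simp: fun_eq_iff left_diff_distrib sum_subtractf)

lemma mat_op_scale:
  "X \<in> carrier_mat n n \<Longrightarrow> mat_op n (map_mat ((*\<^sub>C) c) X) = c *\<^sub>C mat_op n X"
  by transfer (auto simp: fun_eq_iff scaleC_sum_right alg_scaleC_left)

lemma mat_op_mult:
  fixes X Y :: "'a::unital_cstar_algebra mat"
  shows "X \<in> carrier_mat n n \<Longrightarrow> Y \<in> carrier_mat n n \<Longrightarrow> mat_op n (X * Y) = mat_op n X * mat_op n Y"
  using apply_mat_mult[of X n Y]
  by transfer (auto simp: fun_eq_iff apply_mat_def)

definition op_star :: "nat \<Rightarrow> 'a::unital_cstar_algebra linop \<Rightarrow> 'a linop" where
  "op_star n f = mat_op n (mat_star (op_mat n f))"

lemma op_star_mat_op: "X \<in> carrier_mat n n \<Longrightarrow> op_star n (mat_op n X) = mat_op n (mat_star X)"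
  by (simp add: op_star_def)

abbreviation mats :: "nat \<Rightarrow> 'a::unital_cstar_algebra linop set" where
  "mats n \<equiv> mat_op n ` carrier_mat n n"

lemma mat_star_add:
  "X \<in> carrier_mat n m \<Longrightarrow> Y \<in> carrier_mat n m \<Longrightarrow> mat_star (X + Y) = mat_star X + mat_star Y"
  by (intro eq_matI) (auto simp: star_add)

lemma mat_star_scale: "mat_star (map_mat ((*\<^sub>C) c) X) = map_mat ((*\<^sub>C) (cnj c)) (mat_star X)"
  by (intro eq_matI) (auto simp: star_scaleC)

lemma mat_star_one: "mat_star (1\<^sub>m n) = 1\<^sub>m n"
  by (intro eq_matI) auto

lemma mat_star_zero: "mat_star (0\<^sub>m n m) = 0\<^sub>m m n"
  by (intro eq_matI) auto

lemma cstar_subset_mats: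
  fixes N :: "'a::unital_cstar_algebra mat \<Rightarrow> real"
  assumes N: "is_matrix_cstar_norm n N" and n: "1 \<le> n"
  shows "cstar_subset (mats n) (mat_op n (1\<^sub>m n)) (op_star n) (\<lambda>f. N (op_mat n f))"
proof
  note N' = N[unfolded is_matrix_cstar_norm_def]
  show "mat_op n (1\<^sub>m n) \<in> mats n" by simp
  show "mat_op n (1\<^sub>m n) \<noteq> (0 :: 'a linop)"
  proof
    assume "mat_op n (1\<^sub>m n) = (0 :: 'a linop)"
    then have "1\<^sub>m n = (0\<^sub>m n n :: 'a mat)" by (simp add: mat_op_inj flip: mat_op_zero[of n])
    then have "(1\<^sub>m n :: 'a mat) $$ (0, 0) = 0\<^sub>m n n $$ (0, 0)" by simp
    then show False using n by simp
  qed
  fix f :: "'a linop" assume "f \<in> mats n"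
  then obtain X where X: "X \<in> carrier_mat n n" "f = mat_op n X" by blast
  show "mat_op n (1\<^sub>m n) * f = f" "f * mat_op n (1\<^sub>m n) = f"
    using X by (simp_all flip: mat_op_mult)
  show "c *\<^sub>C f \<in> mats n" for c using X by (simp flip: mat_op_scale)
  show "op_star n f \<in> mats n" using X by (simp add: op_star_mat_op)
  show "op_star n (op_star n f) = f" using X by (simp add: op_star_mat_op)
  show "op_star n (c *\<^sub>C f) = cnj c *\<^sub>C op_star n f" for c
    using X by (simp add: op_star_mat_op mat_star_scale flip: mat_op_scale)
  show "0 \<le> N (op_mat n f)" using X N' by simp
  show "N (op_mat n f) = 0 \<longleftrightarrow> f = 0"
    using X N' mat_op_inj[OF X(1) zero_carrier_mat] by (simp add: mat_op_zero)
  show "N (op_mat n (c *\<^sub>C f)) = cmod c * N (op_mat n f)" for c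
    using X N' by (simp flip: mat_op_scale)
  show "N (op_mat n (op_star n f * f)) = (N (op_mat n f))\<^sup>2"
    using X N' by (simp add: op_star_mat_op flip: mat_op_mult)
  fix g :: "'a linop" assume "g \<in> mats n"
  then obtain Y where Y: "Y \<in> carrier_mat n n" "g = mat_op n Y" by blast
  show "f + g \<in> mats n" using X Y by (simp flip: mat_op_add)
  show "f * g \<in> mats n" using X Y by (simp flip: mat_op_mult)
  show "op_star n (f + g) = op_star n f + op_star n g"
    using X Y by (simp add: op_star_mat_op mat_star_add[of _ n n] flip: mat_op_add)
  show "op_star n (f * g) = op_star n g * op_star n f"
    using X Y by (simp add: op_star_mat_op mat_star_mult[of _ n n] flip: mat_op_mult)
  show "N (op_mat n (f + g)) \<le> N (op_mat n f) + N (op_mat n g)"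
    using X Y N' by (simp flip: mat_op_add)
  show "N (op_mat n (f * g)) \<le> N (op_mat n f) * N (op_mat n g)"
    using X Y N' by (simp flip: mat_op_mult)
next
  fix S :: "nat \<Rightarrow> 'a linop"
  assume S: "\<And>k. S k \<in> mats n"
    and C: "\<And>d. d > 0 \<Longrightarrow> \<exists>K. \<forall>k\<ge>K. \<forall>l\<ge>K. N (op_mat n (S k - S l)) < d"
  define M where "M k = op_mat n (S k)" for k
  have M: "M k \<in> carrier_mat n n" "S k = mat_op n (M k)" for k
    using S[of k] by (auto simp: M_def)
  have diff: "op_mat n (S k - mat_op n L) = M k - L" if "L \<in> carrier_mat n n" for k L
    using M[of k] that by (simp add: minus_carrier_mat flip: mat_op_diff)
  have "\<exists>L \<in> carrier_mat n n. (\<lambda>k. N (M k - L)) \<longlonglongrightarrow> 0"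
    using N[unfolded is_matrix_cstar_norm_def] M(1) C diff M by simp
  then obtain L where L: "L \<in> carrier_mat n n" "(\<lambda>k. N (M k - L)) \<longlonglongrightarrow> 0" by blast
  then show "\<exists>L\<in>mats n. (\<lambda>k. N (op_mat n (S k - L))) \<longlonglongrightarrow> 0"
    by (intro bexI[of _ "mat_op n L"]) (simp_all add: diff)
qed

lemma matrix_cstar_norm_zero: "is_matrix_cstar_norm n N \<Longrightarrow> N (0\<^sub>m n n) = 0"
  unfolding is_matrix_cstar_norm_def by (elim conjE) (drule bspec[of _ _ "0\<^sub>m n n"], auto)

lemma matrix_cstar_norm_unique:
  fixes N M :: "'a::unital_cstar_algebra mat \<Rightarrow> real"
  assumes "is_matrix_cstar_norm n N" "is_matrix_cstar_norm n M"
  shows "N = M"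
proof
  fix X :: "'a mat"
  consider "X \<notin> carrier_mat n n" | "X \<in> carrier_mat n n" "n = 0" | "X \<in> carrier_mat n n" "1 \<le> n"
    by linarith
  then show "N X = M X"
  proof cases
    case 1
    then show ?thesis using assms by (simp add: is_matrix_cstar_norm_def)
  next
    case 2
    then have "X = 0\<^sub>m n n" by (intro eq_matI) auto
    then show ?thesis using assms[THEN matrix_cstar_norm_zero] by simp
  next
    case 3
    then show ?thesis
      using cstar_norm_unique[OF cstar_subset_mats[OF assms(1)] cstar_subset_mats[OF assms(2)],
          of "mat_op n X"] by simp
  qed
qed

text \<open>
Existence and uniqueness together make the description in the definition of \<open>cstar_norm\<close> proper.
\<close>

lemma is_matrix_cstar_norm_cstar_norm:
  "is_matrix_cstar_norm n (cstar_norm n :: 'a::unital_cstar_algebra mat \<Rightarrow> real)"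
  unfolding cstar_norm_def
  by (rule theI'[of "is_matrix_cstar_norm n"])
    (use matrix_cstar_norm_exists matrix_cstar_norm_unique in blast)

section \<open>The C*-algebra of square matrices\<close>

abbreviation mscale :: "complex \<Rightarrow> 'a::complex_vector mat \<Rightarrow> 'a mat" (infixr \<open>*\<^sub>m\<close> 75) where
  "c *\<^sub>m X \<equiv> map_mat ((*\<^sub>C) c) X"

lemma mscale_mult_left:
  fixes X Y :: "'a::unital_cstar_algebra mat"
  shows "X \<in> carrier_mat n m \<Longrightarrow> Y \<in> carrier_mat m p \<Longrightarrow> (c *\<^sub>m X) * Y = c *\<^sub>m (X * Y)"
  by (intro eq_matI)
    (auto simp: mult_mat_index[of _ n m _ p] scaleC_sum_right mult_scaleC_left simp del: index_mult_mat(1))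

lemma mscale_mult_right:
  fixes X Y :: "'a::unital_cstar_algebra mat"
  shows "X \<in> carrier_mat n m \<Longrightarrow> Y \<in> carrier_mat m p \<Longrightarrow> X * (c *\<^sub>m Y) = c *\<^sub>m (X * Y)"
  by (intro eq_matI)
    (auto simp: mult_mat_index[of _ n m _ p] scaleC_sum_right mult_scaleC_right simp del: index_mult_mat(1))

lemma mscale_mscale: "c *\<^sub>m d *\<^sub>m X = (c * d) *\<^sub>m X"
  by (intro eq_matI) (auto simp: scaleC_scaleC)

lemma mscale_one: "1 *\<^sub>m X = X"
  by (intro eq_matI) (auto simp: scaleC_one)


lemma
  fixes X Y :: "'a::unital_cstar_algebra mat"
  assumes X: "X \<in> carrier_mat n n"
  shows cn_nonneg: "0 \<le> cstar_norm n X"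
    and cn_eq_0: "cstar_norm n X = 0 \<longleftrightarrow> X = 0\<^sub>m n n"
    and cn_triangle: "Y \<in> carrier_mat n n \<Longrightarrow> cstar_norm n (X + Y) \<le> cstar_norm n X + cstar_norm n Y"
    and cn_scale: "cstar_norm n (c *\<^sub>m X) = cmod c * cstar_norm n X"
    and cn_mult: "Y \<in> carrier_mat n n \<Longrightarrow> cstar_norm n (X * Y) \<le> cstar_norm n X * cstar_norm n Y"
    and cn_cstar: "cstar_norm n (mat_star X * X) = (cstar_norm n X)\<^sup>2"
  using is_matrix_cstar_norm_cstar_norm[of n] X unfolding is_matrix_cstar_norm_def by auto

context
  fixes n :: nat and t :: "'a::unital_cstar_algebra itself"
  assumes n: "1 \<le> n"
begin

interpretation M: cstar_subset "mats n :: 'a linop set" "mat_op n (1\<^sub>m n)" "op_star n"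
  "\<lambda>f. cstar_norm n (op_mat n f)"
  by (rule cstar_subset_mats[OF is_matrix_cstar_norm_cstar_norm n])

lemma cn_one: "cstar_norm n (1\<^sub>m n :: 'a mat) = 1"
  using M.N_e by simp

lemma cn_star:
  fixes X :: "'a mat"
  shows "X \<in> carrier_mat n n \<Longrightarrow> cstar_norm n (mat_star X) = cstar_norm n X"
  using M.N_st[of "mat_op n X"] by (simp add: op_star_mat_op)

text \<open>
This bounds from below the squared norm of a column whose other entry is an isometry.
\<close>

lemma one_plus_cn_le:
  fixes Y :: "'a mat"
  assumes "Y \<in> carrier_mat n n"
  shows "1 + (cstar_norm n Y)\<^sup>2 \<le> cstar_norm n (1\<^sub>m n + mat_star Y * Y)"
proof -
  have "M.pos (op_star n (mat_op n Y) * mat_op n Y)"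
    using assms by (intro M.pos_st_mult) simp
  from M.one_plus_N_le[OF this] show ?thesis
    using assms by (simp add: op_star_mat_op cn_cstar flip: mat_op_mult mat_op_add)
qed

lemma selfadjoint_mat_average:
  fixes H :: "'a mat"
  assumes H: "H \<in> carrier_mat n n" "mat_star H = H" "cstar_norm n H \<le> 1"
  obtains U where "U \<in> carrier_mat n n" "mat_star U * U = 1\<^sub>m n" "U * mat_star U = 1\<^sub>m n"
    "H = (1/2) *\<^sub>m (U + mat_star U)"
proof -
  obtain u where u: "u \<in> mats n" "op_star n u * u = mat_op n (1\<^sub>m n)" "u * op_star n u = mat_op n (1\<^sub>m n)"
    "mat_op n H = (1/2) *\<^sub>C (u + op_star n u)"
    by (rule M.selfadjoint_contraction_average[of "mat_op n H"]) (use H in \<open>auto simp: op_star_mat_op\<close>)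
  then obtain U where U: "U \<in> carrier_mat n n" "u = mat_op n U" by blast
  show ?thesis
    by (rule that[of U])
      (use u U H in \<open>simp_all add: op_star_mat_op mat_op_inj flip: mat_op_mult mat_op_add mat_op_scale\<close>)
qed

lemma contraction_complement:
  fixes X :: "'a mat"
  assumes X: "X \<in> carrier_mat n n" "cstar_norm n X \<le> 1"
  obtains H where "H \<in> carrier_mat n n" "mat_star H = H" "mat_star X * X + H * H = 1\<^sub>m n"
proof -
  have "(cstar_norm n X)\<^sup>2 \<le> 1"
    using X cn_nonneg[OF X(1)] by (simp add: power_le_one)
  then have "M.pos (1 *\<^sub>r mat_op n (1\<^sub>m n) - op_star n (mat_op n X) * mat_op n X)"
    using X by (intro M.pos_e_minus)
      (simp_all add: op_star_mat_op cn_cstar mat_star_mult[of _ n n] flip: mat_op_mult)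
  then obtain h where h: "h \<in> mats n" "op_star n h = h"
      "1 *\<^sub>r mat_op n (1\<^sub>m n) - op_star n (mat_op n X) * mat_op n X = h * h"
    using M.pos_iff_square by blast
  obtain H where H: "H \<in> carrier_mat n n" "h = mat_op n H" using h by blast
  show ?thesis
  proof (rule that[OF H(1)])
    show "mat_star H = H" using h(2) H by (simp add: op_star_mat_op mat_op_inj)
    have "mat_op n (1\<^sub>m n) = op_star n (mat_op n X) * mat_op n X + h * h"
      unfolding h(3)[symmetric] by (simp add: scaleC_one)
    then show "mat_star X * X + H * H = 1\<^sub>m n"
      using X H by (simp add: op_star_mat_op mat_op_inj flip: mat_op_mult mat_op_add)
  qed
qed

text \<open>
A bound for the norm of a matrix by exhibiting \<open>1 - X\<^sup>* X\<close> as a square.  It is used for block matrices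
whose complement can be written down block by block.
\<close>

lemma contraction_if_complement:
  fixes X H :: "'a mat"
  assumes X: "X \<in> carrier_mat n n" and H: "H \<in> carrier_mat n n" "mat_star H = H"
    and sum: "mat_star X * X + H * H = 1\<^sub>m n"
  shows "cstar_norm n X \<le> 1"
proof -
  let ?x = "mat_op n X" and ?h = "mat_op n H"
  have h: "?h \<in> mats n" "op_star n ?h = ?h" using H by (auto simp: op_star_mat_op)
  have "op_star n ?x * ?x + ?h * ?h = mat_op n (1\<^sub>m n)"
    using X H sum by (simp add: op_star_mat_op flip: mat_op_mult mat_op_add)
  then have eq: "1 *\<^sub>r mat_op n (1\<^sub>m n) - op_star n ?x * ?x = ?h * ?h"
    by (simp add: scaleC_one eq_diff_eq diff_eq_eq add.commute)
  have "M.pos (1 *\<^sub>r mat_op n (1\<^sub>m n) - op_star n ?x * ?x)"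
    unfolding eq by (rule M.pos_square[OF h])
  then have "cstar_norm n (op_mat n (op_star n ?x * ?x)) \<le> 1"
    using X by (intro M.N_le_if_pos_diff M.pos_st_mult) auto
  then have "(cstar_norm n X)\<^sup>2 \<le> 1"
    using X by (simp add: op_star_mat_op cn_cstar flip: mat_op_mult)
  then show ?thesis using cn_nonneg[OF X] by (simp add: power_le_one_iff abs_square_le_1)
qed

lemma mat_near_isometry:
  fixes Z :: "'a mat"
  assumes Z: "Z \<in> carrier_mat n n" "cstar_norm n Z \<le> S" and s: "0 < s"
    and lower: "cstar_norm n ((S\<^sup>2) *\<^sub>m 1\<^sub>m n - mat_star Z * Z) \<le> S\<^sup>2 - s\<^sup>2"
  obtains V where "V \<in> carrier_mat n n" "mat_star V * V = 1\<^sub>m n"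
    "cstar_norm n (Z - V) \<le> max (S - 1) (1 - s)"
proof -
  have low: "(S\<^sup>2) *\<^sub>r mat_op n (1\<^sub>m n) - op_star n (mat_op n Z) * mat_op n Z
      = mat_op n ((S\<^sup>2) *\<^sub>m 1\<^sub>m n - mat_star Z * Z)"
    using Z by (simp add: op_star_mat_op mat_op_diff mat_op_mult mat_op_scale)
  have "mat_op n Z \<in> mats n" "cstar_norm n (op_mat n (mat_op n Z)) \<le> S"
    "cstar_norm n (op_mat n ((S\<^sup>2) *\<^sub>r mat_op n (1\<^sub>m n) - op_star n (mat_op n Z) * mat_op n Z)) \<le> S\<^sup>2 - s\<^sup>2"
    unfolding low using Z lower by (simp_all add: minus_carrier_mat)
  then obtain v where v: "v \<in> mats n" "op_star n v * v = mat_op n (1\<^sub>m n)"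
      "cstar_norm n (op_mat n (mat_op n Z - v)) \<le> max (S - 1) (1 - s)"
    using M.near_isometry[of "mat_op n Z" S s] s by blast
  then obtain V where V: "V \<in> carrier_mat n n" "v = mat_op n V" by blast
  show ?thesis
    by (rule that[OF V(1)])
      (use v V Z in \<open>simp_all add: op_star_mat_op mat_op_inj minus_carrier_mat flip: mat_op_mult mat_op_diff\<close>)
qed

lemma mat_test_column:
  fixes Z :: "'a mat"
  assumes Z: "Z \<in> carrier_mat n n" "cstar_norm n Z \<le> S" and S: "0 < S"
    and nonzero: "cstar_norm n ((S\<^sup>2) *\<^sub>m 1\<^sub>m n - mat_star Z * Z) \<noteq> 0"
  obtains Y where "Y \<in> carrier_mat n n" "cstar_norm n Y = S"
    "cstar_norm n (mat_star Z * Z + mat_star Y * Y)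
      \<le> 2 * S\<^sup>2 - cstar_norm n ((S\<^sup>2) *\<^sub>m 1\<^sub>m n - mat_star Z * Z)"
proof -
  have low: "(S\<^sup>2) *\<^sub>r mat_op n (1\<^sub>m n) - op_star n (mat_op n Z) * mat_op n Z
      = mat_op n ((S\<^sup>2) *\<^sub>m 1\<^sub>m n - mat_star Z * Z)"
    using Z by (simp add: op_star_mat_op mat_op_diff mat_op_mult mat_op_scale)
  have low_op: "op_mat n ((S\<^sup>2) *\<^sub>r mat_op n (1\<^sub>m n) - op_star n (mat_op n Z) * mat_op n Z)
      = (S\<^sup>2) *\<^sub>m 1\<^sub>m n - mat_star Z * Z"
    unfolding low using Z by (intro op_mat_mat_op minus_carrier_mat) simp
  obtain y where y: "y \<in> mats n" "cstar_norm n (op_mat n y) = S"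
      "cstar_norm n (op_mat n (op_star n (mat_op n Z) * mat_op n Z + op_star n y * y))
        \<le> 2 * S\<^sup>2 - cstar_norm n (op_mat n ((S\<^sup>2) *\<^sub>r mat_op n (1\<^sub>m n) - op_star n (mat_op n Z) * mat_op n Z))"
    using M.test_column[of "mat_op n Z" S] Z S nonzero unfolding low_op by (metis image_eqI op_mat_mat_op)
  then obtain Y where Y: "Y \<in> carrier_mat n n" "y = mat_op n Y" by blast
  show ?thesis
    using y(2,3) Y Z unfolding low_op
    by (intro that[OF Y(1)]) (simp_all add: op_star_mat_op flip: mat_op_mult mat_op_add)
qed

end


section \<open>Padding by zeros\<close>

definition pad :: "nat \<Rightarrow> 'a::unital_cstar_algebra mat \<Rightarrow> 'a mat" where
  "pad m X = mat m m (\<lambda>(i, j). if i < dim_row X \<and> j < dim_col X then X $$ (i, j) else 0)"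

lemma pad_carrier [simp]: "pad m X \<in> carrier_mat m m"
  by (simp add: pad_def)

lemma pad_dim [simp]: "dim_row (pad m X) = m" "dim_col (pad m X) = m"
  by (simp_all add: pad_def)

lemma pad_index [simp]:
  "i < m \<Longrightarrow> j < m \<Longrightarrow> pad m X $$ (i, j) = (if i < dim_row X \<and> j < dim_col X then X $$ (i, j) else 0)"
  by (simp add: pad_def)

lemma rect_norm_pad: "rect_norm X = cstar_norm (max (dim_row X) (dim_col X)) (pad (max (dim_row X) (dim_col X)) X)"
  by (simp add: rect_norm_def pad_def Let_def)

lemma pad_mult:
  assumes "X \<in> carrier_mat n p" "Y \<in> carrier_mat p q" "p \<le> m"
  shows "pad m X * pad m Y = pad m (X * Y)"
proof (rule eq_matI)
  fix i j assume "i < dim_row (pad m (X * Y))" "j < dim_col (pad m (X * Y))"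
  then have ij: "i < m" "j < m" by auto
  have "(pad m X * pad m Y) $$ (i, j) = (\<Sum>k<m. pad m X $$ (i, k) * pad m Y $$ (k, j))"
    using ij by (intro mult_mat_index) auto
  also have "\<dots> = (\<Sum>k<p. pad m X $$ (i, k) * pad m Y $$ (k, j))"
    using assms ij by (intro sum.mono_neutral_right) auto
  also have "\<dots> = (if i < n \<and> j < q then \<Sum>k<p. X $$ (i, k) * Y $$ (k, j) else 0)"
    using assms ij by auto
  also have "\<dots> = pad m (X * Y) $$ (i, j)"
    using assms ij by (simp add: mult_mat_index[of _ n p _ q] del: index_mult_mat(1))
  finally show "(pad m X * pad m Y) $$ (i, j) = pad m (X * Y) $$ (i, j)" .
qed auto

lemma pad_add: "X \<in> carrier_mat n p \<Longrightarrow> Y \<in> carrier_mat n p \<Longrightarrow> pad m (X + Y) = pad m X + pad m Y"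
  by (intro eq_matI) auto

lemma pad_diff: "X \<in> carrier_mat n p \<Longrightarrow> Y \<in> carrier_mat n p \<Longrightarrow> pad m (X - Y) = pad m X - pad m Y"
  by (intro eq_matI) auto

lemma pad_scale: "pad m (c *\<^sub>m X) = c *\<^sub>m pad m X"
  by (intro eq_matI) auto

lemma pad_star: "pad m (mat_star X) = mat_star (pad m X)"
  by (intro eq_matI) auto

lemma pad_eq_0: "X \<in> carrier_mat n n \<Longrightarrow> n \<le> m \<Longrightarrow> pad m X = 0\<^sub>m m m \<longleftrightarrow> X = 0\<^sub>m n n"
proof
  assume X: "X \<in> carrier_mat n n" "n \<le> m" "pad m X = 0\<^sub>m m m"
  have "X $$ (i, j) = 0" if "i < n" "j < n" for i j
  proof -
    have "pad m X $$ (i, j) = 0" using that X(2) by (simp add: X(3))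
    then show ?thesis using that X(1,2) by simp
  qed
  then show "X = 0\<^sub>m n n" using X by (intro eq_matI) auto
qed (auto intro!: eq_matI)

text \<open>
Multiplying on both sides by the projection onto the first \<open>n\<close> coordinates cuts out a corner.
\<close>

lemma pad_compress:
  assumes L: "L \<in> carrier_mat m m" and "n \<le> m"
  shows "pad m (1\<^sub>m n) * L * pad m (1\<^sub>m n) = pad m (mat n n (\<lambda>(i, j). L $$ (i, j)))"
proof (rule eq_matI)
  let ?P = "pad m (1\<^sub>m n) :: 'a mat"
  fix i j assume "i < dim_row (pad m (mat n n (\<lambda>(i, j). L $$ (i, j))))"
    "j < dim_col (pad m (mat n n (\<lambda>(i, j). L $$ (i, j))))"
  then have ij: "i < m" "j < m" by auto
  have left: "(?P * L) $$ (i, k) = (if i < n then L $$ (i, k) else 0)" if "k < m" for k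
  proof -
    have "(?P * L) $$ (i, k) = (\<Sum>l<m. ?P $$ (i, l) * L $$ (l, k))"
      using ij that L by (intro mult_mat_index) auto
    also have "\<dots> = (\<Sum>l<m. if l = i then if i < n then L $$ (i, k) else 0 else 0)"
      using ij by (intro sum.cong) auto
    finally show ?thesis using ij by simp
  qed
  have "(?P * L * ?P) $$ (i, j) = (\<Sum>k<m. (?P * L) $$ (i, k) * ?P $$ (k, j))"
    using ij L by (intro mult_mat_index[of _ m m _ m] mult_carrier_mat) auto
  also have "\<dots> = (\<Sum>k<m. if k = j then if i < n \<and> j < n then L $$ (i, j) else 0 else 0)"
    using ij by (intro sum.cong) (auto simp: left simp del: index_mult_mat(1))
  finally show "(?P * L * ?P) $$ (i, j) = pad m (mat n n (\<lambda>(i, j). L $$ (i, j))) $$ (i, j)"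
    using ij by simp
qed (use L in auto)

text \<open>
The padded norm is a C*-norm on \<open>n \<times> n\<close> matrices, hence the only one.  It is complete because limits of
padded matrices remain unchanged by compression to the corner.
\<close>

lemma cn_pad:
  fixes X :: "'a::unital_cstar_algebra mat"
  assumes X: "X \<in> carrier_mat n n" and nm: "n \<le> m"
  shows "cstar_norm m (pad m X) = cstar_norm n X"
proof -
  define N where "N Y = (if Y \<in> carrier_mat n n then cstar_norm m (pad m Y) else 0)" for Y :: "'a mat"
  have "is_matrix_cstar_norm n N"
    unfolding is_matrix_cstar_norm_def
  proof (intro conjI ballI allI impI)
    fix S :: "nat \<Rightarrow> 'a mat"
    assume S: "\<forall>k. S k \<in> carrier_mat n n"
      and C: "\<forall>e>0. \<exists>K. \<forall>k\<ge>K. \<forall>l\<ge>K. N (S k - S l) < e"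
    have Sk: "S k \<in> carrier_mat n n" for k using S by simp
    have N_diff: "N (S k - L) = cstar_norm m (pad m (S k) - pad m L)" if "L \<in> carrier_mat n n" for k L
      using that Sk[of k] by (simp add: N_def minus_carrier_mat pad_diff[of _ n n])
    have "\<exists>L\<in>carrier_mat m m. (\<lambda>k. cstar_norm m (pad m (S k) - L)) \<longlonglongrightarrow> 0"
      using is_matrix_cstar_norm_cstar_norm[of m, where 'a = 'a, unfolded is_matrix_cstar_norm_def]
        C Sk by (simp add: N_diff)
    then obtain L where L: "L \<in> carrier_mat m m" "(\<lambda>k. cstar_norm m (pad m (S k) - L)) \<longlonglongrightarrow> 0"
      by blast
    define P where "P = (pad m (1\<^sub>m n) :: 'a mat)"
    define K where "K = mat n n (\<lambda>(i, j). L $$ (i, j))"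
    have P: "P \<in> carrier_mat m m" by (simp add: P_def)
    have K: "K \<in> carrier_mat n n" by (simp add: K_def)
    have bound: "N (S k - K) \<le> cstar_norm m P * cstar_norm m (pad m (S k) - L) * cstar_norm m P" for k
    proof -
      have D: "pad m (S k) - L \<in> carrier_mat m m" using L by (intro minus_carrier_mat)
      have "P * pad m (S k) * P = pad m (S k)"
        unfolding P_def using Sk[of k] nm
        by (simp add: pad_mult[of _ n n _ n])
      then have "pad m (S k) - pad m K = P * (pad m (S k) - L) * P"
        using pad_compress[OF L(1) nm, folded P_def K_def] L(1) P Sk[of k]
        by (simp add: mult_minus_distrib_mat[of _ m m _ m]
            minus_mult_distrib_mat[of _ m m _ _ m])
      then have "N (S k - K) = cstar_norm m (P * (pad m (S k) - L) * P)"
        by (simp add: N_diff[OF K])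
      also have "\<dots> \<le> cstar_norm m (P * (pad m (S k) - L)) * cstar_norm m P"
        using P D by (intro cn_mult) auto
      also have "\<dots> \<le> (cstar_norm m P * cstar_norm m (pad m (S k) - L)) * cstar_norm m P"
        using P D by (intro mult_right_mono cn_mult cn_nonneg) auto
      finally show ?thesis .
    qed
    have "(\<lambda>k. cstar_norm m P * cstar_norm m (pad m (S k) - L) * cstar_norm m P) \<longlonglongrightarrow> 0"
      using L(2) by (intro tendsto_mult_left_zero tendsto_mult_right_zero)
    moreover have "0 \<le> N (S k - K)" for k
      by (simp add: N_def cn_nonneg)
    ultimately have "(\<lambda>k. N (S k - K)) \<longlonglongrightarrow> 0"
      using bound
      by (intro tendsto_sandwich[of "\<lambda>k. 0" "\<lambda>k. N (S k - K)" sequentially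
            "\<lambda>k. cstar_norm m P * cstar_norm m (pad m (S k) - L) * cstar_norm m P" 0]
          always_eventually allI tendsto_const)
    then show "\<exists>L\<in>carrier_mat n n. (\<lambda>k. N (S k - L)) \<longlonglongrightarrow> 0"
      using K by blast
  next
    fix A B :: "'a mat" assume AB: "A \<in> carrier_mat n n" "B \<in> carrier_mat n n"
    then have "pad m (A * B) = pad m A * pad m B"
      using nm by (intro pad_mult[symmetric])
    then show "N (A * B) \<le> N A * N B"
      using AB by (simp add: N_def cn_mult)
  next
    fix A :: "'a mat" assume A: "A \<in> carrier_mat n n"
    then have "pad m (mat_star A * A) = mat_star (pad m A) * pad m A"
      using nm pad_mult[of "mat_star A" n n A n m] by (simp add: pad_star)
    then show "N (mat_star A * A) = (N A)\<^sup>2"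
      using A by (simp add: N_def cn_cstar)
  next
    fix A :: "'a mat" assume A: "A \<in> carrier_mat n n"
    then show "(N A = 0) = (A = 0\<^sub>m n n)"
      using nm by (simp add: N_def cn_eq_0 pad_eq_0)
  qed (auto simp: N_def cn_nonneg cn_triangle cn_scale pad_add[of _ n n] pad_scale)
  then have "N = cstar_norm n"
    by (rule matrix_cstar_norm_unique[OF _ is_matrix_cstar_norm_cstar_norm])
  then show ?thesis using X by (metis N_def)
qed


section \<open>Two by two block matrices\<close>

abbreviation block where "block \<equiv> four_block_mat"

lemma block_mult:
  assumes "A \<in> carrier_mat n n" "B \<in> carrier_mat n n" "C \<in> carrier_mat n n" "D \<in> carrier_mat n n"
    "A' \<in> carrier_mat n n" "B' \<in> carrier_mat n n" "C' \<in> carrier_mat n n" "D' \<in> carrier_mat n n"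
  shows "block A B C D * block A' B' C' D'
    = block (A * A' + B * C') (A * B' + B * D') (C * A' + D * C') (C * B' + D * D')"
  using assms by (intro mult_four_block_mat)

lemma block_carrier [simp]:
  "A \<in> carrier_mat n n \<Longrightarrow> D \<in> carrier_mat n n \<Longrightarrow> block A B C D \<in> carrier_mat (n + n) (n + n)"
  by simp

lemma block_star:
  assumes "A \<in> carrier_mat n n" "B \<in> carrier_mat n n" "C \<in> carrier_mat n n" "D \<in> carrier_mat n n"
  shows "mat_star (block A B C D) = block (mat_star A) (mat_star C) (mat_star B) (mat_star D)"
  using assms by (intro eq_matI) auto

lemma block_corner_pad:
  "A \<in> carrier_mat n n \<Longrightarrow> block A (0\<^sub>m n n) (0\<^sub>m n n) (0\<^sub>m n n) = pad (n + n) A"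
  by (intro eq_matI) auto

lemma cn_corner:
  assumes "A \<in> carrier_mat n n"
  shows "cstar_norm (n + n) (block A (0\<^sub>m n n) (0\<^sub>m n n) (0\<^sub>m n n)) = cstar_norm n A"
  using assms by (simp add: block_corner_pad cn_pad)

text \<open>
The C*-identity for the block matrix with this first column.
\<close>

lemma cn_column:
  assumes A: "A \<in> carrier_mat n n" and B: "B \<in> carrier_mat n n"
  shows "(cstar_norm (n + n) (block A (0\<^sub>m n n) B (0\<^sub>m n n)))\<^sup>2
    = cstar_norm n (mat_star A * A + mat_star B * B)"
proof -
  have "mat_star (block A (0\<^sub>m n n) B (0\<^sub>m n n)) * block A (0\<^sub>m n n) B (0\<^sub>m n n)
      = block (mat_star A * A + mat_star B * B) (0\<^sub>m n n) (0\<^sub>m n n) (0\<^sub>m n n)"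
    using A B by (simp add: block_star[of _ n] mat_star_zero block_mult[of _ n])
  then show ?thesis
    using A B cn_cstar[of "block A (0\<^sub>m n n) B (0\<^sub>m n n)" "n + n"]
      cn_corner[of "mat_star A * A + mat_star B * B" n] by simp
qed

lemma
  fixes A :: "'a::unital_cstar_algebra mat"
  assumes ABCD: "A \<in> carrier_mat n n" "B \<in> carrier_mat n n" "C \<in> carrier_mat n n" "D \<in> carrier_mat n n"
    and n: "1 \<le> n"
  shows cn_block_upper_left: "cstar_norm n A \<le> cstar_norm (n + n) (block A B C D)"
    and cn_block_upper_right: "cstar_norm n B \<le> cstar_norm (n + n) (block A B C D)"
proof -
  let ?Z = "0\<^sub>m n n :: 'a mat" and ?I = "1\<^sub>m n :: 'a mat"
  let ?E = "block ?I ?Z ?Z ?Z" and ?J = "block ?Z ?Z ?I ?Z" and ?X = "block A B C D"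
  have E: "cstar_norm (n + n) ?E = 1"
    using n cn_corner[of ?I n] by (simp add: cn_one)
  have "(cstar_norm (n + n) ?J)\<^sup>2 = 1"
    using n by (subst cn_column) (simp_all add: mat_star_zero mat_star_one cn_one)
  then have J: "cstar_norm (n + n) ?J = 1"
    using cn_nonneg[of ?J "n + n"] by (simp add: power2_eq_1_iff)
  have X: "?X \<in> carrier_mat (n + n) (n + n)" using ABCD by simp
  have EX: "?E * ?X \<in> carrier_mat (n + n) (n + n)" using X by (intro mult_carrier_mat[of _ _ "n + n"]) simp_all
  have comp: "cstar_norm (n + n) (?E * ?X * F) \<le> cstar_norm (n + n) ?X"
    if F: "F \<in> carrier_mat (n + n) (n + n)" "cstar_norm (n + n) F = 1" for F
  proof -
    have "cstar_norm (n + n) (?E * ?X * F) \<le> cstar_norm (n + n) (?E * ?X) * 1"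
      using cn_mult[OF EX F(1)] F(2) by simp
    also have "\<dots> \<le> cstar_norm (n + n) ?X"
      using cn_mult[of ?E "n + n" ?X] X E by simp
    finally show ?thesis .
  qed
  have "?E * ?X * ?E = block A ?Z ?Z ?Z" "?E * ?X * ?J = block B ?Z ?Z ?Z"
    using ABCD by (simp_all add: block_mult[of _ n])
  then show "cstar_norm n A \<le> cstar_norm (n + n) ?X" "cstar_norm n B \<le> cstar_norm (n + n) ?X"
    using comp[of ?E] comp[of ?J] E J ABCD by (simp_all add: cn_corner)
qed

section \<open>Amplifications of linear maps\<close>

lemma scaleC_two: "2 *\<^sub>C x = x + (x :: 'a::complex_vector)"
  using scaleC_add_left[of 1 1 x] by (simp add: scaleC_one)

lemma
  fixes f :: "'a::complex_vector \<Rightarrow> 'b::complex_vector"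
  assumes "complex_linear f"
  shows clin_add: "f (x + y) = f x + f y" and clin_scale: "f (c *\<^sub>C x) = c *\<^sub>C f x"
    and clin_zero: "f 0 = 0"
proof -
  show add: "f (x + y) = f x + f y" and scale: "f (c *\<^sub>C x) = c *\<^sub>C f x" for x y c
    using assms by (simp_all add: complex_linear_iff)
  show "f 0 = 0" using scale[of 0 0] by simp
qed

lemma clin_sum: "complex_linear f \<Longrightarrow> f (sum g A) = (\<Sum>i\<in>A. f (g i))"
  by (induction A rule: infinite_finite_induct) (simp_all add: clin_zero clin_add)

lemma
  fixes f :: "'a::complex_vector \<Rightarrow> 'b::complex_vector"
  assumes f: "complex_linear f"
  shows map_mat_add: "X \<in> carrier_mat n m \<Longrightarrow> Y \<in> carrier_mat n m \<Longrightarrow> map_mat f (X + Y) = map_mat f X + map_mat f Y"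
    and map_mat_scale: "map_mat f (c *\<^sub>m X) = c *\<^sub>m map_mat f X"
    and map_mat_zero: "map_mat f (0\<^sub>m n m) = 0\<^sub>m n m"
  by (auto intro!: eq_matI simp: clin_add[OF f] clin_scale[OF f] clin_zero[OF f])

lemma map_mat_pad:
  "complex_linear f \<Longrightarrow> map_mat f (pad m X) = pad m (map_mat f X)"
  by (intro eq_matI) (auto simp: clin_zero)

lemma map_mat_one:
  "complex_linear f \<Longrightarrow> f 1 = 1 \<Longrightarrow> map_mat f (1\<^sub>m n) = 1\<^sub>m n"
  by (intro eq_matI) (auto simp: clin_zero)

lemma map_mat_block:
  assumes "A \<in> carrier_mat n n" "B \<in> carrier_mat n n" "C \<in> carrier_mat n n" "D \<in> carrier_mat n n"
  shows "map_mat f (block A B C D) = block (map_mat f A) (map_mat f B) (map_mat f C) (map_mat f D)"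
  using assms by (intro map_four_block_mat)

lemma cn_zero: "cstar_norm n (0\<^sub>m n n) = 0"
  by (simp add: cn_eq_0)

lemma amplification_bounded_if_contractions:
  fixes f :: "'a::unital_cstar_algebra \<Rightarrow> 'b::unital_cstar_algebra"
  assumes f: "complex_linear f" and X: "X \<in> carrier_mat n n"
    and bound: "\<And>Y. Y \<in> carrier_mat n n \<Longrightarrow> cstar_norm n Y \<le> 1 \<Longrightarrow> cstar_norm n (map_mat f Y) \<le> K"
  shows "cstar_norm n (map_mat f X) \<le> K * cstar_norm n X"
proof (cases "cstar_norm n X = 0")
  case True
  then have "X = 0\<^sub>m n n" using X by (simp add: cn_eq_0)
  then show ?thesis by (simp add: map_mat_zero[OF f] cn_zero)
next
  case False
  define r where "r = cstar_norm n X"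
  have r: "r > 0" using False cn_nonneg[OF X] by (simp add: r_def order_less_le)
  have "cstar_norm n (map_mat f (of_real (1 / r) *\<^sub>m X)) \<le> K"
    using X r by (intro bound) (auto simp: cn_scale norm_divide r_def[symmetric])
  then have "cstar_norm n (map_mat f X) / r \<le> K"
    using X r by (simp add: map_mat_scale[OF f] cn_scale norm_divide)
  then show ?thesis using r by (simp add: field_simps r_def[symmetric])
qed

lemma cb_norm_bound:
  fixes f :: "'a::unital_cstar_algebra \<Rightarrow> 'b::unital_cstar_algebra"
  assumes f: "cb_map f" and n: "1 \<le> n" and X: "X \<in> carrier_mat n n"
  shows "cstar_norm n (map_mat f X) \<le> \<parallel>f\<parallel>\<^sub>c\<^sub>b * cstar_norm n X"
proof (rule amplification_bounded_if_contractions[OF _ X])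
  show "complex_linear f" using f by (simp add: completely_bounded_def)
  fix Y :: "'a mat" assume "Y \<in> carrier_mat n n" "cstar_norm n Y \<le> 1"
  then have "cstar_norm n (map_mat f Y) \<in> amplification_norms cstar_norm cstar_norm f"
    using n by (auto simp: amplification_norms_def)
  then show "cstar_norm n (map_mat f Y) \<le> \<parallel>f\<parallel>\<^sub>c\<^sub>b"
    using f by (simp add: cb_norm_def completely_bounded_def cSup_upper)
qed

lemma
  assumes lin: "complex_linear f"
    and bound: "\<And>n X. 1 \<le> n \<Longrightarrow> X \<in> carrier_mat n n \<Longrightarrow> M n X \<le> 1 \<Longrightarrow> N n (map_mat f X) \<le> K"
    and ne: "M 1 (0\<^sub>m 1 1) \<le> 1"
  shows completely_boundedI: "completely_bounded M N f" and cb_norm_leI: "cb_norm M N f \<le> K"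
proof -
  have le: "r \<le> K" if "r \<in> amplification_norms M N f" for r
    using that bound by (auto simp: amplification_norms_def)
  then show "completely_bounded M N f"
    using lin by (auto simp: completely_bounded_def intro: bdd_aboveI[of _ K])
  have "N 1 (map_mat f (0\<^sub>m 1 1)) \<in> amplification_norms M N f"
    using ne by (auto simp: amplification_norms_def intro!: exI[of _ 1] exI[of _ "0\<^sub>m 1 1"])
  then show "cb_norm M N f \<le> K"
    unfolding cb_norm_def using le by (intro cSup_least) auto
qed


section \<open>Dilation to self-adjoint contractions\<close>

text \<open>
\<open>H * H\<close> is the diagonal matrix with entries \<open>X X\<^sup>*\<close> and \<open>X\<^sup>* X\<close>, so \<open>H\<close> is a contraction.  A
self-adjoint contraction is the average of the unitaries \<open>H \<plusminus> \<i> sqrt (1 - H\<^sup>2)\<close>.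
\<close>

lemma selfadjoint_dilation:
  fixes X :: "'a::unital_cstar_algebra mat"
  assumes n: "1 \<le> n" and X: "X \<in> carrier_mat n n" "cstar_norm n X \<le> 1"
  defines "H \<equiv> block (0\<^sub>m n n) X (mat_star X) (0\<^sub>m n n)"
  obtains U where "U \<in> carrier_mat (n + n) (n + n)" "mat_star U * U = 1\<^sub>m (n + n)"
    "U * mat_star U = 1\<^sub>m (n + n)" "H = (1/2) *\<^sub>m (U + mat_star U)"
proof -
  obtain h where h: "h \<in> carrier_mat n n" "mat_star h = h" "mat_star X * X + h * h = 1\<^sub>m n"
    using contraction_complement[OF n X] by blast
  obtain k where k: "k \<in> carrier_mat n n" "mat_star k = k" "X * mat_star X + k * k = 1\<^sub>m n"
    using contraction_complement[OF n, of "mat_star X"] X n by (auto simp: cn_star)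
  have H: "H \<in> carrier_mat (n + n) (n + n)" "mat_star H = H"
    using X(1) by (simp_all add: H_def block_star[of _ n] mat_star_zero)
  let ?K = "block k (0\<^sub>m n n) (0\<^sub>m n n) h"
  have K: "?K \<in> carrier_mat (n + n) (n + n)" "mat_star ?K = ?K"
    using h k by (simp_all add: block_star[of _ n] mat_star_zero)
  have "mat_star H * H + ?K * ?K = 1\<^sub>m (n + n)"
  proof -
    have HH: "H * H = block (X * mat_star X) (0\<^sub>m n n) (0\<^sub>m n n) (mat_star X * X)"
      unfolding H_def using X(1) by (simp add: block_mult[of _ n])
    have KK: "?K * ?K = block (k * k) (0\<^sub>m n n) (0\<^sub>m n n) (h * h)"
      using h k by (simp add: block_mult[of _ n])
    have "H * H + ?K * ?K = block (X * mat_star X + k * k) (0\<^sub>m n n + 0\<^sub>m n n) (0\<^sub>m n n + 0\<^sub>m n n)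
        (mat_star X * X + h * h)"
      unfolding HH KK using X(1) h k by (intro add_four_block_mat[of _ n n _ n _ n]) auto
    also have "\<dots> = 1\<^sub>m (n + n)" by (simp add: h(3) k(3))
    finally show ?thesis by (simp add: H(2))
  qed
  then have "cstar_norm (n + n) H \<le> 1"
    using n by (intro contraction_if_complement[OF _ H(1) K]) auto
  then show ?thesis
    using selfadjoint_mat_average[of "n + n" H] H n that by auto
qed


section \<open>Almost isometric unital isomorphisms\<close>

lemma cn_isometry:
  assumes "1 \<le> n" "U \<in> carrier_mat n n" "mat_star U * U = 1\<^sub>m n"
  shows "cstar_norm n U = 1"
proof -
  have "(cstar_norm n U)\<^sup>2 = 1" using cn_cstar[OF assms(2)] assms by (simp add: cn_one)
  then show ?thesis using cn_nonneg[OF assms(2)] by (simp add: power2_eq_1_iff)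
qed

text \<open>
The quantities \<open>S\<close> and \<open>R\<close> bound all amplifications of \<open>T\<close> and of its inverse \<open>T'\<close>.
\<close>

locale near_isomorphism =
  fixes T :: "'a::unital_cstar_algebra \<Rightarrow> 'b::unital_cstar_algebra" and T' :: "'b \<Rightarrow> 'a"
    and S R :: real
  assumes lin: "complex_linear T" and lin': "complex_linear T'"
    and T'_T: "T' (T x) = x" and T_T': "T (T' y) = y" and T_one: "T 1 = 1"
    and T_bound: "1 \<le> n \<Longrightarrow> X \<in> carrier_mat n n \<Longrightarrow> cstar_norm n (map_mat T X) \<le> S * cstar_norm n X"
    and T'_bound: "1 \<le> n \<Longrightarrow> Y \<in> carrier_mat n n \<Longrightarrow> cstar_norm n (map_mat T' Y) \<le> R * cstar_norm n Y"
    and SR: "S * R < sqrt 2"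
begin

text \<open>
The lower bound for \<open>\<bar>T U\<bar>\<close> when \<open>U\<close> is an isometry.
\<close>

definition s :: real where "s = sqrt (2 / R\<^sup>2 - S\<^sup>2)"

text \<open>
The distance of \<open>T U\<close> from an isometry; this is \<open>mu T\<close> for the optimal \<open>S\<close> and \<open>R\<close>.
\<close>

definition m :: real where "m = max (S - 1) (1 - s)"

text \<open>
The error in a product of two isometries near \<open>T U\<close> and \<open>T V\<close>.
\<close>

definition k :: real where "k = 2 * sqrt ((S + m / sqrt 2)\<^sup>2 - 1)"

lemma T'_one: "T' 1 = 1"
  using T'_T[of 1] by (simp add: T_one)

lemma S_ge_1: "1 \<le> S" and R_ge_1: "1 \<le> R"
  using T_bound[of 1 "1\<^sub>m 1"] T'_bound[of 1 "1\<^sub>m 1"]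
  by (simp_all add: map_mat_one[OF lin T_one] map_mat_one[OF lin' T'_one] cn_one)

lemma s_pos: "0 < s" and s_sq: "s\<^sup>2 = 2 / R\<^sup>2 - S\<^sup>2"
proof -
  have "(S * R)\<^sup>2 < 2"
    using SR S_ge_1 R_ge_1 by (metis abs_of_nonneg mult_nonneg_nonneg order_trans
        real_sqrt_abs real_sqrt_less_iff zero_le_one)
  then have "S\<^sup>2 < 2 / R\<^sup>2"
    using R_ge_1 by (simp add: power_mult_distrib pos_less_divide_eq)
  then show "0 < s" "s\<^sup>2 = 2 / R\<^sup>2 - S\<^sup>2" by (simp_all add: s_def)
qed

text \<open>
Compare the column \<open>F\<close> with entries \<open>Z = T U\<close> and \<open>Y\<close> with its preimage \<open>G\<close>, whose entries are \<open>U\<close> and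
\<open>Y' = T' Y\<close>.  From \<open>\<parallel>Y\<parallel> = S\<close> follows \<open>1 \<le> \<parallel>Y'\<parallel>\<close>, hence \<open>2 \<le> \<parallel>G\<parallel>\<^sup>2 \<le> R\<^sup>2 * \<parallel>F\<parallel>\<^sup>2\<close>.  The test column \<open>Y\<close> is chosen
such that \<open>\<parallel>F\<parallel>\<^sup>2 \<le> 2 * S\<^sup>2 - r\<close>, where \<open>r\<close> is the norm to be bounded.
\<close>

lemma image_lower_bound:
  assumes n: "1 \<le> n" and U: "U \<in> carrier_mat n n" "mat_star U * U = 1\<^sub>m n"
  shows "cstar_norm n ((S\<^sup>2) *\<^sub>m 1\<^sub>m n - mat_star (map_mat T U) * map_mat T U) \<le> S\<^sup>2 - s\<^sup>2"
proof -
  let ?Z = "map_mat T U"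
  define r where "r = cstar_norm n ((S\<^sup>2) *\<^sub>m 1\<^sub>m n - mat_star ?Z * ?Z)"
  have S0: "0 < S" using S_ge_1 by simp
  have NZ: "cstar_norm n ?Z \<le> S" using T_bound[OF n U(1)] cn_isometry[OF n U] by simp
  have Z: "?Z \<in> carrier_mat n n" using U by simp
  have "2 \<le> R\<^sup>2 * (2 * S\<^sup>2 - r)"
  \<comment> \<open>for \<open>r = 0\<close> there is no test column, but the claim follows from \<open>1 \<le> R * S\<close>\<close>
  proof (cases "r = 0")
    case True
    have "1 \<le> R\<^sup>2" "1 \<le> S\<^sup>2" using R_ge_1 S_ge_1 by simp_all
    then show ?thesis using mult_mono[of 1 "R\<^sup>2" 1 "S\<^sup>2"] True by simp
  next
    case False
    obtain Y where Y: "Y \<in> carrier_mat n n" "cstar_norm n Y = S"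
      "cstar_norm n (mat_star ?Z * ?Z + mat_star Y * Y) \<le> 2 * S\<^sup>2 - r"
      using mat_test_column[OF n Z NZ S0] False unfolding r_def by blast
    let ?Y' = "map_mat T' Y"
    have Y': "?Y' \<in> carrier_mat n n" using Y by simp
    let ?F = "block ?Z (0\<^sub>m n n) Y (0\<^sub>m n n)"
    have F: "?F \<in> carrier_mat (n + n) (n + n)" using Z by simp
    have T'_Z: "map_mat T' ?Z = U" by (intro eq_matI) (auto simp: T'_T)
    have T_Y': "map_mat T ?Y' = Y" by (intro eq_matI) (auto simp: T_T')
    have G: "map_mat T' ?F = block U (0\<^sub>m n n) ?Y' (0\<^sub>m n n)"
      using map_mat_block[of ?Z n "0\<^sub>m n n" Y "0\<^sub>m n n" T'] Z Y
      by (simp add: T'_Z map_mat_zero[OF lin'])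
    have "S \<le> S * cstar_norm n ?Y'" using T_bound[OF n Y'] by (simp add: T_Y' Y)
    then have "1 \<le> cstar_norm n ?Y'" using S0 by simp
    then have "1 \<le> (cstar_norm n ?Y')\<^sup>2" by simp
    then have "2 \<le> cstar_norm n (1\<^sub>m n + mat_star ?Y' * ?Y')"
      using one_plus_cn_le[OF n Y'] by simp
    also have "\<dots> = (cstar_norm (n + n) (map_mat T' ?F))\<^sup>2"
      unfolding G using cn_column[OF U(1) Y'] by (simp add: U(2))
    also have "\<dots> \<le> (R * cstar_norm (n + n) ?F)\<^sup>2"
      using n F by (intro power_mono T'_bound cn_nonneg) auto
    also have "\<dots> = R\<^sup>2 * cstar_norm n (mat_star ?Z * ?Z + mat_star Y * Y)"
      using cn_column[OF Z Y(1)] by (simp add: power_mult_distrib)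
    also have "\<dots> \<le> R\<^sup>2 * (2 * S\<^sup>2 - r)" using Y(3) by (intro mult_left_mono) auto
    finally show ?thesis .
  qed
  then have "2 / R\<^sup>2 \<le> 2 * S\<^sup>2 - r" using R_ge_1 by (simp add: field_simps)
  then show ?thesis by (simp add: r_def s_sq)
qed

lemma image_near_isometry:
  assumes n: "1 \<le> n" and U: "U \<in> carrier_mat n n" "mat_star U * U = 1\<^sub>m n"
  obtains V where "V \<in> carrier_mat n n" "mat_star V * V = 1\<^sub>m n" "cstar_norm n (map_mat T U - V) \<le> m"
proof -
  have "cstar_norm n (map_mat T U) \<le> S" using T_bound[OF n U(1)] cn_isometry[OF n U] by simp
  then show ?thesis
    using mat_near_isometry[OF n _ _ s_pos image_lower_bound[OF n U]] U that unfolding m_def by auto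
qed

text \<open>
\<open>W\<close> is \<open>sqrt 2\<close> times an isometry since \<open>U\<close> and \<open>V\<close> are isometries, and the column \<open>Z\<close> has norm \<open>sqrt 2\<close>,
so \<open>\<parallel>T W * Z\<parallel> \<le> 2 * S\<close>.  This product is \<open>P + Q\<close>, where \<open>P\<close> would be the product if \<open>T U\<close> and \<open>T V\<close> were \<open>u\<close> and
\<open>v\<close>, and \<open>Q\<close> is a column with two entries of norm at most \<open>m\<close>.  The two entries \<open>2 v\<close> and \<open>D\<close> of \<open>P\<close> give
\<open>\<parallel>P\<parallel>\<^sup>2 = 4 * \<parallel>1 + D\<^sup>* D / 4\<parallel>\<close>.
\<close>

lemma product_estimate:
  assumes n: "1 \<le> n"
    and U: "U \<in> carrier_mat n n" "mat_star U * U = 1\<^sub>m n"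
    and V: "V \<in> carrier_mat n n" "mat_star V * V = 1\<^sub>m n"
    and u: "u \<in> carrier_mat n n" "cstar_norm n (map_mat T U - u) \<le> m"
    and v: "v \<in> carrier_mat n n" "mat_star v * v = 1\<^sub>m n" "cstar_norm n (map_mat T V - v) \<le> m"
  shows "cstar_norm n (u * v - map_mat T (U * V)) \<le> k"
proof -
  let ?O = "0\<^sub>m n n" and ?I = "1\<^sub>m n"
  define W where "W = block ?I ((-1) *\<^sub>m V) U (U * V)"
  define Z where "Z = block v ?O ((-1) *\<^sub>m ?I) ?O"
  have W_in: "W \<in> carrier_mat (n + n) (n + n)" and Z_in: "Z \<in> carrier_mat (n + n) (n + n)"
    using U V v by (simp_all add: W_def Z_def)
  have nn: "1 \<le> n + n" using n by simp
  have UUV: "mat_star U * (U * V) = V"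
    using U V by (simp flip: assoc_mult_mat[of _ n n _ n _ n])
  have VU: "mat_star V * mat_star U * U = mat_star V"
    using U V by (simp add: assoc_mult_mat[of _ n n _ n _ n])
  have VUUV: "mat_star V * mat_star U * (U * V) = ?I"
    using U V UUV by (simp add: assoc_mult_mat[of _ n n _ n _ n])
  have cancel: "(-1) *\<^sub>m A + A = ?O" "A + A = 2 *\<^sub>m A" if "A \<in> carrier_mat n n" for A :: "'a mat"
    using that by (auto intro!: eq_matI simp: scaleC_minus_one scaleC_two)
  have "mat_star W * W = 2 *\<^sub>m 1\<^sub>m (n + n)"
  proof -
    have "mat_star W * W = block (?I + ?I) ((-1) *\<^sub>m V + V)
        ((-1) *\<^sub>m mat_star V + mat_star V) (?I + ?I)"
      using U V
      by (simp add: W_def block_star[of _ n] block_mult[of _ n] mat_star_one mat_star_scale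
          mat_star_mult[of _ n n _ n] mscale_mult_left[of _ n n _ n] mscale_mult_right[of _ n n _ n]
          mscale_mscale mscale_one UUV VU VUUV)
    also have "\<dots> = block (2 *\<^sub>m ?I) ?O ?O (2 *\<^sub>m ?I)"
      using cancel[of V] cancel[of "mat_star V"] cancel[of ?I] V by simp
    also have "\<dots> = 2 *\<^sub>m 1\<^sub>m (n + n)" by (intro eq_matI) auto
    finally show ?thesis .
  qed
  then have "(cstar_norm (n + n) W)\<^sup>2 = 2"
    using cn_cstar[OF W_in] nn by (simp add: cn_scale cn_one)
  then have W: "cstar_norm (n + n) W = sqrt 2"
    using cn_nonneg[OF W_in] by (metis real_sqrt_abs abs_of_nonneg)
  have "(cstar_norm (n + n) Z)\<^sup>2 = cstar_norm n (2 *\<^sub>m ?I :: 'b mat)"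
  proof -
    have "(cstar_norm (n + n) Z)\<^sup>2 = cstar_norm n (?I + ?I :: 'b mat)"
      unfolding Z_def using v
      by (simp add: cn_column mat_star_one mat_star_scale mscale_mult_left[of _ n n _ n]
          mscale_mult_right[of _ n n _ n] mscale_mscale mscale_one)
    also have "?I + ?I = (2 *\<^sub>m ?I :: 'b mat)"
      by (auto intro!: eq_matI simp: scaleC_two)
    finally show ?thesis .
  qed
  then have "(cstar_norm (n + n) Z)\<^sup>2 = 2" using n by (simp add: cn_scale cn_one)
  then have Z: "cstar_norm (n + n) Z = sqrt 2"
    using cn_nonneg[OF Z_in] by (metis real_sqrt_abs abs_of_nonneg)
  define D where "D = u * v - map_mat T (U * V)"
  have UV: "map_mat T (U * V) \<in> carrier_mat n n" using U V by simp
  have D: "D \<in> carrier_mat n n" unfolding D_def using UV by (rule minus_carrier_mat)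
  define P where "P = block (2 *\<^sub>m v) ?O D ?O"
  define Q where "Q = block (map_mat T V - v) ?O ((map_mat T U - u) * v) ?O"
  have diffs: "map_mat T V - v \<in> carrier_mat n n" "(map_mat T U - u) * v \<in> carrier_mat n n"
      "map_mat T U - u \<in> carrier_mat n n"
    using u v by (auto intro: minus_carrier_mat)
  have P_in: "P \<in> carrier_mat (n + n) (n + n)" and Q_in: "Q \<in> carrier_mat (n + n) (n + n)"
    using v D diffs by (simp_all add: P_def Q_def)
  have TW: "map_mat T W = block ?I ((-1) *\<^sub>m map_mat T V) (map_mat T U) (map_mat T (U * V))"
    unfolding W_def using U V
    by (subst map_mat_block[of _ n]) (simp_all add: map_mat_one[OF lin T_one] map_mat_scale[OF lin])
  have sum: "map_mat T W * Z = P + Q"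
  proof -
    have "map_mat T W * Z = block (v + map_mat T V) ?O (map_mat T U * v + (-1) *\<^sub>m map_mat T (U * V)) ?O"
      unfolding TW Z_def using U V v UV
      by (simp add: block_mult[of _ n] mscale_mult_left[of _ n n _ n]
          mscale_mult_right[of _ n n _ n] mscale_mscale mscale_one)
    also have "v + map_mat T V = 2 *\<^sub>m v + (map_mat T V - v)"
      using v V by (auto intro!: eq_matI simp: scaleC_two)
    also have "map_mat T U * v + (-1) *\<^sub>m map_mat T (U * V) = D + (map_mat T U - u) * v"
    proof -
      have "(map_mat T U - u) * v = map_mat T U * v - u * v"
        using U u v by (intro minus_mult_distrib_mat[of _ n n]) auto
      then show ?thesis
        unfolding D_def using UV U V u v
        by (auto intro!: eq_matI simp: scaleC_minus_one simp del: index_mult_mat(1))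
    qed
    also have "block (2 *\<^sub>m v + (map_mat T V - v)) ?O (D + (map_mat T U - u) * v) ?O = P + Q"
      unfolding P_def Q_def using v D diffs by (subst add_four_block_mat[of _ n n _ n _ n]) auto
    finally show ?thesis .
  qed
  have "cstar_norm (n + n) (map_mat T W * Z) \<le> cstar_norm (n + n) (map_mat T W) * cstar_norm (n + n) Z"
    using W_in Z_in by (intro cn_mult) auto
  also have "\<dots> \<le> (S * sqrt 2) * sqrt 2"
    using T_bound[OF nn W_in] unfolding W Z by (intro mult_right_mono) auto
  finally have PQ: "cstar_norm (n + n) (P + Q) \<le> 2 * S" by (simp add: sum mult.assoc)
  have m0: "0 \<le> m" using S_ge_1 by (simp add: m_def)
  have "cstar_norm n ((map_mat T U - u) * v) \<le> m * 1"
    using cn_mult[OF diffs(3) v(1)] cn_isometry[OF n v(1,2)] u(2) by simp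
  then have "(cstar_norm n ((map_mat T U - u) * v))\<^sup>2 \<le> m\<^sup>2"
    using cn_nonneg[OF diffs(2)] by (intro power_mono) auto
  moreover have "(cstar_norm n (map_mat T V - v))\<^sup>2 \<le> m\<^sup>2"
    using cn_nonneg[OF diffs(1)] v(3) by (intro power_mono) auto
  moreover have "(cstar_norm (n + n) Q)\<^sup>2
      \<le> (cstar_norm n (map_mat T V - v))\<^sup>2 + (cstar_norm n ((map_mat T U - u) * v))\<^sup>2"
    unfolding Q_def cn_column[OF diffs(1,2)]
    using diffs by (subst (1 2) cn_cstar[symmetric]) (auto intro!: cn_triangle)
  ultimately have "(cstar_norm (n + n) Q)\<^sup>2 \<le> (sqrt 2 * m)\<^sup>2"
    by (simp add: power_mult_distrib)
  then have Q: "cstar_norm (n + n) Q \<le> sqrt 2 * m"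
    using m0 by (intro power2_le_imp_le[of "cstar_norm (n + n) Q"]) auto
  have P_eq: "P = (P + Q) + (-1) *\<^sub>m Q"
    using P_in Q_in by (auto intro!: eq_matI simp: scaleC_minus_one)
  have "cstar_norm (n + n) P \<le> cstar_norm (n + n) (P + Q) + cstar_norm (n + n) Q"
    using P_in Q_in cn_triangle[of "P + Q" "n + n" "(-1) *\<^sub>m Q"]
    by (subst P_eq) (simp add: cn_scale)
  also have "\<dots> \<le> 2 * (S + m / sqrt 2)"
  proof -
    have "2 * (S + m / sqrt 2) = 2 * S + sqrt 2 * m" by (simp add: field_simps)
    then show ?thesis using PQ Q by simp
  qed
  finally have "(cstar_norm (n + n) P)\<^sup>2 \<le> (2 * (S + m / sqrt 2))\<^sup>2"
    using cn_nonneg[OF P_in] by (intro power_mono)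
  moreover have "4 + (cstar_norm n D)\<^sup>2 \<le> (cstar_norm (n + n) P)\<^sup>2"
  proof -
    let ?D = "(1/2) *\<^sub>m D"
    have "4 + (cstar_norm n D)\<^sup>2 = 4 * (1 + (cstar_norm n ?D)\<^sup>2)"
      using D by (simp add: cn_scale power_divide norm_divide)
    also have "\<dots> \<le> 4 * cstar_norm n (?I + mat_star ?D * ?D)"
      using one_plus_cn_le[OF n, of ?D] D by simp
    also have "\<dots> = cstar_norm n (4 *\<^sub>m (?I + mat_star ?D * ?D))"
      using D by (simp add: cn_scale)
    also have "4 *\<^sub>m (?I + mat_star ?D * ?D) = mat_star (2 *\<^sub>m v) * (2 *\<^sub>m v) + mat_star D * D"
    proof -
      have "mat_star ?D * ?D = (1/4) *\<^sub>m (mat_star D * D)"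
        using D by (simp add: mat_star_scale mscale_mult_left[of _ n n _ n]
            mscale_mult_right[of _ n n _ n] mscale_mscale)
      moreover have "mat_star (2 *\<^sub>m v) * (2 *\<^sub>m v) = 4 *\<^sub>m ?I"
        using v by (simp add: mat_star_scale mscale_mult_left[of _ n n _ n]
            mscale_mult_right[of _ n n _ n] mscale_mscale)
      ultimately show ?thesis
        using D by (auto intro!: eq_matI simp: scaleC_add_right scaleC_scaleC scaleC_one
            simp del: index_mult_mat(1))
    qed
    also have "cstar_norm n \<dots> = (cstar_norm (n + n) P)\<^sup>2"
      unfolding P_def using cn_column[of "2 *\<^sub>m v" n D] v D by simp
    finally show ?thesis .
  qed
  ultimately have "(cstar_norm n D)\<^sup>2 \<le> 4 * ((S + m / sqrt 2)\<^sup>2 - 1)"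
    unfolding power_mult_distrib by simp
  then have "cstar_norm n D \<le> sqrt (4 * ((S + m / sqrt 2)\<^sup>2 - 1))" by (rule real_le_rsqrt)
  also have "\<dots> = k" unfolding k_def real_sqrt_mult by simp
  finally show ?thesis by (simp add: D_def)
qed

end

context near_isomorphism
begin

section \<open>From isometries to contractions\<close>

text \<open>
The bound for the defect of multiplicativity.
\<close>

definition K :: real where "K = k + m * (1 + S)"

text \<open>
The three errors come from \<open>T (U V)\<close> against \<open>u v\<close>, from \<open>u\<close> against \<open>T U\<close>, and from \<open>v\<close> against \<open>T V\<close>.
\<close>

lemma multiplicativity_on_isometries:
  assumes n: "1 \<le> n"
    and U: "U \<in> carrier_mat n n" "mat_star U * U = 1\<^sub>m n"
    and V: "V \<in> carrier_mat n n" "mat_star V * V = 1\<^sub>m n"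
  shows "cstar_norm n (map_mat T (U * V) - map_mat T U * map_mat T V) \<le> K"
proof -
  obtain u where u: "u \<in> carrier_mat n n" "mat_star u * u = 1\<^sub>m n" "cstar_norm n (map_mat T U - u) \<le> m"
    using image_near_isometry[OF n U] .
  obtain v where v: "v \<in> carrier_mat n n" "mat_star v * v = 1\<^sub>m n" "cstar_norm n (map_mat T V - v) \<le> m"
    using image_near_isometry[OF n V] .
  let ?A = "map_mat T U" and ?B = "map_mat T V" and ?C = "map_mat T (U * V)"
  have carr: "?A \<in> carrier_mat n n" "?B \<in> carrier_mat n n" "?C \<in> carrier_mat n n"
    "u * v \<in> carrier_mat n n" "?A - u \<in> carrier_mat n n" "?B - v \<in> carrier_mat n n"
    "u * v - ?C \<in> carrier_mat n n" "(?A - u) * v \<in> carrier_mat n n" "?A * (?B - v) \<in> carrier_mat n n"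
    using U V u v by (auto intro!: minus_carrier_mat mult_carrier_mat)
  have split: "?C - ?A * ?B = (-1) *\<^sub>m ((u * v - ?C) + ((?A - u) * v + ?A * (?B - v)))"
  proof -
    have 1: "(?A - u) * v = ?A * v - u * v" using carr u v by (intro minus_mult_distrib_mat[of _ n n])
    have 2: "?A * (?B - v) = ?A * ?B - ?A * v" using carr u v by (intro mult_minus_distrib_mat[of _ n n])
    show ?thesis unfolding 1 2
      using carr u v U V
      by (auto intro!: eq_matI simp: scaleC_minus_one simp del: index_mult_mat(1))
  qed
  have "cstar_norm n (?C - ?A * ?B) = cstar_norm n ((u * v - ?C) + ((?A - u) * v + ?A * (?B - v)))"
    unfolding split using carr by (simp add: cn_scale)
  also have "\<dots> \<le> cstar_norm n (u * v - ?C) + (cstar_norm n ((?A - u) * v) + cstar_norm n (?A * (?B - v)))"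
    using carr by (intro order_trans[OF cn_triangle] add_left_mono cn_triangle) auto
  also have "\<dots> \<le> k + (m * 1 + S * m)"
  proof (intro add_mono)
    show "cstar_norm n (u * v - ?C) \<le> k"
      by (rule product_estimate[OF n U V u(1,3) v])
    show "cstar_norm n ((?A - u) * v) \<le> m * 1"
      using cn_mult[OF carr(5) v(1)] cn_isometry[OF n v(1,2)] u(3) by simp
    have "cstar_norm n ?A \<le> S" using T_bound[OF n U(1)] cn_isometry[OF n U] by simp
    then have "cstar_norm n ?A * cstar_norm n (?B - v) \<le> S * m"
      using v(3) cn_nonneg[OF carr(6)] S_ge_1 by (intro mult_mono) auto
    then show "cstar_norm n (?A * (?B - v)) \<le> S * m"
      using cn_mult[OF carr(1) carr(6)] by simp
  qed
  also have "\<dots> = K" by (simp add: K_def algebra_simps)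
  finally show ?thesis .
qed

text \<open>
Applied to \<open>U\<close> and \<open>U\<^sup>*\<close>, whose product is \<open>1\<close>, the product estimate bounds \<open>u v - 1\<close>; multiplication by the
contraction \<open>u\<^sup>*\<close> bounds \<open>v - u\<^sup>*\<close>.
\<close>

lemma symmetry_on_unitaries:
  assumes n: "1 \<le> n" and U: "U \<in> carrier_mat n n" "mat_star U * U = 1\<^sub>m n" "U * mat_star U = 1\<^sub>m n"
  shows "cstar_norm n (map_mat (\<lambda>x. T x - star_map T x) U) \<le> k + 2 * m"
proof -
  let ?V = "mat_star U"
  have V: "?V \<in> carrier_mat n n" "mat_star ?V * ?V = 1\<^sub>m n" using U by simp_all
  obtain u where u: "u \<in> carrier_mat n n" "mat_star u * u = 1\<^sub>m n" "cstar_norm n (map_mat T U - u) \<le> m"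
    using image_near_isometry[OF n U(1,2)] .
  obtain v where v: "v \<in> carrier_mat n n" "mat_star v * v = 1\<^sub>m n" "cstar_norm n (map_mat T ?V - v) \<le> m"
    using image_near_isometry[OF n V] .
  let ?A = "map_mat T U" and ?B = "map_mat T ?V"
  have carr: "?A \<in> carrier_mat n n" "?B \<in> carrier_mat n n" "u * v \<in> carrier_mat n n"
    "?A - u \<in> carrier_mat n n" "?B - v \<in> carrier_mat n n" "u * v - 1\<^sub>m n \<in> carrier_mat n n"
    "v - mat_star u \<in> carrier_mat n n" "mat_star u \<in> carrier_mat n n"
    using U V u v by (auto intro!: minus_carrier_mat mult_carrier_mat)
  have "cstar_norm n (u * v - map_mat T (U * ?V)) \<le> k"
    by (rule product_estimate[OF n U(1,2) V u(1,3) v])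
  then have uv: "cstar_norm n (u * v - 1\<^sub>m n) \<le> k"
    by (simp add: U(3) map_mat_one[OF lin T_one])
  have "mat_star u * (u * v - 1\<^sub>m n) = mat_star u * (u * v) - mat_star u * 1\<^sub>m n"
    using u v by (intro mult_minus_distrib_mat[of _ n n]) auto
  also have "mat_star u * (u * v) = v"
    using u v by (simp flip: assoc_mult_mat[of _ n n _ n _ n])
  finally have "v - mat_star u = mat_star u * (u * v - 1\<^sub>m n)" using u by simp
  then have "cstar_norm n (v - mat_star u) \<le> cstar_norm n (mat_star u) * cstar_norm n (u * v - 1\<^sub>m n)"
    using cn_mult[OF carr(8) carr(6)] by simp
  then have vu: "cstar_norm n (v - mat_star u) \<le> k"
    using uv u n by (simp add: cn_star cn_isometry)
  have eq: "map_mat (\<lambda>x. T x - star_map T x) U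
      = (?A - u) + (-1) *\<^sub>m mat_star ((?B - v) + (v - mat_star u))"
    using U u v by (auto intro!: eq_matI simp: star_map_def scaleC_minus_one star_diff star_add star_star)
  have "cstar_norm n (map_mat (\<lambda>x. T x - star_map T x) U)
      \<le> cstar_norm n (?A - u) + cstar_norm n ((?B - v) + (v - mat_star u))"
    unfolding eq using carr n
    by (intro order_trans[OF cn_triangle]) (auto simp: cn_scale cn_star)
  also have "\<dots> \<le> cstar_norm n (?A - u) + (cstar_norm n (?B - v) + cstar_norm n (v - mat_star u))"
    using carr by (intro add_left_mono cn_triangle) auto
  also have "\<dots> \<le> k + 2 * m" using u(3) v(3) vu by simp
  finally show ?thesis .
qed

lemma linear_minus_star_map: "complex_linear (\<lambda>x. T x - star_map T x)"
  unfolding complex_linear_iff star_map_def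
  by (simp add: clin_add[OF lin] clin_scale[OF lin] star_add star_scaleC scaleC_diff_right)

lemma symmetry_on_contractions:
  assumes n: "1 \<le> n" and X: "X \<in> carrier_mat n n" "cstar_norm n X \<le> 1"
  shows "cstar_norm n (map_mat (\<lambda>x. T x - star_map T x) X) \<le> k + 2 * m"
proof -
  let ?f = "\<lambda>x. T x - star_map T x"
  let ?H = "block (0\<^sub>m n n) X (mat_star X) (0\<^sub>m n n)"
  obtain U where U: "U \<in> carrier_mat (n + n) (n + n)" "mat_star U * U = 1\<^sub>m (n + n)"
    "U * mat_star U = 1\<^sub>m (n + n)" "?H = (1/2) *\<^sub>m (U + mat_star U)"
    using selfadjoint_dilation[OF n X] .
  have nn: "1 \<le> n + n" using n by simp
  have "map_mat ?f ?H = (1/2) *\<^sub>m (map_mat ?f U + map_mat ?f (mat_star U))"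
    unfolding U(4) using U(1)
    by (simp add: map_mat_scale[OF linear_minus_star_map] map_mat_add[OF linear_minus_star_map, of _ "n + n" "n + n"])
  then have "cstar_norm (n + n) (map_mat ?f ?H)
      = cstar_norm (n + n) (map_mat ?f U + map_mat ?f (mat_star U)) / 2"
    using U(1) by (simp add: cn_scale norm_divide)
  also have "\<dots> \<le> (cstar_norm (n + n) (map_mat ?f U) + cstar_norm (n + n) (map_mat ?f (mat_star U))) / 2"
    using U(1) by (intro divide_right_mono cn_triangle) auto
  also have "\<dots> \<le> k + 2 * m"
    using symmetry_on_unitaries[OF nn U(1-3)] symmetry_on_unitaries[OF nn, of "mat_star U"] U by simp
  finally have "cstar_norm (n + n) (map_mat ?f ?H) \<le> k + 2 * m" .
  moreover have "map_mat ?f ?H = block (map_mat ?f (0\<^sub>m n n)) (map_mat ?f X) (map_mat ?f (mat_star X)) (map_mat ?f (0\<^sub>m n n))"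
    using X by (intro map_mat_block) auto
  ultimately show ?thesis
    using cn_block_upper_right[OF _ _ _ _ n, of "map_mat ?f (0\<^sub>m n n)" "map_mat ?f X"
        "map_mat ?f (mat_star X)" "map_mat ?f (0\<^sub>m n n)"] X by simp
qed

text \<open>
The amplification of the defect of multiplicativity, as a bilinear map on matrices.
\<close>

definition defect :: "'a mat \<Rightarrow> 'a mat \<Rightarrow> 'b mat" where
  "defect X Y = map_mat T (X * Y) - map_mat T X * map_mat T Y"

lemma defect_carrier [simp]:
  "X \<in> carrier_mat n n \<Longrightarrow> Y \<in> carrier_mat n n \<Longrightarrow> defect X Y \<in> carrier_mat n n"
  unfolding defect_def by (intro minus_carrier_mat mult_carrier_mat[of _ n n]) auto

lemma defect_add_left:
  assumes "X \<in> carrier_mat n n" "X' \<in> carrier_mat n n" "Y \<in> carrier_mat n n"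
  shows "defect (X + X') Y = defect X Y + defect X' Y"
proof -
  have "map_mat T ((X + X') * Y) = map_mat T (X * Y) + map_mat T (X' * Y)"
    using assms by (subst add_mult_distrib_mat[of _ n n]) (auto simp: map_mat_add[OF lin, of _ n n])
  moreover have "map_mat T (X + X') * map_mat T Y = map_mat T X * map_mat T Y + map_mat T X' * map_mat T Y"
    using assms by (simp add: map_mat_add[OF lin, of _ n n] add_mult_distrib_mat[of _ n n])
  ultimately show ?thesis
    unfolding defect_def using assms by (auto intro!: eq_matI simp del: index_mult_mat(1))
qed

lemma defect_add_right:
  assumes "X \<in> carrier_mat n n" "Y \<in> carrier_mat n n" "Y' \<in> carrier_mat n n"
  shows "defect X (Y + Y') = defect X Y + defect X Y'"
proof -
  have "map_mat T (X * (Y + Y')) = map_mat T (X * Y) + map_mat T (X * Y')"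
    using assms by (subst mult_add_distrib_mat[of _ n n]) (auto simp: map_mat_add[OF lin, of _ n n])
  moreover have "map_mat T X * map_mat T (Y + Y') = map_mat T X * map_mat T Y + map_mat T X * map_mat T Y'"
    using assms by (simp add: map_mat_add[OF lin, of _ n n] mult_add_distrib_mat[of _ n n])
  ultimately show ?thesis
    unfolding defect_def using assms by (auto intro!: eq_matI simp del: index_mult_mat(1))
qed

lemma defect_scale:
  assumes "X \<in> carrier_mat n n" "Y \<in> carrier_mat n n"
  shows "defect (c *\<^sub>m X) Y = c *\<^sub>m defect X Y" "defect X (c *\<^sub>m Y) = c *\<^sub>m defect X Y"
  unfolding defect_def using assms
  by (auto intro!: eq_matI simp: mscale_mult_left[of _ n n _ n] mscale_mult_right[of _ n n _ n]
      map_mat_scale[OF lin] scaleC_diff_right clin_scale[OF lin] simp del: index_mult_mat(1))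

lemma cn_half_sum_le:
  assumes "A \<in> carrier_mat n n" "B \<in> carrier_mat n n" "cstar_norm n A \<le> r" "cstar_norm n B \<le> r"
  shows "cstar_norm n ((1/2) *\<^sub>m (A + B)) \<le> r"
  using assms cn_triangle[of A n B] by (simp add: cn_scale norm_divide)

text \<open>
The dilations of \<open>X\<close> and \<open>Y\<^sup>*\<close> have the off-diagonal entries \<open>X, X\<^sup>*\<close> and \<open>Y\<^sup>*, Y\<close>, so \<open>X Y\<close> is the upper
left corner of their product and the defect of \<open>X\<close>, \<open>Y\<close> is the upper left corner of their defect.  The
latter is an average of four defects of unitaries.
\<close>

lemma multiplicativity_on_contractions:
  assumes n: "1 \<le> n" and X: "X \<in> carrier_mat n n" "cstar_norm n X \<le> 1"
    and Y: "Y \<in> carrier_mat n n" "cstar_norm n Y \<le> 1"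
  shows "cstar_norm n (defect X Y) \<le> K"
proof -
  let ?O = "0\<^sub>m n n"
  let ?G = "block ?O X (mat_star X) ?O" and ?H = "block ?O (mat_star Y) Y ?O"
  have nn: "1 \<le> n + n" using n by simp
  obtain U where U: "U \<in> carrier_mat (n + n) (n + n)" "mat_star U * U = 1\<^sub>m (n + n)"
    "U * mat_star U = 1\<^sub>m (n + n)" "?G = (1/2) *\<^sub>m (U + mat_star U)"
    using selfadjoint_dilation[OF n X] .
  have Y': "mat_star Y \<in> carrier_mat n n" "cstar_norm n (mat_star Y) \<le> 1"
    using Y n by (simp_all add: cn_star)
  obtain V where V: "V \<in> carrier_mat (n + n) (n + n)" "mat_star V * V = 1\<^sub>m (n + n)"
    "V * mat_star V = 1\<^sub>m (n + n)" "?H = (1/2) *\<^sub>m (V + mat_star V)"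
    using selfadjoint_dilation[OF n Y'] by auto
  have iso: "cstar_norm (n + n) (defect A B) \<le> K"
    if "A \<in> {U, mat_star U}" "B \<in> {V, mat_star V}" for A B
    unfolding defect_def using that U V by (intro multiplicativity_on_isometries[OF nn]) auto
  have half: "cstar_norm (n + n) (defect A ?H) \<le> K" if A: "A \<in> {U, mat_star U}" for A
  proof -
    have "A \<in> carrier_mat (n + n) (n + n)" using A U by auto
    then have "defect A ?H = (1/2) *\<^sub>m (defect A V + defect A (mat_star V))"
      unfolding V(4) using V(1) by (simp add: defect_scale[of _ "n + n"] defect_add_right[of _ "n + n"])
    then show ?thesis
      using iso[OF A] A U(1) V(1) by (auto intro!: cn_half_sum_le)
  qed
  have H: "?H \<in> carrier_mat (n + n) (n + n)" by simp
  then have "defect ?G ?H = (1/2) *\<^sub>m (defect U ?H + defect (mat_star U) ?H)"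
    unfolding U(4) using U(1) by (simp add: defect_scale[of _ "n + n"] defect_add_left[of _ "n + n"])
  then have GH: "cstar_norm (n + n) (defect ?G ?H) \<le> K"
    using half U(1) H by (auto intro!: cn_half_sum_le)
  have "?G * ?H = block (X * Y) ?O ?O (mat_star X * mat_star Y)"
    using X Y by (simp add: block_mult[of _ n])
  then have TGH: "map_mat T (?G * ?H) = block (map_mat T (X * Y)) ?O ?O (map_mat T (mat_star X * mat_star Y))"
    using X Y by (simp add: map_mat_block[of _ n] map_mat_zero[OF lin])
  have TG_TH: "map_mat T ?G * map_mat T ?H
      = block (map_mat T X * map_mat T Y) ?O ?O (map_mat T (mat_star X) * map_mat T (mat_star Y))"
    using X Y by (simp add: map_mat_block[of _ n] map_mat_zero[OF lin] block_mult[of _ n])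
  have "defect ?G ?H = block (defect X Y) ?O ?O (defect (mat_star X) (mat_star Y))"
    unfolding defect_def TGH TG_TH using X Y
    by (auto intro!: eq_matI simp del: index_mult_mat(1))
  then show ?thesis
    using cn_block_upper_left[OF _ _ _ _ n, of "defect X Y" ?O ?O "defect (mat_star X) (mat_star Y)"] X Y GH
    by simp
qed

lemma K_nonneg: "0 \<le> K"
  using multiplicativity_on_contractions[of 1 "0\<^sub>m 1 1" "0\<^sub>m 1 1"] cn_nonneg[of "defect (0\<^sub>m 1 1) (0\<^sub>m 1 1)" 1]
  by (simp add: cn_zero)

lemma defect_bound:
  assumes n: "1 \<le> n" and X: "X \<in> carrier_mat n n" and Y: "Y \<in> carrier_mat n n"
  shows "cstar_norm n (defect X Y) \<le> K * (cstar_norm n X * cstar_norm n Y)"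
proof (cases "cstar_norm n X = 0 \<or> cstar_norm n Y = 0")
  case True
  then have "X = 0\<^sub>m n n \<or> Y = 0\<^sub>m n n" using X Y by (simp add: cn_eq_0)
  then have "defect X Y = 0\<^sub>m n n"
    using X Y by (auto simp: defect_def map_mat_zero[OF lin] intro!: eq_matI simp del: index_mult_mat(1))
  then show ?thesis using True by (auto simp: cn_zero)
next
  case False
  define a b where "a = cstar_norm n X" and "b = cstar_norm n Y"
  have ab: "a > 0" "b > 0"
    using False cn_nonneg[OF X] cn_nonneg[OF Y] by (simp_all add: a_def b_def order_less_le)
  have "cstar_norm n (defect (of_real (1/a) *\<^sub>m X) (of_real (1/b) *\<^sub>m Y)) \<le> K"
    using X Y ab n
    by (intro multiplicativity_on_contractions) (auto simp: cn_scale norm_divide a_def b_def)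
  then have "cstar_norm n (defect X Y) / (a * b) \<le> K"
    using X Y ab by (simp add: defect_scale[of _ n] cn_scale norm_divide mult.commute)
  then show ?thesis using ab by (simp add: field_simps a_def b_def)
qed

end

section \<open>The Haagerup norm\<close>

lemma rect_norm_nonneg: "0 \<le> rect_norm X"
  unfolding rect_norm_pad by (rule cn_nonneg) simp

lemma tensor_zero_left: "0 \<otimes>\<^sub>t b = 0"
  by transfer (rule tensor_rel.zero)

lemma tensor_scale_swap: "(c *\<^sub>C a) \<otimes>\<^sub>t b = a \<otimes>\<^sub>t (c *\<^sub>C b)"
  by transfer (rule tensor_rel.scale)

lemma tensor_zero_right: "a \<otimes>\<^sub>t 0 = 0"
  using tensor_scale_swap[of 0 a 0] by (simp add: tensor_zero_left)

lemma sum_lessThan_add: "(\<Sum>k<p + (q::nat). f k) = (\<Sum>k<p. f k) + (\<Sum>k<q. f (p + k) :: 'a::comm_monoid_add)"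
  by (induction q) (simp_all add: add.assoc)

lemma tensor_mat_prod_index:
  "i < dim_row X \<Longrightarrow> j < dim_col Y \<Longrightarrow> (X \<odot>\<^sub>h Y) $$ (i, j) = (\<Sum>k<dim_col X. X $$ (i, k) \<otimes>\<^sub>t Y $$ (k, j))"
  by (simp add: tensor_mat_prod_def)

lemma tensor_mat_prod_dim [simp]: "dim_row (X \<odot>\<^sub>h Y) = dim_row X" "dim_col (X \<odot>\<^sub>h Y) = dim_col Y"
  by (simp_all add: tensor_mat_prod_def)

text \<open>
The Haagerup norm is an infimum over the factorisations; it would be meaningless for a matrix
without any.
\<close>

definition factorable :: "nat \<Rightarrow> ('a::complex_vector, 'b::complex_vector) tensor mat \<Rightarrow> bool" where
  "factorable n U \<longleftrightarrow> (\<exists>p X Y. X \<in> carrier_mat n p \<and> Y \<in> carrier_mat p n \<and> X \<odot>\<^sub>h Y = U)"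

lemma factorable_zero: "factorable n (0\<^sub>m n n)"
  unfolding factorable_def
  by (rule exI[of _ 0], rule exI[of _ "0\<^sub>m n 0"], rule exI[of _ "0\<^sub>m 0 n"])
    (auto intro!: eq_matI simp: tensor_mat_prod_index)

text \<open>
The factors are placed side by side and on top of each other.
\<close>

lemma factorable_add:
  assumes "factorable n U" "factorable n V"
  shows "factorable n (U + V)"
proof -
  obtain p X Y where X: "X \<in> carrier_mat n p" "Y \<in> carrier_mat p n" "X \<odot>\<^sub>h Y = U"
    using assms(1) by (auto simp: factorable_def)
  obtain q A B where A: "A \<in> carrier_mat n q" "B \<in> carrier_mat q n" "A \<odot>\<^sub>h B = V"
    using assms(2) by (auto simp: factorable_def)
  define P where "P = mat n (p + q) (\<lambda>(i, k). if k < p then X $$ (i, k) else A $$ (i, k - p))"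
  define Q where "Q = mat (p + q) n (\<lambda>(k, j). if k < p then Y $$ (k, j) else B $$ (k - p, j))"
  have "P \<odot>\<^sub>h Q = U + V"
  proof (rule eq_matI)
    fix i j assume "i < dim_row (U + V)" "j < dim_col (U + V)"
    then have ij: "i < n" "j < n" using X A by auto
    have "(P \<odot>\<^sub>h Q) $$ (i, j) = (\<Sum>k<p + q. P $$ (i, k) \<otimes>\<^sub>t Q $$ (k, j))"
      using ij by (simp add: tensor_mat_prod_index P_def Q_def)
    also have "\<dots> = (\<Sum>k<p. X $$ (i, k) \<otimes>\<^sub>t Y $$ (k, j)) + (\<Sum>k<q. A $$ (i, k) \<otimes>\<^sub>t B $$ (k, j))"
      unfolding sum_lessThan_add using ij
      by (intro arg_cong2[of _ _ _ _ "(+)"] sum.cong) (auto simp: P_def Q_def)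
    also have "\<dots> = U $$ (i, j) + V $$ (i, j)"
      using ij X A by (auto simp: tensor_mat_prod_index)
    finally show "(P \<odot>\<^sub>h Q) $$ (i, j) = (U + V) $$ (i, j)"
      using ij X A by auto
  qed (use X A in \<open>auto simp: P_def Q_def\<close>)
  then show ?thesis
    unfolding factorable_def
    by (intro exI[of _ "p + q"] exI[of _ P] exI[of _ Q]) (auto simp: P_def Q_def)
qed

lemma factorable_entry:
  fixes u :: "('a::complex_vector, 'b::complex_vector) tensor"
  shows "factorable n (mat n n (\<lambda>ij. if ij = (a, b) then u else 0))"
proof -
  have elementary: "factorable n (mat n n (\<lambda>ij. if ij = (a, b) then x \<otimes>\<^sub>t y else 0))"
    for x :: 'a and y :: 'b
    unfolding factorable_def
    by (rule exI[of _ 1], rule exI[of _ "mat n 1 (\<lambda>(i, k). if i = a then x else 0)"],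
        rule exI[of _ "mat 1 n (\<lambda>(k, j). if j = b then y else 0)"])
      (auto intro!: eq_matI simp: tensor_mat_prod_index tensor_zero_left tensor_zero_right)
  obtain s :: "('a \<times> 'b) multiset" where "u = abs_tensor s" by (metis Quotient3_abs_rep[OF Quotient3_tensor])
  moreover have "factorable n (mat n n (\<lambda>ij. if ij = (a, b) then abs_tensor s else 0))"
    for s :: "('a \<times> 'b) multiset"
  proof (induction s)
    case empty
    have "mat n n (\<lambda>ij. if ij = (a, b) then abs_tensor {#} else 0) = (0\<^sub>m n n :: ('a, 'b) tensor mat)"
      by (intro eq_matI) (auto simp: zero_tensor.abs_eq)
    then show ?case using factorable_zero by (simp only:)
  next
    case (add xy s)
    obtain x y where xy: "xy = (x, y)" by (cases xy)
    have "abs_tensor (add_mset xy s) = x \<otimes>\<^sub>t y + abs_tensor s"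
      by (simp add: xy tensor.abs_eq plus_tensor.abs_eq)
    then have "mat n n (\<lambda>ij. if ij = (a, b) then abs_tensor (add_mset xy s) else 0)
        = mat n n (\<lambda>ij. if ij = (a, b) then x \<otimes>\<^sub>t y else 0)
          + mat n n (\<lambda>ij. if ij = (a, b) then abs_tensor s else 0)"
      by (intro eq_matI) auto
    then show ?case using factorable_add[OF elementary add] by (simp only:)
  qed
  ultimately show ?thesis by blast
qed

lemma factorable_mat:
  assumes U: "U \<in> carrier_mat n n"
  shows "factorable n U"
proof -
  have "factorable n (mat n n (\<lambda>ij. if ij \<in> A then U $$ ij else 0))"
    if "finite A" for A
    using that
  proof (induction A)
    case empty
    have "mat n n (\<lambda>ij. if ij \<in> {} then U $$ ij else 0) = 0\<^sub>m n n" by (intro eq_matI) auto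
    then show ?case using factorable_zero by (simp only:)
  next
    case (insert ab A)
    obtain a b where ab: "ab = (a, b)" by (cases ab)
    have "mat n n (\<lambda>ij. if ij \<in> insert ab A then U $$ ij else 0)
        = mat n n (\<lambda>ij. if ij = (a, b) then U $$ ab else 0) + mat n n (\<lambda>ij. if ij \<in> A then U $$ ij else 0)"
      using insert(2) by (intro eq_matI) (auto simp: ab)
    then show ?case using factorable_add[OF factorable_entry insert(3)] by (simp only:)
  qed
  from this[of "{..<n} \<times> {..<n}"] 
  have "factorable n (mat n n (\<lambda>ij. if ij \<in> {..<n} \<times> {..<n} then U $$ ij else 0))" by simp
  also have "mat n n (\<lambda>ij. if ij \<in> {..<n} \<times> {..<n} then U $$ ij else 0) = U"
    using U by (intro eq_matI) auto
  finally show ?thesis .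
qed

text \<open>
To bound a quantity on the unit ball of the Haagerup norm, it is enough to bound it by the product
of norms in each factorisation.
\<close>

lemma haagerup_bound:
  assumes U: "U \<in> carrier_mat n n" "haagerup_norm n U \<le> 1" and K: "0 \<le> K"
    and bound: "\<And>p X Y. X \<in> carrier_mat n p \<Longrightarrow> Y \<in> carrier_mat p n \<Longrightarrow> X \<odot>\<^sub>h Y = U \<Longrightarrow>
      r \<le> K * (rect_norm X * rect_norm Y)"
  shows "r \<le> K"
proof (rule field_le_epsilon)
  fix d :: real assume d: "0 < d"
  define A where "A = {rect_norm X * rect_norm Y | p X Y.
            X \<in> carrier_mat n p \<and> Y \<in> carrier_mat p n \<and> X \<odot>\<^sub>h Y = U}"
  have ne: "A \<noteq> {}"
    using factorable_mat[OF U(1)] unfolding A_def factorable_def by blast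
  have bdd: "bdd_below A"
    unfolding A_def by (rule bdd_belowI[of _ 0]) (auto intro!: mult_nonneg_nonneg rect_norm_nonneg)
  have "0 < d / (K + 1)" using d K by simp
  then have "Inf A < 1 + d / (K + 1)"
    using U(2) unfolding haagerup_norm_def A_def[symmetric] by linarith
  then obtain a where a: "a \<in> A" "a < 1 + d / (K + 1)"
    using cInf_less_iff[OF ne bdd] by blast
  then have "r \<le> K * a" using bound unfolding A_def by blast
  also have "\<dots> \<le> K * (1 + d / (K + 1))" using a K by (intro mult_left_mono) auto
  also have "\<dots> \<le> K + d" using K d by (simp add: field_simps)
  finally show "r \<le> K + d" .
qed

lemma haagerup_norm_zero_le: "haagerup_norm n (0\<^sub>m n n :: ('a::unital_cstar_algebra, 'b::unital_cstar_algebra) tensor mat) \<le> 0"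
proof -
  have "(0::real) \<in> {rect_norm X * rect_norm Y | p X Y.
            X \<in> carrier_mat n p \<and> Y \<in> carrier_mat p n \<and> X \<odot>\<^sub>h Y = (0\<^sub>m n n :: ('a, 'b) tensor mat)}"
  proof -
    have "pad n (0\<^sub>m n 0) = (0\<^sub>m n n :: 'a mat)" by (intro eq_matI) auto
    then have "rect_norm (0\<^sub>m n 0 :: 'a mat) = 0"
      by (simp add: rect_norm_pad cn_zero)
    moreover have "0\<^sub>m n 0 \<odot>\<^sub>h 0\<^sub>m 0 n = (0\<^sub>m n n :: ('a, 'b) tensor mat)"
      by (intro eq_matI) (auto simp: tensor_mat_prod_index)
    ultimately show ?thesis
      by (intro CollectI exI[of _ 0] exI[of _ "0\<^sub>m n 0"] exI[of _ "0\<^sub>m 0 n"]) simp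
  qed
  then show ?thesis
    unfolding haagerup_norm_def
    by (rule cInf_lower) (rule bdd_belowI[of _ 0], auto intro!: mult_nonneg_nonneg rect_norm_nonneg)
qed

section \<open>The two completely bounded norms\<close>

context near_isomorphism
begin

lemma complex_bilinear_mult_defect: "complex_bilinear (mult_defect T)"
  unfolding complex_bilinear_def complex_linear_iff mult_defect_def
  by (simp add: clin_add[OF lin] clin_scale[OF lin] distrib_left distrib_right mult_scaleC_left
      mult_scaleC_right scaleC_diff_right)

lemma lift_mult_defect:
  assumes X: "X \<in> carrier_mat n p" and Y: "Y \<in> carrier_mat p n"
  shows "map_mat (tensor_lift (mult_defect T)) (X \<odot>\<^sub>h Y) = map_mat T (X * Y) - map_mat T X * map_mat T Y"
proof (rule eq_matI)
  note bil = complex_bilinear_mult_defect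
  fix i j assume "i < dim_row (map_mat T (X * Y) - map_mat T X * map_mat T Y)"
    "j < dim_col (map_mat T (X * Y) - map_mat T X * map_mat T Y)"
  then have ij: "i < n" "j < n" using X Y by auto
  have "map_mat (tensor_lift (mult_defect T)) (X \<odot>\<^sub>h Y) $$ (i, j)
      = (\<Sum>k<p. mult_defect T (X $$ (i, k)) (Y $$ (k, j)))"
    using X Y ij
    by (simp add: tensor_mat_prod_index clin_sum[OF complex_linear_tensor_lift[OF bil]] tensor_lift_tensor[OF bil])
  also have "\<dots> = T ((X * Y) $$ (i, j)) - (map_mat T X * map_mat T Y) $$ (i, j)"
    using X Y ij
    by (simp add: mult_mat_index[of _ n p _ n] mult_defect_def sum_subtractf clin_sum[OF lin]
        del: index_mult_mat(1))
  finally show "map_mat (tensor_lift (mult_defect T)) (X \<odot>\<^sub>h Y) $$ (i, j)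
      = (map_mat T (X * Y) - map_mat T X * map_mat T Y) $$ (i, j)"
    using X Y ij by (simp del: index_mult_mat(1))
qed (use X Y in auto)

text \<open>
Padding turns the factors into square matrices of size \<open>max n p\<close> without changing their norms, and
the defect of the padded matrices is the padded defect.
\<close>

lemma lift_mult_defect_bound:
  assumes n: "1 \<le> n" and X: "X \<in> carrier_mat n p" and Y: "Y \<in> carrier_mat p n"
  shows "cstar_norm n (map_mat (tensor_lift (mult_defect T)) (X \<odot>\<^sub>h Y)) \<le> K * (rect_norm X * rect_norm Y)"
proof -
  define q where "q = max n p"
  have q: "1 \<le> q" "n \<le> q" "p \<le> q" using n by (auto simp: q_def)
  let ?Z = "map_mat T (X * Y) - map_mat T X * map_mat T Y"
  have TXY: "map_mat T X * map_mat T Y \<in> carrier_mat n n" using X Y by (intro mult_carrier_mat) auto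
  then have Z: "?Z \<in> carrier_mat n n" by (rule minus_carrier_mat)
  have "pad q ?Z = defect (pad q X) (pad q Y)"
  proof -
    have "pad q ?Z = pad q (map_mat T (X * Y)) - pad q (map_mat T X * map_mat T Y)"
      using X Y TXY by (intro pad_diff[of _ n n]) auto
    also have "pad q (map_mat T (X * Y)) = map_mat T (pad q X * pad q Y)"
      using X Y q by (simp add: pad_mult[of _ n p _ n] map_mat_pad[OF lin])
    also have "pad q (map_mat T X * map_mat T Y) = map_mat T (pad q X) * map_mat T (pad q Y)"
      using X Y q by (simp add: pad_mult[of _ n p _ n] map_mat_pad[OF lin])
    finally show ?thesis by (simp add: defect_def)
  qed
  then have "cstar_norm n ?Z = cstar_norm q (defect (pad q X) (pad q Y))"
    using cn_pad[OF Z q(2)] by simp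
  also have "\<dots> \<le> K * (cstar_norm q (pad q X) * cstar_norm q (pad q Y))"
    by (intro defect_bound q) auto
  also have "\<dots> = K * (rect_norm X * rect_norm Y)"
    using X Y by (simp add: rect_norm_pad q_def max.commute)
  finally show ?thesis by (simp add: lift_mult_defect[OF X Y])
qed

lemma mult_defect_cb:
  "cb_bilinear (mult_defect T)" "cb_bilinear_norm (mult_defect T) \<le> K"
proof -
  note lin_lift = complex_linear_tensor_lift[OF complex_bilinear_mult_defect]
  have bound: "cstar_norm n (map_mat (tensor_lift (mult_defect T)) U) \<le> K"
    if "1 \<le> n" "U \<in> carrier_mat n n" "haagerup_norm n U \<le> 1" for n and U :: "('a, 'a) tensor mat"
  proof (rule haagerup_bound[OF that(2,3) K_nonneg])
    fix p and X Y :: "'a mat"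
    assume XY: "X \<in> carrier_mat n p" "Y \<in> carrier_mat p n" "X \<odot>\<^sub>h Y = U"
    show "cstar_norm n (map_mat (tensor_lift (mult_defect T)) U) \<le> K * (rect_norm X * rect_norm Y)"
      using lift_mult_defect_bound[OF that(1) XY(1,2)] by (simp add: XY(3))
  qed
  have zero: "haagerup_norm 1 (0\<^sub>m 1 1 :: ('a, 'a) tensor mat) \<le> 1"
    using haagerup_norm_zero_le[of 1] by (rule order_trans) simp
  show "cb_bilinear (mult_defect T)"
    unfolding cb_bilinear_def
    using complex_bilinear_mult_defect completely_boundedI[where M = haagerup_norm and N = cstar_norm, OF lin_lift bound zero] by blast
  show "cb_bilinear_norm (mult_defect T) \<le> K"
    unfolding cb_bilinear_norm_def by (rule cb_norm_leI[where M = haagerup_norm and N = cstar_norm, OF lin_lift bound zero])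
qed

lemma minus_star_map_cb:
  "cb_map (\<lambda>x. T x - star_map T x)" "\<parallel>\<lambda>x. T x - star_map T x\<parallel>\<^sub>c\<^sub>b \<le> k + 2 * m"
proof -
  have zero: "cstar_norm 1 (0\<^sub>m 1 1 :: 'a mat) \<le> 1" by (simp add: cn_zero)
  show "cb_map (\<lambda>x. T x - star_map T x)"
    by (rule completely_boundedI[where M = cstar_norm and N = cstar_norm, OF linear_minus_star_map symmetry_on_contractions zero])
  show "\<parallel>\<lambda>x. T x - star_map T x\<parallel>\<^sub>c\<^sub>b \<le> k + 2 * m"
    by (rule cb_norm_leI[where M = cstar_norm and N = cstar_norm, OF linear_minus_star_map symmetry_on_contractions zero])
qed

end

theorem theorem2p7:
  fixes T :: "'a::unital_cstar_algebra \<Rightarrow> 'b::unital_cstar_algebra"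
  assumes "cb_isomorphism T"
    and "T 1 = 1"
    and "\<parallel>T\<parallel>\<^sub>c\<^sub>b * \<parallel>inv_into UNIV T\<parallel>\<^sub>c\<^sub>b < sqrt 2"
  shows "cb_bilinear (mult_defect T) \<and>
    cb_bilinear_norm (mult_defect T)
      \<le> 2 * sqrt ((\<parallel>T\<parallel>\<^sub>c\<^sub>b + mu T / sqrt 2)\<^sup>2 - 1) + mu T * (1 + \<parallel>T\<parallel>\<^sub>c\<^sub>b) \<and>
    cb_map (\<lambda>x. T x - star_map T x) \<and>
    \<parallel>\<lambda>x. T x - star_map T x\<parallel>\<^sub>c\<^sub>b
      \<le> 2 * sqrt ((\<parallel>T\<parallel>\<^sub>c\<^sub>b + mu T / sqrt 2)\<^sup>2 - 1) + 2 * mu T"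
proof -
  have cb: "cb_map T" "cb_map (inv_into UNIV T)" and "bij T"
    using assms(1) by (simp_all add: cb_isomorphism_def)
  interpret near_isomorphism T "inv_into UNIV T" "\<parallel>T\<parallel>\<^sub>c\<^sub>b" "\<parallel>inv_into UNIV T\<parallel>\<^sub>c\<^sub>b"
  proof (rule near_isomorphism.intro)
    show "complex_linear T" "complex_linear (inv_into UNIV T)"
      using cb by (simp_all add: completely_bounded_def)
    show "inv_into UNIV T (T x) = x" for x
      using \<open>bij T\<close> by (simp add: bij_is_inj)
    show "T (inv_into UNIV T y) = y" for y
      using \<open>bij T\<close> by (simp add: bij_is_surj surj_f_inv_f)
  qed (use assms cb cb_norm_bound in auto)
  have "m = mu T" by (simp add: m_def mu_def s_def)
  then show ?thesis
    using mult_defect_cb minus_star_map_cb by (simp add: K_def k_def)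
qed

end
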